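(* Let $p$ be a prime, let $n\ge 1$, and let $V\subseteq\mathbb{G}_a^n\times\mathbb{G}_m^n$ be an irreducible algebraic variety defined over $\overline{\mathbb{Q}}\subset\mathbb{C}_p$ with $\dim V<n$. Assume the $p$-adic Schanuel conjecture: for every $k\geq 1$ and all $\mathbb{Q}$-linearly independent $z_1,\dots,z_k\in\mathbb{D}_p$, one has $\operatorname{tr.deg.}_{\mathbb{Q}}\mathbb{Q}(z_1,\dots,z_k,\exp(z_1),\dots,\exp(z_k))\ge k$. Then there exist finitely many proper $\mathbb{Q}$-linear subspaces $L_1,\dots,L_m\subset\mathbb{G}_a^n$ such that for every $\mathbf{z}\in\mathbb{D}_p^n$, if $(\mathbf{z},\exp(\mathbf{z}))\in V(\mathbb{C}_p)$, then $\mathbf{z}\in L_i(\mathbb{C}_p)$ for some $i\in\{1,\dots,m\}$.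
   Context: $\mathbb{C}_p$ is the completion of an algebraic closure of $\mathbb{Q}_p$, with valuation $v$ normalized by $v(p)=1$. $\mathbb{D}_p=\{x\in\mathbb{C}_p: v(x)>1/(p-1)\}$, and $\exp:\mathbb{D}_p\to1+\mathbb{D}_p$ is the $p$-adic exponential $\exp(x)=\sum_{j\ge0}x^j/j!$; on tuples it is applied coordinatewise. A proper $\mathbb{Q}$-linear subspace of $\mathbb{G}_a^n$ is a proper linear subspace defined by equations of the form $m_1X_1+\dots+m_nX_n=0$ with $m_1,\dots,m_n\in\mathbb{Z}$ (so at least one such equation with not all $m_i$ zero). *)

theory Defs
  imports "HOL-Analysis.Analysis" "HOL-Library.Poly_Mapping" "HOL-Library.Extended_Nat"
begin

section \<open>The field of \<open>p\<close>-adic complex numbers\<close>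

definition subfield_of :: "'a::field set \<Rightarrow> bool" where
  "subfield_of F \<longleftrightarrow> 0 \<in> F \<and> 1 \<in> F \<and>
     (\<forall>x\<in>F. \<forall>y\<in>F. x + y \<in> F \<and> x - y \<in> F \<and> x * y \<in> F) \<and> (\<forall>x\<in>F. inverse x \<in> F)"

text \<open>In characteristic \<open>0\<close> every subfield contains \<open>\<rat>\<close>, so this is the field \<open>\<rat>(S)\<close>.\<close>

definition Q_adjoin :: "'a::field_char_0 set \<Rightarrow> 'a set" where
  "Q_adjoin S = \<Inter>{F. subfield_of F \<and> S \<subseteq> F}"

definition algebraic_over :: "'a::field set \<Rightarrow> 'a set" where
  "algebraic_over F = {x. \<exists>f. f \<noteq> 0 \<and> (\<forall>i. coeff f i \<in> F) \<and> poly f x = 0}"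

definition val_tendsto :: "('a::field \<Rightarrow> ereal) \<Rightarrow> (nat \<Rightarrow> 'a) \<Rightarrow> 'a \<Rightarrow> bool" where
  "val_tendsto v s l \<longleftrightarrow> (\<lambda>k. v (s k - l)) \<longlonglongrightarrow> \<infinity>"

definition val_Cauchy :: "('a::field \<Rightarrow> ereal) \<Rightarrow> (nat \<Rightarrow> 'a) \<Rightarrow> bool" where
  "val_Cauchy v s \<longleftrightarrow> (\<forall>M::real. \<exists>N. \<forall>i\<ge>N. \<forall>j\<ge>N. v (s i - s j) > ereal M)"

definition val_closure :: "('a::field \<Rightarrow> ereal) \<Rightarrow> 'a set \<Rightarrow> 'a set" where
  "val_closure v S = {x. \<forall>M::real. \<exists>y\<in>S. v (x - y) > ereal M}"

text \<open>
  \<open>padic_complex p v\<close> says that the ambient field with its valuation \<open>v\<close> is the completion of an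
  algebraic closure of \<open>\<rat>\<^sub>p\<close>, normalised by \<open>v p = 1\<close>. On \<open>\<rat>\<close>, the normalisation forces \<open>v\<close> to be
  the \<open>p\<close>-adic valuation. As the ambient field is complete, the closure of \<open>\<rat>\<close> in it is the
  completion of \<open>\<rat>\<close>, that is, \<open>\<rat>\<^sub>p\<close>. The elements algebraic over that closure are then required
  to form an algebraically closed field (hence an algebraic closure of \<open>\<rat>\<^sub>p\<close>) that is dense.
  These conditions determine the valued field up to isometric isomorphism.
\<close>

definition Qp :: "('a::field_char_0 \<Rightarrow> ereal) \<Rightarrow> 'a set" where
  "Qp v = val_closure v \<rat>"

definition Qp_bar :: "('a::field_char_0 \<Rightarrow> ereal) \<Rightarrow> 'a set" where
  "Qp_bar v = algebraic_over (Qp v)"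

locale padic_complex =
  fixes p :: nat and v :: "'a::field_char_0 \<Rightarrow> ereal"
  assumes prime_p: "prime p"
    and v_eq_infinity_iff: "v x = \<infinity> \<longleftrightarrow> x = 0"
    and v_not_minus_infinity: "v x \<noteq> -\<infinity>"
    and v_mult: "v (x * y) = v x + v y"
    and v_add: "v (x + y) \<ge> min (v x) (v y)"
    and v_p: "v (of_nat p) = 1"
    and complete: "val_Cauchy v s \<Longrightarrow> \<exists>l. val_tendsto v s l"
    and Qp_bar_closed:
      "\<lbrakk>degree f > 0; \<forall>i. coeff f i \<in> Qp_bar v\<rbrakk> \<Longrightarrow> \<exists>x\<in>Qp_bar v. poly f x = 0"
    and Qp_bar_dense: "val_closure v (Qp_bar v) = UNIV"

definition Dp :: "nat \<Rightarrow> ('a::field \<Rightarrow> ereal) \<Rightarrow> 'a set" where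
  "Dp p v = {x. v x > ereal (1 / (real p - 1))}"

definition padic_exp :: "('a::field_char_0 \<Rightarrow> ereal) \<Rightarrow> 'a \<Rightarrow> 'a" where
  "padic_exp v x = (THE l. val_tendsto v (\<lambda>k. \<Sum>j<k. x ^ j / fact j) l)"


section \<open>Multivariate polynomials and transcendence degree\<close>

text \<open>Finitely supported maps from monomials (finitely supported exponents) to coefficients.\<close>

type_synonym ('x, 'a) mpol = "('x \<Rightarrow>\<^sub>0 nat) \<Rightarrow>\<^sub>0 'a"

definition mpol_eval :: "('x \<Rightarrow> 'a::comm_ring_1) \<Rightarrow> ('x, 'a) mpol \<Rightarrow> 'a" where
  "mpol_eval a P =
     (\<Sum>m\<in>Poly_Mapping.keys P.
        Poly_Mapping.lookup P m * (\<Prod>x\<in>Poly_Mapping.keys m. a x ^ Poly_Mapping.lookup m x))"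

definition mpol_coeffs_in :: "'a::comm_ring_1 set \<Rightarrow> ('x, 'a) mpol \<Rightarrow> bool" where
  "mpol_coeffs_in F P \<longleftrightarrow> (\<forall>m. Poly_Mapping.lookup P m \<in> F)"

definition mpol_vars :: "('x, 'a::comm_ring_1) mpol \<Rightarrow> 'x set" where
  "mpol_vars P = (\<Union>m\<in>Poly_Mapping.keys P. Poly_Mapping.keys m)"

definition algebraically_independent ::
  "'a::field_char_0 set \<Rightarrow> nat \<Rightarrow> (nat \<Rightarrow> 'a) \<Rightarrow> bool" where
  "algebraically_independent F k b \<longleftrightarrow>
     (\<forall>P :: (nat, 'a) mpol. mpol_coeffs_in F P \<longrightarrow> mpol_vars P \<subseteq> {..<k} \<longrightarrow>
        mpol_eval b P = 0 \<longrightarrow> P = 0)"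

definition trdeg_Q :: "'a::field_char_0 set \<Rightarrow> enat" where
  "trdeg_Q L =
     Sup {enat k | k. \<exists>b. (\<forall>i<k. b i \<in> L) \<and> algebraically_independent \<rat> k b}"

definition Q_linearly_independent :: "nat \<Rightarrow> (nat \<Rightarrow> 'a::field_char_0) \<Rightarrow> bool" where
  "Q_linearly_independent k z \<longleftrightarrow>
     (\<forall>c :: nat \<Rightarrow> rat. (\<Sum>i<k. of_rat (c i) * z i) = 0 \<longrightarrow> (\<forall>i<k. c i = 0))"

definition padic_schanuel :: "nat \<Rightarrow> ('a::field_char_0 \<Rightarrow> ereal) \<Rightarrow> bool" where
  "padic_schanuel p v \<longleftrightarrow>
     (\<forall>k\<ge>1. \<forall>z. (\<forall>i<k. z i \<in> Dp p v) \<longrightarrow> Q_linearly_independent k z \<longrightarrow>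
        trdeg_Q (Q_adjoin (z ` {..<k} \<union> (\<lambda>i. padic_exp v (z i)) ` {..<k})) \<ge> enat k)"


section \<open>Subvarieties of \<open>G\<^sub>a\<^sup>n \<times> G\<^sub>m\<^sup>n\<close>\<close>

text \<open>
  A subvariety is identified with its set of points over the (algebraically closed) ambient field.
  The coordinates on \<open>G\<^sub>a\<^sup>n\<close> are indexed by \<open>Inl i\<close> and those on \<open>G\<^sub>m\<^sup>n\<close> by \<open>Inr i\<close>. Clearing
  denominators, polynomials and Laurent polynomials in the latter cut out the same sets.
\<close>

definition GaGm :: "(('a::field ^ 'n) \<times> ('a ^ 'n)) set" where
  "GaGm = {(x, y). \<forall>i. y $ i \<noteq> 0}"

definition coords :: "('a ^ 'n) \<times> ('a ^ 'n) \<Rightarrow> 'n + 'n \<Rightarrow> 'a" where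
  "coords q = case_sum (\<lambda>i. fst q $ i) (\<lambda>i. snd q $ i)"

definition closed_defined_over :: "'a::field set \<Rightarrow> (('a ^ 'n) \<times> ('a ^ 'n)) set \<Rightarrow> bool" where
  "closed_defined_over F V \<longleftrightarrow>
     (\<exists>S :: ('n + 'n, 'a) mpol set. (\<forall>P\<in>S. mpol_coeffs_in F P) \<and>
        V = {q \<in> GaGm. \<forall>P\<in>S. mpol_eval (coords q) P = 0})"

abbreviation zariski_closed :: "(('a::field ^ 'n) \<times> ('a ^ 'n)) set \<Rightarrow> bool" where
  "zariski_closed \<equiv> closed_defined_over UNIV"

definition irreducible_closed :: "(('a::field ^ 'n) \<times> ('a ^ 'n)) set \<Rightarrow> bool" where
  "irreducible_closed V \<longleftrightarrow> zariski_closed V \<and> V \<noteq> {} \<and>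
     (\<forall>A B. zariski_closed A \<longrightarrow> zariski_closed B \<longrightarrow> V = A \<union> B \<longrightarrow> V = A \<or> V = B)"

text \<open>Krull dimension of the Zariski topology.\<close>

definition variety_dim :: "(('a::field ^ 'n) \<times> ('a ^ 'n)) set \<Rightarrow> enat" where
  "variety_dim V =
     Sup {enat m | m. \<exists>Z. (\<forall>i\<le>m. irreducible_closed (Z i) \<and> Z i \<subseteq> V) \<and>
                        (\<forall>i<m. Z i \<subset> Z (Suc i))}"

text \<open>The points of a proper \<open>\<rat>\<close>-linear subspace of \<open>G\<^sub>a\<^sup>n\<close>.\<close>

definition proper_Q_subspace :: "('a::field_char_0 ^ 'n) set \<Rightarrow> bool" where
  "proper_Q_subspace L \<longleftrightarrow>
     (\<exists>M :: (int ^ 'n) set. (\<exists>m\<in>M. m \<noteq> 0) \<and>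
        L = {x. \<forall>m\<in>M. (\<Sum>i\<in>UNIV. of_int (m $ i) * x $ i) = 0})"

end

theory Submission
  imports Defs "HOL-Library.Function_Algebras"
begin

text \<open>
  A point \<open>(z, exp z)\<close> of \<open>V\<close> generates a field of transcendence degree at most \<open>dim V < n\<close>, since
  the loci of the point over a tower of algebraically closed fields form a chain of irreducible
  closed subsets of \<open>V\<close>. By Schanuel's conjecture \<open>z\<close> then lies on one of the countably many rational
  hyperplanes, and it remains to see that finitely many of them suffice.

  Write \<open>z = \<pi> t\<close> with \<open>\<pi>\<^bsup>p-1\<^esup> = p\<close>, so that \<open>t\<close> runs over the open unit polydisc. In these coordinates
  \<open>exp\<close> is a power series with integral coefficients in a number field, and so, after scaling, are the
  equations of \<open>V\<close>, which has algebraic coefficients. Hence one works with power series over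
  discretely valued complete fields, where Weierstrass division holds on the whole open polydisc
  (over the full field it does not). If no finite set of hyperplanes sufficed, there would be a prime
  ideal of the ring of such series that contains everything vanishing on the solution set and
  avoids every linear form. By induction on the number of variables, such a prime has a point at
  which countably many given series outside of it do not vanish. That point is a solution on no
  rational hyperplane, a contradiction.
\<close>


text \<open>Weierstrass division needs a coefficient of largest norm. Over the whole ambient field
  the norms are dense: the coefficients of a bounded series on the open disc may approach their
  supremum without reaching it, and the series may then have infinitely many zeros. A discrete value
  group excludes this. Each equation of \<open>V\<close> involves finitely many algebraic numbers,
  hence lives over the completion of a number field, but no single field is fixed. The ring
  \<open>B n\<close> is therefore a directed union: division takes place over a suitable member,
  while ideals are taken in the union. The points, by contrast, have coordinates in the ambient
  field, which must be algebraically closed so that roots can be taken. Countable avoidance works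
  because a nonzero series in one variable over such a field has finitely many zeros in the disc,
  while the disc is uncountable. The scale \<pi> comes from Legendre's estimate v(j!) \<le> j/(p-1),
  which makes every \<pi>^j / j! integral. The prime ideals must also avoid the constant p, since an
  ideal containing it has no common zero.\<close>

lemma subfield_ofD:
  assumes "subfield_of F"
  shows "0 \<in> F" "1 \<in> F" "x \<in> F \<Longrightarrow> y \<in> F \<Longrightarrow> x + y \<in> F" "x \<in> F \<Longrightarrow> y \<in> F \<Longrightarrow> x - y \<in> F"
    "x \<in> F \<Longrightarrow> y \<in> F \<Longrightarrow> x * y \<in> F" "x \<in> F \<Longrightarrow> inverse x \<in> F" "x \<in> F \<Longrightarrow> - x \<in> F"
    "x \<in> F \<Longrightarrow> y \<in> F \<Longrightarrow> x / y \<in> F" "x \<in> F \<Longrightarrow> x ^ n \<in> F"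
proof -
  show *: "0 \<in> F" "1 \<in> F" "\<And>x y. x \<in> F \<Longrightarrow> y \<in> F \<Longrightarrow> x + y \<in> F" "\<And>x y. x \<in> F \<Longrightarrow> y \<in> F \<Longrightarrow> x - y \<in> F"
    "\<And>x y. x \<in> F \<Longrightarrow> y \<in> F \<Longrightarrow> x * y \<in> F" "\<And>x. x \<in> F \<Longrightarrow> inverse x \<in> F"
    using assms by (auto simp: subfield_of_def)
  show "x \<in> F \<Longrightarrow> - x \<in> F" using *(4)[OF *(1), of x] by simp
  show "x \<in> F \<Longrightarrow> y \<in> F \<Longrightarrow> x / y \<in> F" by (simp add: divide_inverse *)
  show "x \<in> F \<Longrightarrow> x ^ n \<in> F" by (induction n) (auto intro: *)
qed

lemma subfield_of_sum:
  assumes "subfield_of F" "\<And>i. i \<in> I \<Longrightarrow> f i \<in> F"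
  shows "sum f I \<in> F"
  using assms(2)
  by (induction I rule: infinite_finite_induct) (auto intro: subfield_ofD[OF assms(1)])

lemma subfield_of_Rats: "subfield_of (F :: 'a::field_char_0 set) \<Longrightarrow> \<rat> \<subseteq> F"
proof
  fix x :: 'a assume F: "subfield_of F" and "x \<in> \<rat>"
  then obtain a b where x: "x = of_int a / of_int b" by (auto elim!: Rats_cases')
  have n: "of_nat n \<in> F" for n by (induction n) (auto intro: subfield_ofD[OF F])
  have "of_int a \<in> F" for a by (cases a rule: int_cases2) (auto intro: subfield_ofD[OF F] n)
  then show "x \<in> F" unfolding x by (intro subfield_ofD[OF F])
qed

lemma subfield_of_Rats_self: "subfield_of (\<rat> :: 'a::field_char_0 set)"
  unfolding subfield_of_def by (auto)

section \<open>Relative algebraic closure\<close>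

definition fspan :: "'a::field set \<Rightarrow> 'a set \<Rightarrow> 'a set" where
  "fspan F W = {\<Sum>w\<in>W. c w * w | c. \<forall>w\<in>W. c w \<in> F}"

lemma fspan_add: "subfield_of F \<Longrightarrow> x \<in> fspan F W \<Longrightarrow> y \<in> fspan F W \<Longrightarrow> x + y \<in> fspan F W"
  unfolding fspan_def
  apply clarsimp
  subgoal for c d
    by (rule exI[of _ "\<lambda>w. c w + d w"]) (auto simp: algebra_simps sum.distrib intro: subfield_ofD)
  done

lemma fspan_scale: "subfield_of F \<Longrightarrow> a \<in> F \<Longrightarrow> x \<in> fspan F W \<Longrightarrow> a * x \<in> fspan F W"
  unfolding fspan_def
  apply clarsimp
  subgoal for c
    by (rule exI[of _ "\<lambda>w. a * c w"]) (auto simp: algebra_simps sum_distrib_left intro: subfield_ofD)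
  done

lemma fspan_0: "subfield_of F \<Longrightarrow> 0 \<in> fspan F W"
  unfolding fspan_def by (auto intro!: exI[of _ "\<lambda>w. 0"] intro: subfield_ofD)

lemma fspan_sum:
  assumes "subfield_of F" "\<And>i. i \<in> I \<Longrightarrow> f i \<in> fspan F W"
  shows "sum f I \<in> fspan F W"
  using assms(2)
  by (induction I rule: infinite_finite_induct) (auto intro: fspan_0 fspan_add assms(1))

lemma fspan_base:
  assumes "subfield_of F" "finite W" "w \<in> W"
  shows "w \<in> fspan F W"
proof -
  have "w = (\<Sum>u\<in>W. (if u = w then 1 else 0) * u)"
    using assms by (simp add: if_distrib[of "\<lambda>x. x * _"] sum.delta cong: if_cong)
  then show ?thesis unfolding fspan_def using assms
    by (auto intro!: exI[of _ "\<lambda>u. if u = w then 1 else 0"] intro: subfield_ofD)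
qed

text \<open>Multiplication by \<open>a\<close> is linear, so testing it on generators suffices. The
  function \<open>g\<close> lets the products \<open>a * w\<close> be supplied in whatever form they
  arise.\<close>

lemma fspan_least:
  assumes "subfield_of F" "x \<in> fspan F W" "\<And>w. w \<in> W \<Longrightarrow> g w \<in> fspan F W'"
    "\<And>w. w \<in> W \<Longrightarrow> g w = a * w"
  shows "a * x \<in> fspan F W'"
proof -
  obtain c where c: "x = (\<Sum>w\<in>W. c w * w)" "\<forall>w\<in>W. c w \<in> F"
    using assms(2) by (auto simp: fspan_def)
  have "a * x = (\<Sum>w\<in>W. c w * g w)"
    by (simp add: c assms(4) sum_distrib_left algebra_simps)
  then show ?thesis
    using assms(1,3) c(2) fspan_sum[of F W "\<lambda>w. c w * g w" W'] fspan_scale by metis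
qed

text \<open>Induction on the generators: if some vector involves \<open>w\<close>, it serves as a
  pivot, and subtracting multiples of it leaves one vector fewer in a span with one generator
  fewer.\<close>

lemma linear_dependence:
  assumes F: "subfield_of F" and "finite W" "finite I" "card W < card I" "\<forall>i\<in>I. u i \<in> fspan F W"
  shows "\<exists>c. (\<forall>i\<in>I. c i \<in> F) \<and> (\<exists>i\<in>I. c i \<noteq> 0) \<and> (\<Sum>i\<in>I. c i * u i) = 0"
  using assms(2-)
proof (induction W arbitrary: I u rule: finite_induct)
  case empty
  then have "\<forall>i\<in>I. u i = 0" by (auto simp: fspan_def)
  moreover from empty have "I \<noteq> {}" by auto
  ultimately show ?case by (auto intro!: exI[of _ "\<lambda>_. 1"] intro: subfield_ofD[OF F])
next
  case (insert w W)
  have "\<forall>i\<in>I. \<exists>a y. a \<in> F \<and> y \<in> fspan F W \<and> u i = a * w + y"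
  proof
    fix i assume "i \<in> I"
    then obtain c where c: "u i = (\<Sum>w\<in>insert w W. c w * w)" "\<forall>w\<in>insert w W. c w \<in> F"
      using insert.prems by (auto simp: fspan_def)
    then show "\<exists>a y. a \<in> F \<and> y \<in> fspan F W \<and> u i = a * w + y"
      using insert.hyps
      by (intro exI[of _ "c w"] exI[of _ "\<Sum>w\<in>W. c w * w"]) (auto simp: fspan_def)
  qed
  then obtain a y where ay: "\<forall>i\<in>I. a i \<in> F \<and> y i \<in> fspan F W \<and> u i = a i * w + y i"
    by metis
  show ?case
  proof (cases "\<forall>i\<in>I. a i = 0")
    case True
    then have "\<forall>i\<in>I. u i \<in> fspan F W" using ay by auto
    then show ?thesis using insert by auto
  next
    case False
    then obtain k where k: "k \<in> I" "a k \<noteq> 0" by auto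
    define u' where "u' i = u i - (a i / a k) * u k" for i
    have u': "u' i \<in> fspan F W" if "i \<in> I" for i
    proof -
      have "u' i = y i + (- (a i / a k)) * y k"
        using ay that k by (simp add: u'_def field_simps)
      moreover have "- (a i / a k) \<in> F" using ay that k by (auto intro!: subfield_ofD[OF F])
      ultimately show ?thesis using ay that k by (metis fspan_add fspan_scale F)
    qed
    have "\<exists>c. (\<forall>i\<in>I-{k}. c i \<in> F) \<and> (\<exists>i\<in>I-{k}. c i \<noteq> 0) \<and> (\<Sum>i\<in>I-{k}. c i * u' i) = 0"
      using insert.prems insert.hyps k u' by (intro insert.IH) auto
    then obtain c where c: "\<forall>i\<in>I-{k}. c i \<in> F" "\<exists>i\<in>I-{k}. c i \<noteq> 0" "(\<Sum>i\<in>I-{k}. c i * u' i) = 0"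
      by blast
    \<comment> \<open>The coefficient of the pivot undoes the elimination, turning the relation
      among the \<open>u' i\<close> into one among the \<open>u i\<close>.\<close>
    define d where "d i = (if i = k then - (\<Sum>i\<in>I-{k}. c i * (a i / a k)) else c i)" for i
    have "(\<Sum>i\<in>I. d i * u i) = d k * u k + (\<Sum>i\<in>I-{k}. d i * u i)"
      using k insert.prems by (simp add: sum.remove)
    also have "(\<Sum>i\<in>I-{k}. d i * u i) = (\<Sum>i\<in>I-{k}. c i * u' i + c i * (a i / a k) * u k)"
      by (rule sum.cong) (auto simp: d_def u'_def algebra_simps)
    also have "\<dots> = (\<Sum>i\<in>I-{k}. c i * (a i / a k)) * u k"
      by (simp add: sum.distrib c(3) sum_distrib_right)
    finally have "(\<Sum>i\<in>I. d i * u i) = 0" by (simp add: d_def)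
    moreover have "\<forall>i\<in>I. d i \<in> F"
      using c ay k by (auto simp: d_def intro!: subfield_ofD[OF F] subfield_of_sum[OF F])
    moreover have "\<exists>i\<in>I. d i \<noteq> 0" using c(2) by (auto simp: d_def)
    ultimately show ?thesis by blast
  qed
qed

text \<open>The multipliers of the span of \<open>W\<close>. For a finite \<open>W\<close> with a
  nonzero element they form a field of elements algebraic over \<open>F\<close> of degree at most
  \<open>card W\<close>; the closure properties of algebraic elements are read off from such
  fields.\<close>

definition stab :: "'a::field set \<Rightarrow> 'a set \<Rightarrow> 'a set" where
  "stab F W = {x. \<forall>w\<in>W. x * w \<in> fspan F W}"

lemma stab_fspan: "subfield_of F \<Longrightarrow> x \<in> stab F W \<Longrightarrow> y \<in> fspan F W \<Longrightarrow> x * y \<in> fspan F W"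
  by (rule fspan_least[of F _ W]) (auto simp: stab_def)

lemma stab_const: "subfield_of F \<Longrightarrow> finite W \<Longrightarrow> a \<in> F \<Longrightarrow> a \<in> stab F W"
  by (auto simp: stab_def intro: fspan_scale fspan_base)

lemma stab_add: "subfield_of F \<Longrightarrow> x \<in> stab F W \<Longrightarrow> y \<in> stab F W \<Longrightarrow> x + y \<in> stab F W"
  by (auto simp: stab_def distrib_right intro!: fspan_add)

lemma stab_mult: "subfield_of F \<Longrightarrow> finite W \<Longrightarrow> x \<in> stab F W \<Longrightarrow> y \<in> stab F W \<Longrightarrow> x * y \<in> stab F W"
  using stab_fspan[of F x W] by (simp add: stab_def mult.assoc)

text \<open>The \<open>card W + 1\<close> elements \<open>x ^ i * w0\<close> lie in a span of
  \<open>card W\<close> generators, hence are dependent. The explicit degree bound later makes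
  number fields discretely valued.\<close>

lemma stab_algebraic:
  assumes F: "subfield_of F" and W: "finite W" "w0 \<in> W" "w0 \<noteq> 0" and x: "x \<in> stab F W"
  shows "\<exists>f. f \<noteq> 0 \<and> (\<forall>i. coeff f i \<in> F) \<and> degree f \<le> card W \<and> poly f x = 0"
proof -
  have pw: "x ^ i * w0 \<in> fspan F W" for i
    by (induction i) (auto intro!: fspan_base F W stab_fspan x simp: mult.assoc)
  obtain c where c: "\<forall>i\<in>{..card W}. c i \<in> F" "\<exists>i\<in>{..card W}. c i \<noteq> 0"
    "(\<Sum>i\<in>{..card W}. c i * (x ^ i * w0)) = 0"
    using linear_dependence[OF F W(1), of "{..card W}" "\<lambda>i. x ^ i * w0"] pw by auto
  define f where "f = (\<Sum>i\<le>card W. monom (c i) i)"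
  have cf: "coeff f i = (if i \<le> card W then c i else 0)" for i
    by (simp add: f_def coeff_sum)
  have "(\<Sum>i\<in>{..card W}. c i * x ^ i) * w0 = 0"
    using c(3) by (simp add: sum_distrib_right mult.assoc)
  then have "poly f x = 0" using W(3) by (simp add: f_def poly_sum poly_monom)
  moreover have "f \<noteq> 0" using c(2) cf by (metis atMost_iff coeff_0)
  moreover have "\<forall>i. coeff f i \<in> F" using c(1) by (auto simp: cf intro: subfield_ofD[OF F])
  moreover have "degree f \<le> card W" by (rule degree_le) (auto simp: cf)
  ultimately show ?thesis by blast
qed

lemma algebraic_nonzero_coeff_0:
  fixes x :: "'a::field"
  assumes "x \<noteq> 0" "f \<noteq> 0" "\<forall>i. coeff f i \<in> F" "poly f x = 0"
  shows "\<exists>g. g \<noteq> 0 \<and> (\<forall>i. coeff g i \<in> F) \<and> poly g x = 0 \<and> coeff g 0 \<noteq> 0"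
  using assms(2-)
proof (induction f)
  case (pCons a f)
  show ?case
  proof (cases "a = 0")
    case True
    have "\<forall>i. coeff f i \<in> F" using pCons.prems(2) by (metis coeff_pCons_Suc)
    then show ?thesis using pCons True assms(1) by auto
  next
    case False
    then show ?thesis using pCons.prems by (intro exI[of _ "pCons a f"]) auto
  qed
qed auto

lemma stab_poly:
  assumes "subfield_of F" "finite W" "x \<in> stab F W" "\<forall>i. coeff g i \<in> stab F W"
  shows "poly g x \<in> stab F W"
  using assms(4)
proof (induction g)
  case 0
  then show ?case using assms by (auto intro!: stab_const subfield_ofD)
next
  case (pCons a g)
  have "a \<in> stab F W" using pCons.prems by (metis coeff_pCons_0)
  moreover have "\<forall>i. coeff g i \<in> stab F W" using pCons.prems by (metis coeff_pCons_Suc)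
  ultimately show ?case using pCons.IH assms by (auto intro!: stab_add stab_mult)
qed

text \<open>With an annihilating polynomial \<open>pCons a h\<close>, \<open>a\<close> nonzero, one
  has \<open>x * poly h x = - a\<close>, so the inverse is itself a polynomial in
  \<open>x\<close>.\<close>

lemma stab_inverse:
  assumes F: "subfield_of F" and W: "finite W" "w0 \<in> W" "w0 \<noteq> 0" and x: "x \<in> stab F W"
  shows "inverse x \<in> stab F W"
proof (cases "x = 0")
  case False
  obtain f where "f \<noteq> 0" "\<forall>i. coeff f i \<in> F" "poly f x = 0"
    using stab_algebraic[OF assms] by blast
  then obtain g where g: "\<forall>i. coeff g i \<in> F" "poly g x = 0" "coeff g 0 \<noteq> 0"
    using algebraic_nonzero_coeff_0[OF False] by blast
  obtain a h where ah: "g = pCons a h" by (cases g)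
  have h: "\<forall>i. coeff h i \<in> stab F W" using g(1) ah stab_const[OF F W(1)]
    by (metis coeff_pCons_Suc)
  have "inverse x = (- inverse a) * poly h x"
    using g ah False by (simp add: field_simps eq_neg_iff_add_eq_0)
  moreover have "- inverse a \<in> stab F W" using g ah
    by (auto intro!: stab_const F W subfield_ofD[OF F]) (metis coeff_pCons_0)
  ultimately show ?thesis
    using stab_poly[OF F W(1) x h] stab_mult[OF F W(1)] by metis
next
  case True then show ?thesis using x by simp
qed

lemma subfield_of_stab:
  assumes F: "subfield_of F" and W: "finite W" "w0 \<in> W" "w0 \<noteq> 0"
  shows "subfield_of (stab F W)"
proof -
  have m: "- 1 \<in> stab F W" by (auto intro!: stab_const F W subfield_ofD[OF F])
  have d: "x - y \<in> stab F W" if "x \<in> stab F W" "y \<in> stab F W" for x y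
    using stab_add[OF F that(1) stab_mult[OF F W(1) m that(2)]] by simp
  have "0 \<in> stab F W" "1 \<in> stab F W" using stab_const[OF F W(1)] subfield_ofD[OF F] by auto
  then show ?thesis unfolding subfield_of_def
    by (intro conjI ballI d stab_add[OF F] stab_mult[OF F W(1)] stab_inverse[OF F W])
qed

text \<open>The span of the products \<open>w * x ^ j\<close> with \<open>j < d\<close> is stable
  under \<open>x\<close>, because the relation rewrites \<open>x ^ d\<close>. The coefficients of
  the relation may lie in \<open>stab F W\<close> rather than \<open>F\<close>; this is what gives
  transitivity of algebraicity.\<close>

lemma stab_adjoin:
  assumes F: "subfield_of F" and W: "finite W" "1 \<in> W"
    and x: "x ^ d = (\<Sum>i<d. b i * x ^ i)" and b: "\<forall>i<d. b i \<in> stab F W"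
  shows "\<exists>W'. finite W' \<and> 1 \<in> W' \<and> stab F W \<subseteq> stab F W' \<and> x \<in> stab F W'"
proof -
  define W' where "W' = (\<lambda>(w, j). w * x ^ j) ` (W \<times> {..<d})"
  have d: "d > 0" using x by (cases d) auto
  have fin: "finite W'" using W by (simp add: W'_def)
  have in_W': "w * x ^ j \<in> fspan F W'" if "w \<in> W" "j < d" for w j
    by (rule fspan_base[OF F fin]) (use that in \<open>auto simp: W'_def\<close>)
  have mem: "y * x ^ j \<in> fspan F W'" if "y \<in> fspan F W" "j < d" for y j
    using fspan_least[OF F that(1), of "\<lambda>w. w * x ^ j" W' "x ^ j"] in_W' that(2)
    by (metis mult.commute)
  have "1 \<in> W'" using W d by (force simp: W'_def)
  moreover have "stab F W \<subseteq> stab F W'"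
  proof
    fix y assume y: "y \<in> stab F W"
    have "y * (w * x ^ j) \<in> fspan F W'" if "w \<in> W" "j < d" for w j
      unfolding mult.assoc[symmetric] using y that by (intro mem) (auto simp: stab_def)
    then show "y \<in> stab F W'" unfolding stab_def[of F W'] by (subst W'_def) auto
  qed
  moreover have "x \<in> stab F W'"
    unfolding stab_def
  proof (safe)
    fix u assume "u \<in> W'"
    then obtain w j where u: "u = w * x ^ j" "w \<in> W" "j < d" by (auto simp: W'_def)
    show "x * u \<in> fspan F W'"
    proof (cases "Suc j < d")
      case True
      then show ?thesis using in_W'[OF u(2) True] by (simp add: u algebra_simps)
    next
      case False
      then have "d = Suc j" using u by simp
      then have "x * u = w * x ^ d" by (simp add: u)
      also have "\<dots> = (\<Sum>i<d. (b i * w) * x ^ i)" by (simp add: x sum_distrib_left algebra_simps)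
      finally show ?thesis using b u by (auto intro!: fspan_sum F mem simp: stab_def)
    qed
  qed
  ultimately show ?thesis using fin by blast
qed

lemma poly_root_monic:
  fixes f :: "'a::field poly"
  assumes "f \<noteq> 0" "poly f x = 0"
  shows "x ^ degree f = (\<Sum>i<degree f. (- (coeff f i / lead_coeff f)) * x ^ i)"
proof -
  have "0 = poly f x / lead_coeff f" using assms by simp
  also have "\<dots> = (\<Sum>i\<le>degree f. coeff f i / lead_coeff f * x ^ i)"
    by (simp add: poly_altdef sum_divide_distrib)
  also have "\<dots> = (\<Sum>i<degree f. coeff f i / lead_coeff f * x ^ i) + x ^ degree f"
    using assms by (simp add: lessThan_Suc_atMost[symmetric])
  finally show ?thesis by (simp add: sum_negf eq_neg_iff_add_eq_0 add.commute)
qed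

lemma finite_algebraic_stab:
  assumes F: "subfield_of F" and "finite C" "C \<subseteq> algebraic_over F"
  shows "\<exists>W. finite W \<and> 1 \<in> W \<and> C \<subseteq> stab F W"
  using assms(2-)
proof (induction C rule: finite_induct)
  case empty
  show ?case by (intro exI[of _ "{1}"]) auto
next
  case (insert x C)
  then obtain W where W: "finite W" "1 \<in> W" "C \<subseteq> stab F W" by auto
  obtain f where f: "f \<noteq> 0" "\<forall>i. coeff f i \<in> F" "poly f x = 0"
    using insert.prems by (auto simp: algebraic_over_def)
  obtain W' where "finite W'" "1 \<in> W'" "stab F W \<subseteq> stab F W'" "x \<in> stab F W'"
    using stab_adjoin[OF F W(1,2) poly_root_monic[OF f(1,3)]] f(2)
      stab_const[OF F W(1) subfield_ofD(7)[OF F subfield_ofD(8)[OF F]]] by blast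
  then show ?case using W by (intro exI[of _ W']) auto
qed

lemma stab_subset_algebraic:
  assumes F: "subfield_of F" and W: "finite W" "1 \<in> W"
  shows "stab F W \<subseteq> algebraic_over F"
proof
  fix x assume "x \<in> stab F W"
  from stab_algebraic[OF F W _ this] show "x \<in> algebraic_over F" by (auto simp: algebraic_over_def)
qed

lemma algebraic_over_superset: "subfield_of F \<Longrightarrow> F \<subseteq> algebraic_over F"
  unfolding algebraic_over_def
  apply safe
  subgoal for x
    by (rule exI[of _ "[:-x, 1:]"]) (auto simp: coeff_pCons split: nat.splits intro: subfield_ofD)
  done

lemma subfield_of_algebraic_over:
  assumes F: "subfield_of F"
  shows "subfield_of (algebraic_over F)"
proof -
  have *: "\<exists>S. subfield_of S \<and> x \<in> S \<and> y \<in> S \<and> S \<subseteq> algebraic_over F"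
    if "x \<in> algebraic_over F" "y \<in> algebraic_over F" for x y
  proof -
    obtain W where W: "finite W" "1 \<in> W" "{x,y} \<subseteq> stab F W"
      using finite_algebraic_stab[OF F, of "{x,y}"] \<open>x \<in> _\<close> \<open>y \<in> _\<close> by blast
    then show ?thesis using subfield_of_stab[OF F W(1,2)] stab_subset_algebraic[OF F W(1,2)]
      by (intro exI[of _ "stab F W"]) simp
  qed
  show ?thesis unfolding subfield_of_def
  proof (intro conjI ballI)
    show "0 \<in> algebraic_over F" "1 \<in> algebraic_over F"
      using algebraic_over_superset[OF F] subfield_ofD[OF F] by auto
  next
    fix x y assume "x \<in> algebraic_over F" "y \<in> algebraic_over F"
    from *[OF this] obtain S where S: "subfield_of S" "x \<in> S" "y \<in> S" "S \<subseteq> algebraic_over F" by blast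
    then show "x + y \<in> algebraic_over F" "x - y \<in> algebraic_over F" "x * y \<in> algebraic_over F"
      using subfield_ofD(3-5)[OF S(1-3)] by blast+
  next
    fix x assume "x \<in> algebraic_over F"
    from *[OF this this] obtain S where S: "subfield_of S" "x \<in> S" "S \<subseteq> algebraic_over F" by blast
    then show "inverse x \<in> algebraic_over F" using subfield_ofD(6)[OF S(1,2)] by blast
  qed
qed

text \<open>Transitivity: the finitely many coefficients of the monic relation lie in one multiplier
  field over \<open>F\<close>, which can then be enlarged to contain \<open>x\<close>.\<close>

lemma algebraic_over_root:
  assumes F: "subfield_of F" and f: "f \<noteq> 0" "\<forall>i. coeff f i \<in> algebraic_over F" "poly f x = 0"
  shows "x \<in> algebraic_over F"
proof -
  define C where "C = (\<lambda>i. - (coeff f i / lead_coeff f)) ` {..<degree f}"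
  have "C \<subseteq> algebraic_over F" using f(2)
    by (auto simp: C_def intro!: subfield_ofD[OF subfield_of_algebraic_over[OF F]])
  then obtain W where W: "finite W" "1 \<in> W" "C \<subseteq> stab F W"
    using finite_algebraic_stab[OF F, of C] by (auto simp: C_def)
  obtain W' where "finite W'" "1 \<in> W'" "x \<in> stab F W'"
    using stab_adjoin[OF F W(1,2) poly_root_monic[OF f(1,3)]] W(3) by (auto simp: C_def)
  then show ?thesis using stab_subset_algebraic[OF F] by blast
qed

lemma subfield_of_Q_adjoin: "subfield_of (Q_adjoin S)"
  unfolding Q_adjoin_def subfield_of_def by blast

lemma Q_adjoin_superset: "S \<subseteq> Q_adjoin S"
  unfolding Q_adjoin_def by blast

lemma Q_adjoin_least: "subfield_of F \<Longrightarrow> S \<subseteq> F \<Longrightarrow> Q_adjoin S \<subseteq> F"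
  unfolding Q_adjoin_def by blast

lemma Q_adjoin_mono: "S \<subseteq> T \<Longrightarrow> Q_adjoin S \<subseteq> Q_adjoin T"
  unfolding Q_adjoin_def by blast

lemma algebraic_over_mono: "F \<subseteq> G \<Longrightarrow> algebraic_over F \<subseteq> algebraic_over G"
  unfolding algebraic_over_def by blast

section \<open>Extending homomorphisms to a simple extension\<close>

definition subring_of :: "'r::comm_ring_1 set \<Rightarrow> bool" where
  "subring_of A \<longleftrightarrow> 0 \<in> A \<and> 1 \<in> A \<and> (\<forall>x\<in>A. \<forall>y\<in>A. x + y \<in> A \<and> x - y \<in> A \<and> x * y \<in> A)"

lemma subring_ofD:
  assumes "subring_of A"
  shows "0 \<in> A" "1 \<in> A" "x \<in> A \<Longrightarrow> y \<in> A \<Longrightarrow> x + y \<in> A" "x \<in> A \<Longrightarrow> y \<in> A \<Longrightarrow> x - y \<in> A"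
    "x \<in> A \<Longrightarrow> y \<in> A \<Longrightarrow> x * y \<in> A" "x \<in> A \<Longrightarrow> - x \<in> A" "x \<in> A \<Longrightarrow> x ^ n \<in> A"
proof -
  show *: "0 \<in> A" "1 \<in> A" "\<And>x y. x \<in> A \<Longrightarrow> y \<in> A \<Longrightarrow> x + y \<in> A" "\<And>x y. x \<in> A \<Longrightarrow> y \<in> A \<Longrightarrow> x - y \<in> A"
    "\<And>x y. x \<in> A \<Longrightarrow> y \<in> A \<Longrightarrow> x * y \<in> A" using assms by (auto simp: subring_of_def)
  show "x \<in> A \<Longrightarrow> - x \<in> A" using *(4)[OF *(1), of x] by simp
  show "x \<in> A \<Longrightarrow> x ^ n \<in> A" by (induction n) (auto intro: *)
qed

lemma subring_of_sum: "subring_of A \<Longrightarrow> (\<And>i. i \<in> I \<Longrightarrow> f i \<in> A) \<Longrightarrow> sum f I \<in> A"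
  by (induction I rule: infinite_finite_induct) (auto intro: subring_ofD)

lemma subring_of_prod: "subring_of A \<Longrightarrow> (\<And>i. i \<in> I \<Longrightarrow> f i \<in> A) \<Longrightarrow> prod f I \<in> A"
  by (induction I rule: infinite_finite_induct) (auto intro: subring_ofD)

lemma subring_of_subfield: "subfield_of F \<Longrightarrow> subring_of F"
  by (auto simp: subring_of_def subfield_of_def)

section \<open>Polynomials over a subring and evaluation through a homomorphism\<close>

definition polys_over :: "'r::zero set \<Rightarrow> 'r poly set" where
  "polys_over A = {h. \<forall>i. coeff h i \<in> A}"

lemma subring_of_polys_over: "subring_of A \<Longrightarrow> subring_of (polys_over A)"
  unfolding subring_of_def[of "polys_over A"]
  by (auto simp: polys_over_def coeff_mult coeff_1 intro: subring_ofD subring_of_sum)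

lemma polys_over_pCons: "pCons a h \<in> polys_over A \<longleftrightarrow> a \<in> A \<and> h \<in> polys_over A"
  unfolding polys_over_def
  by (auto simp: coeff_pCons split: nat.splits)

lemma polys_over_monom: "0 \<in> A \<Longrightarrow> a \<in> A \<Longrightarrow> monom a k \<in> polys_over A"
  by (auto simp: polys_over_def)

lemma polys_over_smult: "subring_of A \<Longrightarrow> a \<in> A \<Longrightarrow> h \<in> polys_over A \<Longrightarrow> smult a h \<in> polys_over A"
  by (auto simp: polys_over_def intro: subring_ofD)

text \<open>Long division in which every step first multiplies by the leading coefficient of
  \<open>m\<close>, which need not be invertible. Zero divisors are possible, so degrees are
  controlled by inequalities only. The bound on \<open>degree q\<close> is needed where a quotient
  must have smaller degree than its dividend.\<close>

lemma pseudo_division: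
  fixes m :: "'r::comm_ring_1 poly"
  assumes A: "subring_of A" and m: "m \<in> polys_over A" "degree m \<ge> 1"
  shows "h \<in> polys_over A \<Longrightarrow> \<exists>k q r. q \<in> polys_over A \<and> r \<in> polys_over A \<and>
    smult (lead_coeff m ^ k) h = q * m + r \<and> degree r < degree m \<and> degree q \<le> degree h - degree m"
proof (induction "degree h" arbitrary: h rule: less_induct)
  case less
  note A' = subring_ofD[OF subring_of_polys_over[OF A]]
  define a where "a = lead_coeff m"
  have a: "a \<in> A" using m by (auto simp: a_def polys_over_def)
  show ?case
  proof (cases "degree h < degree m")
    case True
    then show ?thesis using less.prems by (intro exI[of _ 0] exI[of _ h]) (auto intro: A')
  next
    case False
    define s where "s = monom (lead_coeff h) (degree h - degree m)"
    define h2 where "h2 = smult a h - s * m"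
    have s: "s \<in> polys_over A" using less.prems
      by (auto simp: s_def polys_over_def intro: subring_ofD[OF A])
    have h2: "h2 \<in> polys_over A"
      unfolding h2_def by (intro A' s m polys_over_smult A a less.prems)
    have dsm: "degree (s * m) \<le> degree h"
      using degree_mult_le[of s m] degree_monom_le[of "lead_coeff h" "degree h - degree m"] False
      by (simp add: s_def)
    have "degree h2 \<le> degree h"
      unfolding h2_def by (intro degree_diff_le dsm order.trans[OF degree_smult_le]) simp
    moreover have "coeff h2 (degree h) = 0"
      using False by (simp add: h2_def s_def coeff_monom_mult a_def)
    ultimately have "degree h2 < degree h"
      using m(2) False by (metis coeff_0_degree_minus_1 diff_less eq_zero_or_degree_less leI
        le_neq_implies_less le_zero_eq
          degree_0 less_le_trans not_less zero_less_one)
    from less.hyps[OF this h2] obtain k q r where q: "q \<in> polys_over A" "r \<in> polys_over A"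
      "smult (a ^ k) h2 = q * m + r" "degree r < degree m" "degree q \<le> degree h2 - degree m"
      unfolding a_def by blast
    have "smult (a ^ Suc k) h = smult (a ^ k) h2 + smult (a ^ k) (s * m)"
      by (simp add: h2_def smult_diff_right mult.commute)
    also have "\<dots> = (q + smult (a ^ k) s) * m + r" by (simp add: q(3) algebra_simps)
    finally have "smult (a ^ Suc k) h = (q + smult (a ^ k) s) * m + r" .
    moreover have "degree (q + smult (a ^ k) s) \<le> degree h - degree m"
    proof (rule degree_add_le)
      show "degree q \<le> degree h - degree m" using q(5) \<open>degree h2 \<le> degree h\<close> by linarith
      show "degree (smult (a ^ k) s) \<le> degree h - degree m"
        unfolding s_def by (intro order.trans[OF degree_smult_le] degree_monom_le)
    qed
    moreover have "q + smult (a ^ k) s \<in> polys_over A"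
      by (intro A' q polys_over_smult A s subring_ofD[OF A] a)
    ultimately show ?thesis unfolding a_def using q by blast
  qed
qed

definition ring_hom_on :: "'r::comm_ring_1 set \<Rightarrow> ('r \<Rightarrow> 'b::field) \<Rightarrow> bool" where
  "ring_hom_on A \<phi> \<longleftrightarrow> \<phi> 0 = 0 \<and> \<phi> 1 = 1 \<and>
     (\<forall>x\<in>A. \<forall>y\<in>A. \<phi> (x + y) = \<phi> x + \<phi> y \<and> \<phi> (x * y) = \<phi> x * \<phi> y)"

abbreviation eval_via :: "('r::comm_ring_1 \<Rightarrow> 'b::field) \<Rightarrow> 'r poly \<Rightarrow> 'b \<Rightarrow> 'b" where
  "eval_via \<phi> h \<tau> \<equiv> poly (map_poly \<phi> h) \<tau>"

context
  fixes A :: "'r::comm_ring_1 set" and \<phi> :: "'r \<Rightarrow> 'b::field"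
  assumes A: "subring_of A" and hom: "ring_hom_on A \<phi>"
begin

lemma ring_hom_onD:
  "\<phi> 0 = 0" "\<phi> 1 = 1" "x \<in> A \<Longrightarrow> y \<in> A \<Longrightarrow> \<phi> (x + y) = \<phi> x + \<phi> y"
  "x \<in> A \<Longrightarrow> y \<in> A \<Longrightarrow> \<phi> (x * y) = \<phi> x * \<phi> y" "x \<in> A \<Longrightarrow> y \<in> A \<Longrightarrow> \<phi> (x - y) = \<phi> x - \<phi> y"
  "x \<in> A \<Longrightarrow> \<phi> (x ^ k) = \<phi> x ^ k"
proof -
  show *: "\<phi> 0 = 0" "\<phi> 1 = 1" "\<And>x y. x \<in> A \<Longrightarrow> y \<in> A \<Longrightarrow> \<phi> (x + y) = \<phi> x + \<phi> y"
    "\<And>x y. x \<in> A \<Longrightarrow> y \<in> A \<Longrightarrow> \<phi> (x * y) = \<phi> x * \<phi> y"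
    using hom by (auto simp: ring_hom_on_def)
  show "x \<in> A \<Longrightarrow> y \<in> A \<Longrightarrow> \<phi> (x - y) = \<phi> x - \<phi> y"
    using *(3)[of "x - y" y] subring_ofD(4)[OF A, of x y] by simp
  show "x \<in> A \<Longrightarrow> \<phi> (x ^ k) = \<phi> x ^ k"
    by (induction k) (auto simp: * subring_ofD(7)[OF A])
qed

lemma ring_hom_on_sum: "(\<And>i. i \<in> I \<Longrightarrow> f i \<in> A) \<Longrightarrow> \<phi> (sum f I) = (\<Sum>i\<in>I. \<phi> (f i))"
  by (induction I rule: infinite_finite_induct) (auto simp: ring_hom_onD subring_of_sum A)

lemma ring_hom_on_prod: "(\<And>i. i \<in> I \<Longrightarrow> f i \<in> A) \<Longrightarrow> \<phi> (prod f I) = (\<Prod>i\<in>I. \<phi> (f i))"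
  by (induction I rule: infinite_finite_induct) (auto simp: ring_hom_onD subring_of_prod A)

lemma eval_via_add:
  "f \<in> polys_over A \<Longrightarrow> g \<in> polys_over A \<Longrightarrow> eval_via \<phi> (f + g) \<tau> = eval_via \<phi> f \<tau> + eval_via \<phi> g \<tau>"
proof -
  assume "f \<in> polys_over A" "g \<in> polys_over A"
  then have "map_poly \<phi> (f + g) = map_poly \<phi> f + map_poly \<phi> g"
    by (intro poly_eqI) (auto simp: coeff_map_poly ring_hom_onD polys_over_def)
  then show ?thesis by simp
qed

lemma eval_via_smult:
  "a \<in> A \<Longrightarrow> g \<in> polys_over A \<Longrightarrow> eval_via \<phi> (smult a g) \<tau> = \<phi> a * eval_via \<phi> g \<tau>"
proof -
  assume "a \<in> A" "g \<in> polys_over A"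
  then have "map_poly \<phi> (smult a g) = smult (\<phi> a) (map_poly \<phi> g)"
    by (intro poly_eqI) (auto simp: coeff_map_poly ring_hom_onD polys_over_def)
  then show ?thesis by simp
qed

lemma eval_via_pCons: "eval_via \<phi> (pCons a g) \<tau> = \<phi> a + \<tau> * eval_via \<phi> g \<tau>"
  by (simp add: map_poly_pCons ring_hom_onD)

lemma eval_via_mult:
  "f \<in> polys_over A \<Longrightarrow> g \<in> polys_over A \<Longrightarrow> eval_via \<phi> (f * g) \<tau> = eval_via \<phi> f \<tau> * eval_via \<phi> g \<tau>"
proof (induction f)
  case (pCons a f)
  then have *: "a \<in> A" "f \<in> polys_over A" by (auto simp: polys_over_pCons)
  have "eval_via \<phi> (pCons a f * g) \<tau> = eval_via \<phi> (smult a g + pCons 0 (f * g)) \<tau>" by simp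
  also have "\<dots> = eval_via \<phi> (smult a g) \<tau> + eval_via \<phi> (pCons 0 (f * g)) \<tau>"
    using * pCons.prems by (intro eval_via_add)
      (auto simp: polys_over_pCons subring_ofD[OF A] intro: polys_over_smult A subring_ofD[OF
        subring_of_polys_over[OF A]])
  finally show ?case using * pCons.prems pCons.IH
    by (simp add: eval_via_smult eval_via_pCons ring_hom_onD algebra_simps)
qed simp

end

text \<open>\<open>P\<close> is a prime ideal of the polynomial ring over \<open>A\<close>, and
  \<open>J\<close> below is its contraction to \<open>A\<close>. Since \<open>A\<close> need not be
  a domain, arguments for polynomials over the domain \<open>A / J\<close> are carried out on
  representatives.\<close>

locale poly_prime =
  fixes A :: "'r::comm_ring_1 set" and P :: "'r poly set"
  assumes A: "subring_of A"
    and P_sub: "P \<subseteq> polys_over A"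
    and P_0: "0 \<in> P"
    and P_add: "f \<in> P \<Longrightarrow> g \<in> P \<Longrightarrow> f + g \<in> P"
    and P_mult: "f \<in> polys_over A \<Longrightarrow> g \<in> P \<Longrightarrow> f * g \<in> P"
    and P_prime: "f \<in> polys_over A \<Longrightarrow> g \<in> polys_over A \<Longrightarrow> f * g \<in> P \<Longrightarrow> f \<in> P \<or> g \<in> P"
    and P_1: "1 \<notin> P"
begin

definition J where "J = {a \<in> A. [:a:] \<in> P}"

lemmas Ap = subring_ofD[OF subring_of_polys_over[OF A]]

lemma P_diff: "f \<in> P \<Longrightarrow> g \<in> P \<Longrightarrow> f - g \<in> P"
  using P_add[of f "-1 * g"] P_mult[of "-1" g] Ap(2,6) by auto

lemma J_mult: "a \<in> A \<Longrightarrow> b \<in> J \<Longrightarrow> a * b \<in> J"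
  using P_mult[of "[:a:]" "[:b:]"] Ap(1) by (auto simp: J_def subring_ofD[OF A] polys_over_pCons mult.commute)

lemma J_prime: "a \<in> A \<Longrightarrow> b \<in> A \<Longrightarrow> a * b \<in> J \<Longrightarrow> a \<in> J \<or> b \<in> J"
  using P_prime[of "[:a:]" "[:b:]"] Ap(1) by (auto simp: J_def polys_over_pCons mult.commute)

lemma J_add: "a \<in> J \<Longrightarrow> b \<in> J \<Longrightarrow> a + b \<in> J"
  using P_add[of "[:a:]" "[:b:]"] by (auto simp: J_def subring_ofD[OF A])

lemma J_0: "0 \<in> J"
  using P_0 by (simp add: J_def subring_ofD[OF A])

lemma J_1: "1 \<notin> J"
  using P_1 by (simp add: J_def one_pCons)

lemma J_power: "a \<in> A \<Longrightarrow> a ^ k \<in> J \<Longrightarrow> a \<in> J"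
proof (induction k)
  case (Suc k)
  then show ?case using J_prime[of a "a ^ k"] subring_ofD(7)[OF A] by auto
qed (simp add: J_1)

lemma J_sum: "(\<And>i. i \<in> I \<Longrightarrow> f i \<in> J) \<Longrightarrow> sum f I \<in> J"
  by (induction I rule: infinite_finite_induct) (auto intro: J_0 J_add)

lemma polys_over_J: "h \<in> polys_over J \<Longrightarrow> h \<in> P"
proof (induction h)
  case (pCons a h)
  then have "[:a:] \<in> P" "h \<in> P" by (auto simp: polys_over_pCons J_def)
  then have "[:a:] + [:0,1:] * h \<in> P"
    using Ap(1) by (intro P_add P_mult) (auto simp: polys_over_pCons subring_ofD[OF A])
  then show ?case by simp
qed (auto simp: P_0)

text \<open>Leading terms with coefficient in \<open>J\<close> vanish modulo \<open>J\<close> and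
  may be dropped, until a leading coefficient survives.\<close>

lemma trim:
  assumes "h \<in> polys_over A" "h \<notin> polys_over J"
  shows "\<exists>g\<in>polys_over A. h - g \<in> polys_over J \<and> lead_coeff g \<notin> J \<and> degree g \<le> degree h"
  using assms
proof (induction "degree h" arbitrary: h rule: less_induct)
  case less
  show ?case
  proof (cases "lead_coeff h \<in> J")
    case False
    then show ?thesis using less.prems J_0 by (intro bexI[of _ h]) (auto simp: polys_over_def)
  next
    case True
    define s where "s = monom (lead_coeff h) (degree h)"
    have s: "s \<in> polys_over J" using True J_0 by (auto simp: s_def polys_over_def)
    have d: "degree h \<noteq> 0"
    proof
      assume "degree h = 0"
      then have "h = s" by (simp add: s_def poly_eq_iff coeff_eq_0)
      then show False using s less.prems by simp
    qed
    have "degree (h - s) \<le> degree h"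
      by (intro degree_diff_le) (auto simp: s_def degree_monom_le)
    moreover have "coeff (h - s) (degree h) = 0" by (simp add: s_def)
    ultimately have lt: "degree (h - s) < degree h"
      using d by (metis degree_0 eq_zero_or_degree_less leD le_neq_implies_less neq0_conv leading_coeff_0_iff)
    have 1: "h - s \<in> polys_over A" using less.prems s by (auto simp: polys_over_def J_def subring_ofD[OF A])
    have 2: "h - s \<notin> polys_over J"
    proof
      assume *: "h - s \<in> polys_over J"
      have "coeff h i \<in> J" for i using J_add[of "coeff (h - s) i" "coeff s i"] * s by (auto simp: polys_over_def)
      then show False using less.prems by (auto simp: polys_over_def)
    qed
    from less.hyps[OF lt 1 2] obtain g where g: "g\<in>polys_over A" "h - s - g \<in> polys_over J" "lead_coeff g \<notin> J"
      "degree g \<le> degree (h - s)" by blast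
    have "coeff (h - g) i \<in> J" for i
      using J_add[of "coeff (h - s - g) i" "coeff s i"] g(2) s by (auto simp: polys_over_def)
    then have "h - g \<in> polys_over J" by (auto simp: polys_over_def)
    then show ?thesis using g lt by (intro bexI[of _ g]) auto
  qed
qed

text \<open>Over the fraction field of \<open>A / J\<close>, the polynomial \<open>m\<close>
  generates a prime ideal not containing \<open>r0\<close>, so the two generate the unit ideal, and
  clearing denominators leaves a constant \<open>N\<close>. Fractions are avoided by taking, in the
  ideal generated by \<open>P\<close> and \<open>r0\<close>, an element of least degree among those
  with leading coefficient outside \<open>J\<close>.\<close>

lemma coprime_const:
  assumes m: "m \<in> P" "lead_coeff m \<notin> J" and m_min: "\<And>g. g \<in> P \<Longrightarrow> degree g < degree m \<Longrightarrow> g \<in> polys_over J"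
    and r0: "r0 \<in> polys_over A" "r0 \<notin> P"
  shows "\<exists>N\<in>A - J. \<exists>u\<in>polys_over A. \<exists>h\<in>P. [:N:] = u * r0 + h"
proof -
  define I where "I = {u * r0 + h | u h. u \<in> polys_over A \<and> h \<in> P}"
  have IA: "I \<subseteq> polys_over A" using r0 P_sub by (auto simp: I_def intro!: Ap(3,5))
  have I_P: "h \<in> I" if "h \<in> P" for h
    using that Ap(1) unfolding I_def mem_Collect_eq by (intro exI[of _ 0] exI[of _ h]) auto
  have I_r0: "r0 \<in> I" unfolding I_def mem_Collect_eq using Ap(2) P_0
    by (intro exI[of _ 1] exI[of _ 0]) auto
  have I_mult: "f * g \<in> I" if fg: "f \<in> polys_over A" "g \<in> I" for f g
  proof -
    obtain u h where "g = u * r0 + h" "u \<in> polys_over A" "h \<in> P" using fg by (auto simp: I_def)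
    then have "f * g = (f * u) * r0 + f * h" "f * u \<in> polys_over A" "f * h \<in> P"
      using fg by (auto simp: algebra_simps intro: Ap P_mult)
    then show ?thesis unfolding I_def by blast
  qed
  have I_diff: "f - g \<in> I" if fg: "f \<in> I" "g \<in> I" for f g
  proof -
    obtain u h u' h' where *: "f = u * r0 + h" "u \<in> polys_over A" "h \<in> P"
      "g = u' * r0 + h'" "u' \<in> polys_over A" "h' \<in> P" using fg unfolding I_def by blast
    then have "f - g = (u - u') * r0 + (h - h')" "u - u' \<in> polys_over A" "h - h' \<in> P"
      by (auto simp: algebra_simps intro: Ap P_diff)
    then show ?thesis unfolding I_def by blast
  qed
  define S where "S d \<longleftrightarrow> (\<exists>g\<in>I. lead_coeff g \<notin> J \<and> degree g = d)" for d
  have trimI: "\<exists>d'\<le>degree g. S d'" if g: "g \<in> I" "g \<notin> polys_over J" for g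
  proof -
    obtain g' where g': "g - g' \<in> polys_over J" "lead_coeff g' \<notin> J" "degree g' \<le> degree g"
      using trim[of g] g IA by blast
    have "g - (g - g') \<in> I" using I_diff[OF g(1) I_P[OF polys_over_J[OF g'(1)]]] .
    then show ?thesis using g' unfolding S_def by auto
  qed
  have "\<exists>d. S d" using trimI[OF I_r0] r0 polys_over_J by blast
  then obtain d where d: "S d" "\<And>d'. S d' \<Longrightarrow> d \<le> d'" by (metis LeastI_ex Least_le)
  then obtain g where g: "g \<in> I" "lead_coeff g \<notin> J" "degree g = d" by (auto simp: S_def)
  have gA: "g \<in> polys_over A" using g IA by auto
  then have bA: "lead_coeff g \<in> A" by (auto simp: polys_over_def)
  have divg: "\<exists>k q r. q \<in> polys_over A \<and> r \<in> polys_over J \<and> smult (lead_coeff g ^ k) s = q * g + r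
      \<and> degree q \<le> degree s - degree g" if s: "d \<ge> 1" "s \<in> I" for s
  proof -
    obtain k q r where *: "q \<in> polys_over A" "r \<in> polys_over A"
      "smult (lead_coeff g ^ k) s = q * g + r" "degree r < degree g" "degree q \<le> degree s - degree g"
      using pseudo_division[OF A gA, of s] s g IA by auto
    have "smult (lead_coeff g ^ k) s - q * g \<in> I"
      using I_mult[of "[:lead_coeff g ^ k:]" s] bA that g * Ap(1)
      by (intro I_diff I_mult) (auto simp: polys_over_pCons subring_ofD[OF A])
    then have "r \<in> I" using *(3) by simp
    then have "r \<in> polys_over J" using trimI[of r] d(2) *(4) g(3) by force
    then show ?thesis using * by blast
  qed
  \<comment> \<open>If \<open>d\<close> were positive, \<open>g\<close> would divide
    \<open>r0\<close> and \<open>m\<close> modulo \<open>J\<close>, up to constants outside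
    \<open>J\<close>. The first excludes \<open>g\<close> from \<open>P\<close>. Then the quotient
    of \<open>m\<close> lies in \<open>P\<close> and, having smaller degree than a nonconstant
    \<open>m\<close>, has its coefficients in \<open>J\<close>; this forces the leading coefficient
    of \<open>m\<close> into \<open>J\<close>.\<close>
  have "d = 0"
  proof (rule ccontr)
    assume "d \<noteq> 0" then have d1: "d \<ge> 1" by simp
    have gP: "g \<notin> P"
    proof
      assume gP: "g \<in> P"
      obtain k q r where *: "q \<in> polys_over A" "r \<in> polys_over J" "smult (lead_coeff g ^ k) r0 = q * g + r"
        using divg[OF d1 I_r0] by blast
      then have "[:lead_coeff g ^ k:] * r0 \<in> P"
        using P_add[OF P_mult[OF *(1) gP] polys_over_J[OF *(2)]] by simp
      then have "[:lead_coeff g ^ k:] \<in> P"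
        using P_prime[of "[:lead_coeff g ^ k:]" r0] r0 bA Ap(1) by (auto simp: polys_over_pCons subring_ofD[OF A])
      then have "lead_coeff g ^ k \<in> J" using bA by (auto simp: J_def subring_ofD[OF A])
      then show False using J_power bA g by blast
    qed
    obtain k q r where *: "q \<in> polys_over A" "r \<in> polys_over J" "smult (lead_coeff g ^ k) m = q * g + r"
      "degree q \<le> degree m - degree g"
      using divg[OF d1 I_P[OF m(1)]] by blast
    have mA: "m \<in> polys_over A" using m P_sub by auto
    have "[:lead_coeff g ^ k:] * m - r \<in> P"
      using bA Ap(1) m by (intro P_diff P_mult polys_over_J[OF *(2)])
        (auto simp: polys_over_pCons subring_ofD[OF A])
    then have "q * g \<in> P" using *(3) by simp
    then have qP: "q \<in> P" using gP P_prime[of q g] * gA by auto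
    have "q \<in> polys_over J"
    proof (cases "degree m = 0")
      case True
      then have "m = [:lead_coeff m:]" by (metis degree_eq_zeroE coeff_pCons_0)
      then have "lead_coeff m \<in> J" using m mA unfolding J_def by (auto simp: polys_over_def)
      then show ?thesis using m by simp
    next
      case False
      then show ?thesis using m_min[OF qP] *(4) g d1 by auto
    qed
    then have qg: "coeff (q * g) i \<in> J" for i
    proof -
      have "coeff g (i - j) * coeff q j \<in> J" for j
        using gA \<open>q \<in> polys_over J\<close> by (intro J_mult) (auto simp: polys_over_def)
      then show ?thesis unfolding coeff_mult by (intro J_sum) (simp add: mult.commute)
    qed
    have "coeff (smult (lead_coeff g ^ k) m) (degree m) \<in> J"
      unfolding *(3) coeff_add using qg *(2) by (auto simp: polys_over_def intro: J_add)
    then have "lead_coeff g ^ k * lead_coeff m \<in> J" by simp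
    then have "lead_coeff g ^ k \<in> J \<or> lead_coeff m \<in> J"
      using bA mA by (intro J_prime) (auto simp: subring_ofD[OF A] polys_over_def)
    then show False using J_power bA g m by blast
  qed
  then have gc: "[:lead_coeff g:] = g" using g(3) by (metis degree_eq_zeroE coeff_pCons_0)
  obtain u h where "g = u * r0 + h" "u \<in> polys_over A" "h \<in> P" using g(1) unfolding I_def by blast
  then show ?thesis using g(2) bA gc by (intro bexI[of _ "lead_coeff g"] bexI[of _ u] bexI[of _ h]) auto
qed

text \<open>\<open>m\<close> is a minimal polynomial of the variable over the fraction field of
  \<open>A / J\<close>. A homomorphism that kills \<open>J\<close> but not the leading coefficient
  of \<open>m\<close> extends to \<open>A[X] / P\<close> by sending \<open>X\<close> to any root of
  the image of \<open>m\<close>; each \<open>r\<close> outside \<open>P\<close> stays nonzero as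
  soon as one element \<open>N\<close> outside \<open>J\<close> does. This lifts points both for
  affine varieties and for power series rings.\<close>

theorem hom_extension:
  assumes nontriv: "\<not> P \<subseteq> polys_over J"
  shows "\<exists>m\<in>P. degree m \<ge> 1 \<and> lead_coeff m \<in> A \<and> lead_coeff m \<notin> J \<and>
    (\<forall>(\<phi> :: 'r \<Rightarrow> 'b::field) \<tau>. ring_hom_on A \<phi> \<longrightarrow> \<phi> ` J \<subseteq> {0} \<longrightarrow> \<phi> (lead_coeff m) \<noteq> 0 \<longrightarrow>
        eval_via \<phi> m \<tau> = 0 \<longrightarrow> (\<forall>h\<in>P. eval_via \<phi> h \<tau> = 0)) \<and>
    (\<forall>r\<in>polys_over A - P. \<exists>N\<in>A - J. \<forall>(\<phi> :: 'r \<Rightarrow> 'b) \<tau>. ring_hom_on A \<phi> \<longrightarrow>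
        (\<forall>h\<in>P. eval_via \<phi> h \<tau> = 0) \<longrightarrow> \<phi> N \<noteq> 0 \<longrightarrow> eval_via \<phi> r \<tau> \<noteq> 0)"
proof -
  define S where "S d \<longleftrightarrow> (\<exists>g\<in>P. lead_coeff g \<notin> J \<and> degree g = d)" for d
  have trimP: "\<exists>d'\<le>degree g. S d'" if g: "g \<in> P" "g \<notin> polys_over J" for g
  proof -
    obtain g' where g': "g - g' \<in> polys_over J" "lead_coeff g' \<notin> J" "degree g' \<le> degree g"
      using trim[of g] g P_sub by blast
    have "g - (g - g') \<in> P" using P_diff[OF g(1) polys_over_J[OF g'(1)]] .
    then show ?thesis using g' unfolding S_def by auto
  qed
  have "\<exists>d. S d" using trimP nontriv by blast
  then obtain d where d: "S d" "\<And>d'. S d' \<Longrightarrow> d \<le> d'" by (metis LeastI_ex Least_le)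
  then obtain m where m: "m \<in> P" "lead_coeff m \<notin> J" "degree m = d" by (auto simp: S_def)
  have mA: "m \<in> polys_over A" using m P_sub by auto
  have aA: "lead_coeff m \<in> A" using mA by (auto simp: polys_over_def)
  have m_min: "g \<in> polys_over J" if "g \<in> P" "degree g < degree m" for g
    using trimP[OF that(1)] d(2) that(2) m(3) by force
  have deg: "degree m \<ge> 1"
  proof (rule ccontr)
    assume "\<not> degree m \<ge> 1"
    then have "m = [:lead_coeff m:]" by (metis degree_eq_zeroE coeff_pCons_0 less_one linorder_not_less)
    then show False using m aA unfolding J_def by auto
  qed
  have 1: "eval_via \<phi> h \<tau> = 0" if \<phi>: "ring_hom_on A \<phi>" "\<phi> ` J \<subseteq> {0}" "\<phi> (lead_coeff m) \<noteq> 0" "eval_via \<phi> m \<tau> = 0"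
    and h: "h \<in> P" for \<phi> :: "'r \<Rightarrow> 'b" and \<tau> h
  proof -
    obtain k q r where *: "q \<in> polys_over A" "r \<in> polys_over A"
      "smult (lead_coeff m ^ k) h = q * m + r" "degree r < degree m"
      using pseudo_division[OF A mA deg, of h] h P_sub by auto
    have hA: "h \<in> polys_over A" using h P_sub by auto
    have "[:lead_coeff m ^ k:] * h - q * m \<in> P"
      using aA Ap(1) m h * by (intro P_diff P_mult) (auto simp: polys_over_pCons subring_ofD[OF A])
    then have "r \<in> P" using *(3) by simp
    then have "r \<in> polys_over J" using m_min * by auto
    then have "map_poly \<phi> r = 0" using \<phi>(2) ring_hom_onD(1)[OF A \<phi>(1)]
      by (auto simp: poly_eq_iff coeff_map_poly polys_over_def)
    then have "eval_via \<phi> (q * m + r) \<tau> = 0"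
      using * mA \<phi>(4) by (simp add: eval_via_add[OF A \<phi>(1)] eval_via_mult[OF A \<phi>(1)] Ap)
    moreover have "eval_via \<phi> (q * m + r) \<tau> = \<phi> (lead_coeff m) ^ k * eval_via \<phi> h \<tau>"
      using aA hA by (simp add: *(3)[symmetric] eval_via_smult[OF A \<phi>(1)] subring_ofD[OF A]
        ring_hom_onD(6)[OF A \<phi>(1)])
    ultimately show ?thesis using \<phi>(3) by simp
  qed
  have 2: "\<exists>N\<in>A - J. \<forall>(\<phi> :: 'r \<Rightarrow> 'b) \<tau>. ring_hom_on A \<phi> \<longrightarrow>
        (\<forall>h\<in>P. eval_via \<phi> h \<tau> = 0) \<longrightarrow> \<phi> N \<noteq> 0 \<longrightarrow> eval_via \<phi> r \<tau> \<noteq> 0" if r: "r \<in> polys_over A - P" for r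
  proof -
    obtain N u h where N: "N \<in> A - J" "u \<in> polys_over A" "h \<in> P" "[:N:] = u * r + h"
      using coprime_const[OF m(1,2) m_min, of r] r by auto
    show ?thesis
    proof (rule bexI[OF _ N(1)], intro allI impI)
      fix \<phi> :: "'r \<Rightarrow> 'b" and \<tau>
      assume \<phi>: "ring_hom_on A \<phi>" "\<forall>h\<in>P. eval_via \<phi> h \<tau> = 0" "\<phi> N \<noteq> 0"
      have "\<phi> N = eval_via \<phi> [:N:] \<tau>" by (simp add: eval_via_pCons[OF A \<phi>(1)])
      also have "\<dots> = eval_via \<phi> u \<tau> * eval_via \<phi> r \<tau>"
        unfolding N(4) using N r \<phi>(2) P_sub
        by (subst eval_via_add[OF A \<phi>(1)]) (auto simp: eval_via_mult[OF A \<phi>(1)] intro: Ap)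
      finally show "eval_via \<phi> r \<tau> \<noteq> 0" using \<phi>(3) by auto
    qed
  qed
  show ?thesis using m(1) deg m(2) aA 1 2 by blast
qed

end

section \<open>Specialisation of finitely generated algebras\<close>

fun adjoin_list :: "'a::field set \<Rightarrow> 'a list \<Rightarrow> 'a set" where
  "adjoin_list F [] = F"
| "adjoin_list F (q # qs) = (\<lambda>h. poly h q) ` polys_over (adjoin_list F qs)"

lemma subring_of_poly_image:
  fixes A :: "'a::comm_ring_1 set"
  assumes "subring_of A"
  shows "subring_of ((\<lambda>h. poly h q) ` polys_over A)"
proof -
  note Ap = subring_ofD[OF subring_of_polys_over[OF assms]]
  have "poly f q + poly g q \<in> (\<lambda>h. poly h q) ` polys_over A"
    "poly f q - poly g q \<in> (\<lambda>h. poly h q) ` polys_over A"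
    "poly f q * poly g q \<in> (\<lambda>h. poly h q) ` polys_over A"
    if "f \<in> polys_over A" "g \<in> polys_over A" for f g
    using Ap(3-5)[OF that, THEN imageI[of _ _ "\<lambda>h. poly h q"]] by simp_all
  moreover have "0 \<in> (\<lambda>h. poly h q) ` polys_over A" "1 \<in> (\<lambda>h. poly h q) ` polys_over A"
    using Ap(1,2) by (force intro: image_eqI[of _ _ 0] image_eqI[of _ _ 1])+
  ultimately show ?thesis unfolding subring_of_def by blast
qed

lemma subring_of_adjoin_list: "subfield_of F \<Longrightarrow> subring_of (adjoin_list F qs)"
  by (induction qs) (auto intro: subring_of_subfield subring_of_poly_image)

lemma adjoin_list_subset:
  assumes "subfield_of F"
  shows "adjoin_list F qs \<subseteq> adjoin_list F (q # qs)" "q \<in> adjoin_list F (q # qs)"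
proof -
  note A = subring_ofD[OF subring_of_adjoin_list[OF assms, of qs]]
  show "adjoin_list F qs \<subseteq> adjoin_list F (q # qs)"
    using A(1) by (auto intro!: image_eqI[of _ _ "[:_:]"] simp: polys_over_def coeff_pCons split: nat.splits)
  show "q \<in> adjoin_list F (q # qs)"
    using A by (auto intro!: image_eqI[of _ _ "[:0,1:]"] simp: polys_over_def coeff_pCons split: nat.splits)
qed

lemma adjoin_list_mem: "subfield_of F \<Longrightarrow> q \<in> set qs \<Longrightarrow> q \<in> adjoin_list F qs"
  by (induction qs) (use adjoin_list_subset in \<open>auto simp del: adjoin_list.simps(2)\<close>)

lemma adjoin_list_base: "subfield_of F \<Longrightarrow> F \<subseteq> adjoin_list F qs"
  by (induction qs) (simp, metis adjoin_list_subset(1) order.trans)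

definition alg_closed_set :: "'a::field set \<Rightarrow> bool" where
  "alg_closed_set F \<longleftrightarrow> subfield_of F \<and> (\<forall>f\<in>polys_over F. degree f \<ge> 1 \<longrightarrow> (\<exists>x\<in>F. poly f x = 0))"

text \<open>A form of the Nullstellensatz. A generator transcendental over the others goes to a
  rational number that is not a root of the specialised polynomial; an algebraic one goes to a root
  of its specialised minimal polynomial, whose leading coefficient is kept nonzero together with the
  constant \<open>N\<close>.\<close>

lemma specialisation:
  fixes F :: "'a::field_char_0 set"
  assumes F: "alg_closed_set F"
  shows "u \<in> adjoin_list F qs \<Longrightarrow> u \<noteq> 0 \<Longrightarrow>
    \<exists>\<phi>. ring_hom_on (adjoin_list F qs) \<phi> \<and> \<phi> ` adjoin_list F qs \<subseteq> F \<and> (\<forall>x\<in>F. \<phi> x = x) \<and> \<phi> u \<noteq> 0"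
proof (induction qs arbitrary: u)
  case Nil
  then show ?case by (intro exI[of _ "\<lambda>x. x"]) (auto simp: ring_hom_on_def)
next
  case (Cons s qs)
  have F': "subfield_of F" using F by (simp add: alg_closed_set_def)
  define A where "A = adjoin_list F qs"
  have A: "subring_of A" unfolding A_def by (rule subring_of_adjoin_list[OF F'])
  note Ap = subring_ofD[OF subring_of_polys_over[OF A]]
  note IH = Cons.IH[folded A_def]
  obtain h0 where h0: "h0 \<in> polys_over A" "u = poly h0 s" using Cons.prems by (auto simp: A_def)
  define P where "P = {h \<in> polys_over A. poly h s = 0}"
  interpret P: poly_prime A P
    by unfold_locales (auto simp: P_def A intro: Ap)
  have J: "P.J = {0}" unfolding P.J_def using subring_ofD[OF A] Ap(1) by (auto simp: P_def polys_over_pCons)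
  have map_F: "map_poly \<phi> h \<in> polys_over F" if "ring_hom_on A \<phi>" "\<phi> ` A \<subseteq> F" "h \<in> polys_over A" for \<phi> h
    using that ring_hom_onD(1)[OF A that(1)] by (auto simp: polys_over_def coeff_map_poly)
  have "\<exists>\<phi> \<tau>. ring_hom_on A \<phi> \<and> \<phi> ` A \<subseteq> F \<and> (\<forall>x\<in>F. \<phi> x = x) \<and> \<tau> \<in> F \<and>
          (\<forall>h\<in>P. eval_via \<phi> h \<tau> = 0) \<and> eval_via \<phi> h0 \<tau> \<noteq> 0"
  proof (cases "P \<subseteq> {0}")
    case True
    have "lead_coeff h0 \<in> A" "lead_coeff h0 \<noteq> 0"
      using h0 Cons.prems by (auto simp: polys_over_def)
    from IH[OF this] obtain \<phi> where \<phi>: "ring_hom_on A \<phi>" "\<phi> ` A \<subseteq> F" "\<forall>x\<in>F. \<phi> x = x" "\<phi> (lead_coeff h0) \<noteq> 0"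
      by blast
    have "coeff (map_poly \<phi> h0) (degree h0) \<noteq> 0"
      using \<phi>(4) ring_hom_onD(1)[OF A \<phi>(1)] by (simp add: coeff_map_poly)
    then have "map_poly \<phi> h0 \<noteq> 0" by auto
    then have "finite {x. eval_via \<phi> h0 x = 0}" by (rule poly_roots_finite)
    moreover have "infinite (\<rat> :: 'a set)" using Rats_infinite by blast
    ultimately have "\<not> \<rat> \<subseteq> {x. eval_via \<phi> h0 x = 0}" using finite_subset by blast
    then obtain \<tau> where "\<tau> \<in> \<rat>" "eval_via \<phi> h0 \<tau> \<noteq> 0" by auto
    then show ?thesis using True \<phi> subfield_of_Rats[OF F'] by (intro exI[of _ \<phi>] exI[of _ \<tau>]) auto
  next
    case False
    then have "\<not> P \<subseteq> polys_over P.J" unfolding J by (auto simp: polys_over_def poly_eq_iff)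
    from P.hom_extension[where ?'b = 'a, OF this] obtain m where m: "m\<in>P" "degree m \<ge> 1" "lead_coeff m \<in> A"
      "lead_coeff m \<notin> P.J"
      and ext: "\<forall>(\<phi> :: 'a \<Rightarrow> 'a) \<tau>. ring_hom_on A \<phi> \<longrightarrow> \<phi> ` P.J \<subseteq> {0} \<longrightarrow> \<phi> (lead_coeff m) \<noteq> 0 \<longrightarrow>
        eval_via \<phi> m \<tau> = 0 \<longrightarrow> (\<forall>h\<in>P. eval_via \<phi> h \<tau> = 0)"
      and nz: "\<forall>r\<in>polys_over A - P. \<exists>N\<in>A - P.J. \<forall>(\<phi> :: 'a \<Rightarrow> 'a) \<tau>. ring_hom_on A \<phi> \<longrightarrow>
        (\<forall>h\<in>P. eval_via \<phi> h \<tau> = 0) \<longrightarrow> \<phi> N \<noteq> 0 \<longrightarrow> eval_via \<phi> r \<tau> \<noteq> 0"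
      by - (elim bexE conjE, rule that, assumption+)
    have "h0 \<in> polys_over A - P" using h0 Cons.prems by (auto simp: P_def)
    then obtain N where N: "N \<in> A - P.J" and N': "\<forall>(\<phi> :: 'a \<Rightarrow> 'a) \<tau>. ring_hom_on A \<phi> \<longrightarrow>
        (\<forall>h\<in>P. eval_via \<phi> h \<tau> = 0) \<longrightarrow> \<phi> N \<noteq> 0 \<longrightarrow> eval_via \<phi> h0 \<tau> \<noteq> 0"
      using nz by blast
    have "lead_coeff m * N \<in> A" "lead_coeff m * N \<noteq> 0"
      using m N unfolding J by (auto intro: subring_ofD[OF A])
    from IH[OF this] obtain \<phi> where \<phi>: "ring_hom_on A \<phi>" "\<phi> ` A \<subseteq> F" "\<forall>x\<in>F. \<phi> x = x" "\<phi> (lead_coeff m * N) \<noteq> 0"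
      by blast
    then have nz2: "\<phi> (lead_coeff m) \<noteq> 0" "\<phi> N \<noteq> 0"
      using m N ring_hom_onD(4)[OF A \<phi>(1), of "lead_coeff m" N] by auto
    have "degree (map_poly \<phi> m) \<ge> degree m"
      using nz2 ring_hom_onD(1)[OF A \<phi>(1)] by (intro le_degree) (simp add: coeff_map_poly)
    moreover have "map_poly \<phi> m \<in> polys_over F" using map_F \<phi> m by (auto simp: P_def)
    ultimately obtain \<tau> where \<tau>: "\<tau> \<in> F" "eval_via \<phi> m \<tau> = 0"
      using F m(2) unfolding alg_closed_set_def by (meson le_trans)
    have "\<forall>h\<in>P. eval_via \<phi> h \<tau> = 0"
      using ext \<phi>(1) nz2 \<tau> ring_hom_onD(1)[OF A \<phi>(1)] unfolding J by blast
    then show ?thesis using N' \<phi> nz2 \<tau> by (intro exI[of _ \<phi>] exI[of _ \<tau>]) auto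
  qed
  then obtain \<phi> \<tau> where \<phi>: "ring_hom_on A \<phi>" "\<phi> ` A \<subseteq> F" "\<forall>x\<in>F. \<phi> x = x" "\<tau> \<in> F"
    "\<forall>h\<in>P. eval_via \<phi> h \<tau> = 0" "eval_via \<phi> h0 \<tau> \<noteq> 0" by blast
  \<comment> \<open>An element may be \<open>poly h s\<close> for several \<open>h\<close>; two of
    them differ by a member of \<open>P\<close>, which evaluation at \<open>\<tau>\<close> kills, so
    the choice does not matter.\<close>
  define \<psi> where "\<psi> y = eval_via \<phi> (SOME h. h \<in> polys_over A \<and> poly h s = y) \<tau>" for y
  have \<psi>: "\<psi> (poly h s) = eval_via \<phi> h \<tau>" if h: "h \<in> polys_over A" for h
  proof -
    define g where "g = (SOME g. g \<in> polys_over A \<and> poly g s = poly h s)"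
    have g: "g \<in> polys_over A \<and> poly g s = poly h s" unfolding g_def by (rule someI[of _ h]) (use h in auto)
    then have "h - g \<in> P" using h by (auto simp: P_def intro: Ap)
    then have "eval_via \<phi> (g + (h - g)) \<tau> = eval_via \<phi> g \<tau>"
      using \<phi>(5) g h by (subst eval_via_add[OF A \<phi>(1)]) (auto intro: Ap)
    then show ?thesis by (simp add: \<psi>_def g_def)
  qed
  have \<psi>_const: "\<psi> a = \<phi> a" if "a \<in> A" for a
    using \<psi>[of "[:a:]"] that Ap(1) by (simp add: polys_over_pCons eval_via_pCons[OF A \<phi>(1)])
  have "ring_hom_on (adjoin_list F (s # qs)) \<psi>"
    unfolding ring_hom_on_def
  proof (intro conjI ballI)
    show "\<psi> 0 = 0" "\<psi> 1 = 1"
      using \<psi>_const[of 0] \<psi>_const[of 1] ring_hom_onD(1,2)[OF A \<phi>(1)] subring_ofD(1,2)[OF A] by auto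
  next
    fix x y assume "x \<in> adjoin_list F (s # qs)" "y \<in> adjoin_list F (s # qs)"
    then obtain f g where *: "f \<in> polys_over A" "x = poly f s" "g \<in> polys_over A" "y = poly g s"
      by (auto simp: A_def)
    show "\<psi> (x + y) = \<psi> x + \<psi> y"
      using * \<psi>[of "f + g"] \<psi>[of f] \<psi>[of g] by (simp add: Ap eval_via_add[OF A \<phi>(1)])
    show "\<psi> (x * y) = \<psi> x * \<psi> y"
      using * \<psi>[of "f * g"] \<psi>[of f] \<psi>[of g] by (simp add: Ap eval_via_mult[OF A \<phi>(1)])
  qed
  moreover have "\<psi> ` adjoin_list F (s # qs) \<subseteq> F"
  proof
    fix z assume "z \<in> \<psi> ` adjoin_list F (s # qs)"
    then obtain h where h: "h \<in> polys_over A" "z = eval_via \<phi> h \<tau>" by (auto simp: A_def[symmetric] \<psi>)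
    have "map_poly \<phi> h \<in> polys_over F" using map_F \<phi> h by auto
    then show "z \<in> F" using \<phi>(4) unfolding h(2) poly_altdef
      by (auto simp: polys_over_def intro!: subfield_of_sum[OF F'] subfield_ofD[OF F'])
  qed
  moreover have "\<forall>x\<in>F. \<psi> x = x"
    using \<psi>_const \<phi>(3) adjoin_list_base[OF F', of qs] by (auto simp: A_def)
  moreover have "\<psi> u \<noteq> 0" using \<psi> h0 \<phi>(6) by simp
  ultimately show ?case by blast
qed

section \<open>Evaluation of multivariate polynomials\<close>

lemma mpol_eval_superset:
  assumes "finite M" "Poly_Mapping.keys P \<subseteq> M"
  shows "mpol_eval a P = (\<Sum>m\<in>M. Poly_Mapping.lookup P m * (\<Prod>x\<in>Poly_Mapping.keys m. a x ^ Poly_Mapping.lookup m x))"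
  unfolding mpol_eval_def
  by (rule sum.mono_neutral_left) (use assms in \<open>auto simp: in_keys_iff\<close>)

lemma mpol_eval_add: "mpol_eval a (P + Q) = mpol_eval a P + mpol_eval a Q"
  using Poly_Mapping.keys_add[of P Q]
  by (simp add: mpol_eval_superset[of "Poly_Mapping.keys P \<union> Poly_Mapping.keys Q"] lookup_add
      distrib_right sum.distrib)

text \<open>Polynomials regarded as functions of the assignment. The ring operations become
  pointwise, and polynomials can be written as lambda terms without computing in the polynomial
  type.\<close>

definition mpol_funs :: "'a::comm_ring_1 set \<Rightarrow> 'x set \<Rightarrow> (('x \<Rightarrow> 'a) \<Rightarrow> 'a) set" where
  "mpol_funs F X = {\<lambda>a. mpol_eval a P | P. mpol_coeffs_in F P \<and> mpol_vars P \<subseteq> X}"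

context
  fixes F :: "'a::comm_ring_1 set" and X :: "'x set"
  assumes F: "subring_of F"
begin

lemma mpol_funs_mono:
  assumes "c \<in> F" "Poly_Mapping.keys m \<subseteq> X"
  shows "(\<lambda>a. c * (\<Prod>x\<in>Poly_Mapping.keys m. a x ^ Poly_Mapping.lookup m x)) \<in> mpol_funs F X"
proof -
  have "mpol_eval a (Poly_Mapping.single m c) = c * (\<Prod>x\<in>Poly_Mapping.keys m. a x ^ Poly_Mapping.lookup m x)" for a
    by (subst mpol_eval_superset[of "{m}"]) auto
  moreover have "mpol_coeffs_in F (Poly_Mapping.single m c)"
    using assms subring_ofD(1)[OF F] by (auto simp: mpol_coeffs_in_def lookup_single when_def)
  moreover have "mpol_vars (Poly_Mapping.single m c) \<subseteq> X" using assms by (auto simp: mpol_vars_def)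
  ultimately show ?thesis unfolding mpol_funs_def
    by (auto intro!: exI[of _ "Poly_Mapping.single m c"])
qed

lemma mpol_funs_const: "c \<in> F \<Longrightarrow> (\<lambda>a. c) \<in> mpol_funs F X"
  using mpol_funs_mono[of c 0] by simp

lemma mpol_funs_var: "x \<in> X \<Longrightarrow> (\<lambda>a. a x) \<in> mpol_funs F X"
  using mpol_funs_mono[of 1 "Poly_Mapping.single x 1"] subring_ofD(2)[OF F] by simp

lemma mpol_funs_add:
  assumes "f \<in> mpol_funs F X" "g \<in> mpol_funs F X"
  shows "(\<lambda>a. f a + g a) \<in> mpol_funs F X"
proof -
  obtain P Q where *: "f = (\<lambda>a. mpol_eval a P)" "mpol_coeffs_in F P" "mpol_vars P \<subseteq> X"
    "g = (\<lambda>a. mpol_eval a Q)" "mpol_coeffs_in F Q" "mpol_vars Q \<subseteq> X" using assms by (auto simp: mpol_funs_def)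
  then have "mpol_coeffs_in F (P + Q)" "mpol_vars (P + Q) \<subseteq> X"
    using Poly_Mapping.keys_add[of P Q]
    by (auto simp: mpol_coeffs_in_def lookup_add mpol_vars_def intro: subring_ofD[OF F]) blast
  then show ?thesis using * unfolding mpol_funs_def
    by (auto simp: mpol_eval_add[symmetric])
qed

lemma mpol_funs_sum:
  "(\<And>i. i \<in> I \<Longrightarrow> f i \<in> mpol_funs F X) \<Longrightarrow> (\<lambda>a. \<Sum>i\<in>I. f i a) \<in> mpol_funs F X"
proof (induction I rule: infinite_finite_induct)
  case (insert i I)
  then show ?case using mpol_funs_add[of "f i" "\<lambda>a. \<Sum>i\<in>I. f i a"] by simp
qed (auto intro: mpol_funs_const subring_ofD[OF F])

lemma mpol_funs_mult:
  assumes "f \<in> mpol_funs F X" "g \<in> mpol_funs F X"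
  shows "(\<lambda>a. f a * g a) \<in> mpol_funs F X"
proof -
  obtain P Q where *: "f = (\<lambda>a. mpol_eval a P)" "mpol_coeffs_in F P" "mpol_vars P \<subseteq> X"
    "g = (\<lambda>a. mpol_eval a Q)" "mpol_coeffs_in F Q" "mpol_vars Q \<subseteq> X" using assms by (auto simp: mpol_funs_def)
  define mon where "mon a m = (\<Prod>x\<in>Poly_Mapping.keys m. a x ^ Poly_Mapping.lookup m x)" for a :: "'x \<Rightarrow> 'a" and m
  have mon_superset: "mon a m = (\<Prod>x\<in>Y. a x ^ Poly_Mapping.lookup m x)" if "finite Y"
    "Poly_Mapping.keys m \<subseteq> Y" for a m Y
    unfolding mon_def by (rule prod.mono_neutral_left) (use that in \<open>auto simp: in_keys_iff\<close>)
  have mon_add: "mon a (m + m') = mon a m * mon a m'" for a m m'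
    using Poly_Mapping.keys_add[of m m']
    by (simp add: mon_superset[of "Poly_Mapping.keys m \<union> Poly_Mapping.keys m'"] lookup_add power_add prod.distrib)
  have "f a * g a = (\<Sum>m\<in>Poly_Mapping.keys P. \<Sum>m'\<in>Poly_Mapping.keys Q.
      (Poly_Mapping.lookup P m * Poly_Mapping.lookup Q m') * mon a (m + m'))" for a
    unfolding * mpol_eval_def mon_add sum_product by (simp add: mon_def algebra_simps)
  moreover have "(\<lambda>a. \<Sum>m\<in>Poly_Mapping.keys P. \<Sum>m'\<in>Poly_Mapping.keys Q.
      (Poly_Mapping.lookup P m * Poly_Mapping.lookup Q m') * mon a (m + m')) \<in> mpol_funs F X"
  proof (intro mpol_funs_sum, unfold mon_def, rule mpol_funs_mono)
    fix m m' assume "m \<in> Poly_Mapping.keys P" "m' \<in> Poly_Mapping.keys Q"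
    then have "Poly_Mapping.keys m \<subseteq> mpol_vars P" "Poly_Mapping.keys m' \<subseteq> mpol_vars Q"
      by (auto simp: mpol_vars_def)
    then show "Poly_Mapping.keys (m + m') \<subseteq> X"
      using Poly_Mapping.keys_add[of m m'] *(3,6) by (meson Un_least order.trans)
  qed (use * in \<open>auto simp: mpol_coeffs_in_def intro: subring_ofD[OF F]\<close>)
  ultimately show ?thesis by simp
qed

lemma mpol_funs_prod:
  "(\<And>i. i \<in> I \<Longrightarrow> f i \<in> mpol_funs F X) \<Longrightarrow> (\<lambda>a. \<Prod>i\<in>I. f i a) \<in> mpol_funs F X"
proof (induction I rule: infinite_finite_induct)
  case (insert i I)
  then show ?case using mpol_funs_mult[of "f i" "\<lambda>a. \<Prod>i\<in>I. f i a"] by simp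
qed (auto intro: mpol_funs_const subring_ofD[OF F])

lemma mpol_funs_power: "f \<in> mpol_funs F X \<Longrightarrow> (\<lambda>a. f a ^ k) \<in> mpol_funs F X"
  using mpol_funs_prod[of "{..<k}" "\<lambda>_. f"] by simp

end

lemma mpol_eval_in_subring:
  assumes "subring_of A" "mpol_coeffs_in F P" "F \<subseteq> A" "\<And>x. x \<in> mpol_vars P \<Longrightarrow> a x \<in> A"
  shows "mpol_eval a P \<in> A"
  unfolding mpol_eval_def
  by (intro subring_of_sum subring_of_prod subring_ofD[OF assms(1)] assms)
    (use assms in \<open>auto simp: mpol_coeffs_in_def mpol_vars_def\<close>)

lemma mpol_eval_hom:
  assumes A: "subring_of A" and \<phi>: "ring_hom_on A \<phi>" and "mpol_coeffs_in F P" "F \<subseteq> A" "\<forall>c\<in>F. \<phi> c = c"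
    "\<And>x. x \<in> mpol_vars P \<Longrightarrow> a x \<in> A"
  shows "\<phi> (mpol_eval a P) = mpol_eval (\<lambda>x. \<phi> (a x)) P"
proof -
  have c: "Poly_Mapping.lookup P m \<in> F" "Poly_Mapping.lookup P m \<in> A" for m
    using assms by (auto simp: mpol_coeffs_in_def)
  have aA: "a x \<in> A" if "x \<in> Poly_Mapping.keys m" "m \<in> Poly_Mapping.keys P" for x m
    using that by (intro assms) (auto simp: mpol_vars_def)
  have p: "a x ^ k \<in> A" if "x \<in> Poly_Mapping.keys m" "m \<in> Poly_Mapping.keys P" for x m k
    using aA[OF that] by (rule subring_ofD[OF A])
  have pr: "(\<Prod>x\<in>Poly_Mapping.keys m. a x ^ Poly_Mapping.lookup m x) \<in> A" if "m \<in> Poly_Mapping.keys P" for m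
    using p that by (auto intro: subring_of_prod[OF A])
  show ?thesis unfolding mpol_eval_def
    using c pr by (subst ring_hom_on_sum[OF A \<phi>])
      (auto intro!: sum.cong prod.cong subring_ofD(5)[OF A] simp: ring_hom_onD(4)[OF A \<phi>]
        ring_hom_on_prod[OF A \<phi>] p
        ring_hom_onD(6)[OF A \<phi>] aA assms(5))
qed

section \<open>The dimension of a variety with a point of large transcendence degree\<close>

lemma mpol_funs_cong:
  assumes "f \<in> mpol_funs F X" "\<And>x. x \<in> X \<Longrightarrow> a x = b x"
  shows "f a = f b"
proof -
  obtain P where P: "f = (\<lambda>a. mpol_eval a P)" "mpol_vars P \<subseteq> X" using assms by (auto simp: mpol_funs_def)
  have "(\<Prod>x\<in>Poly_Mapping.keys m. a x ^ Poly_Mapping.lookup m x) = (\<Prod>x\<in>Poly_Mapping.keys m. b x ^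
    Poly_Mapping.lookup m x)"
    if "m \<in> Poly_Mapping.keys P" for m
    by (rule prod.cong) (use that P assms in \<open>auto simp: mpol_vars_def\<close>)
  then show ?thesis by (simp add: P mpol_eval_def)
qed

lemma mpol_funs_closed:
  assumes "subring_of F" "f \<in> mpol_funs F X" "\<And>x. x \<in> X \<Longrightarrow> a x \<in> F"
  shows "f a \<in> F"
  using assms mpol_eval_in_subring[OF assms(1) _ subset_refl, of _ a] by (force simp: mpol_funs_def)

text \<open>The quotients form a subfield containing the generators, hence contain the generated
  field. Allowing any \<open>F\<close> serves both rational coefficients and the fields of the
  tower.\<close>

lemma Q_adjoin_fractions:
  assumes F: "subfield_of F" and b: "b \<in> Q_adjoin (a ` X)"
  shows "\<exists>G\<in>mpol_funs F X. \<exists>H\<in>mpol_funs F X. H a \<noteq> 0 \<and> b = G a / H a"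
proof -
  have F': "subring_of F" using F by (rule subring_of_subfield)
  note mf = mpol_funs_const[OF F', where X = X] mpol_funs_var[OF F', where X = X]
    mpol_funs_add[OF F', where X = X] mpol_funs_mult[OF F', where X = X]
  define S where "S = {G a / H a | G H. G \<in> mpol_funs F X \<and> H \<in> mpol_funs F X \<and> H a \<noteq> 0}"
  have SI: "x \<in> S" if "x = G a / H a" "G \<in> mpol_funs F X" "H \<in> mpol_funs F X" "H a \<noteq> 0" for x G H
    using that unfolding S_def by blast
  have m: "(\<lambda>a. f a - g a) \<in> mpol_funs F X" if "f \<in> mpol_funs F X" "g \<in> mpol_funs F X" for f g
    using mf(3)[OF that(1) mf(4)[OF mf(1)[of "-1"] that(2)]] subfield_ofD[OF F] by simp
  have "subfield_of S" unfolding subfield_of_def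
  proof (intro conjI ballI)
    show "0 \<in> S" by (rule SI[of _ "\<lambda>a. 0" "\<lambda>a. 1"]) (auto intro: mf subfield_ofD[OF F])
    show "1 \<in> S" by (rule SI[of _ "\<lambda>a. 1" "\<lambda>a. 1"]) (auto intro: mf subfield_ofD[OF F])
  next
    fix x y assume "x \<in> S" "y \<in> S"
    then obtain G H G' H' where *: "x = G a / H a" "G \<in> mpol_funs F X" "H \<in> mpol_funs F X" "H a \<noteq> 0"
      "y = G' a / H' a" "G' \<in> mpol_funs F X" "H' \<in> mpol_funs F X" "H' a \<noteq> 0" unfolding S_def by blast

    show "x + y \<in> S" by (rule SI[of _ "\<lambda>a. G a * H' a + G' a * H a" "\<lambda>a. H a * H' a"])
      (use * in \<open>auto intro!: mf simp: field_simps\<close>)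
    show "x - y \<in> S" by (rule SI[of _ "\<lambda>a. G a * H' a - G' a * H a" "\<lambda>a. H a * H' a"])
      (use * in \<open>simp_all add: mf m diff_frac_eq\<close>)
    show "x * y \<in> S" by (rule SI[of _ "\<lambda>a. G a * G' a" "\<lambda>a. H a * H' a"])
      (use * in \<open>simp_all add: mf\<close>)
  next
    fix x assume "x \<in> S"
    then obtain G H where *: "x = G a / H a" "G \<in> mpol_funs F X" "H \<in> mpol_funs F X" "H a \<noteq> 0"
      unfolding S_def by blast
    show "inverse x \<in> S"
    proof (cases "G a = 0")
      case True
      then show ?thesis using *
        by (intro SI[of _ "\<lambda>a. 0" "\<lambda>a. 1"]) (auto intro: mf subfield_ofD[OF F])
    next
      case False then show ?thesis by (intro SI[of _ H G]) (use * in auto)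
    qed
  qed
  moreover have "a ` X \<subseteq> S"
  proof safe
    fix x assume "x \<in> X"
    then show "a x \<in> S" by (intro SI[of _ "\<lambda>a. a x" "\<lambda>a. 1"]) (auto intro: mf subfield_ofD[OF F])
  qed
  ultimately have "b \<in> S" using Q_adjoin_least b by blast
  then show ?thesis unfolding S_def by blast
qed

text \<open>Clearing denominators in an algebraic relation for \<open>b i\<close> gives a rational
  polynomial \<open>W\<close> vanishing at \<open>b\<close>. Independence makes it zero; replacing
  \<open>b i\<close> by an arbitrary \<open>T\<close> then shows that \<open>f\<close> vanishes
  everywhere.\<close>

lemma algebraically_independent_not_algebraic:
  fixes b :: "nat \<Rightarrow> 'a::field_char_0"
  assumes ind: "algebraically_independent \<rat> n b" and i: "i < n"
  shows "b i \<notin> algebraic_over (Q_adjoin (b ` {..<i}))"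
proof
  assume "b i \<in> algebraic_over (Q_adjoin (b ` {..<i}))"
  then obtain f where f: "f \<noteq> 0" "\<And>k. coeff f k \<in> Q_adjoin (b ` {..<i})" "poly f (b i) = 0"
    by (auto simp: algebraic_over_def)
  have Q: "subring_of (\<rat> :: 'a set)" by (rule subring_of_subfield[OF subfield_of_Rats_self])
  have "\<exists>G H. G \<in> mpol_funs \<rat> {..<i} \<and> H \<in> mpol_funs \<rat> {..<i} \<and> H b \<noteq> 0 \<and> coeff f k = G b / H b" for k
    using Q_adjoin_fractions[OF subfield_of_Rats_self f(2)] by blast
  then obtain G H where GH: "\<And>k. G k \<in> mpol_funs \<rat> {..<i}" "\<And>k. H k \<in> mpol_funs \<rat> {..<i}"
    "\<And>k. H k b \<noteq> 0" "\<And>k. coeff f k = G k b / H k b" by metis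
  define d where "d = degree f"
  define g where "g k a = G k a * (\<Prod>l\<in>{..d}-{k}. H l a)" for k a
  define D where "D = (\<Prod>l\<in>{..d}. H l b)"
  define W where "W a = (\<Sum>k\<le>d. g k a * a i ^ k)" for a
  have D0: "D \<noteq> 0" using GH by (simp add: D_def)
  have g: "g k \<in> mpol_funs \<rat> {..<i}" for k
    unfolding g_def by (intro mpol_funs_mult[OF Q] mpol_funs_prod[OF Q] GH)
  have gb: "g k b = D * coeff f k" if "k \<le> d" for k
    using GH that by (simp add: g_def D_def prod.remove[of "{..d}" k])
  have sub: "mpol_funs \<rat> {..<i} \<subseteq> mpol_funs (\<rat>::'a set) {..<n}"
    using i by (fastforce simp: mpol_funs_def)
  have "W \<in> mpol_funs \<rat> {..<n}" unfolding W_def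
    using i g sub by (intro mpol_funs_sum[OF Q] mpol_funs_mult[OF Q] mpol_funs_power[OF Q] mpol_funs_var[OF
      Q]) auto
  then obtain P where P: "W = (\<lambda>a. mpol_eval a P)" "mpol_coeffs_in \<rat> P" "mpol_vars P \<subseteq> {..<n}"
    by (auto simp: mpol_funs_def)
  have WT: "W (b(i := T)) = D * poly f T" for T
  proof -
    have "g k (b(i := T)) = g k b" for k by (rule mpol_funs_cong[OF g]) auto
    then show ?thesis by (simp add: W_def gb poly_altdef d_def sum_distrib_left mult.assoc)
  qed
  have "mpol_eval b P = 0" using WT[of "b i"] f(3) by (simp add: P fun_upd_idem)
  then have "P = 0" using ind P unfolding algebraically_independent_def by blast
  then have "poly f T = 0" for T using WT[of T] D0 by (simp add: P mpol_eval_def)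
  then show False using f(1) poly_all_0_iff_0 by blast
qed

text \<open>For \<open>q\<close> in \<open>GaGm\<close>, the Zariski closure of the point over
  \<open>F\<close>: the smallest closed set defined over \<open>F\<close> containing it, with points
  in the ambient field.\<close>

definition locus :: "'a::field set \<Rightarrow> ('a ^ 'n) \<times> ('a ^ 'n) \<Rightarrow> (('a ^ 'n) \<times> ('a ^ 'n)) set" where
  "locus F q = {x \<in> GaGm. \<forall>P. mpol_coeffs_in F P \<longrightarrow> mpol_eval (coords q) P = 0 \<longrightarrow> mpol_eval (coords x) P = 0}"

lemma zariski_closed_locus: "zariski_closed (locus F q)"
  unfolding closed_defined_over_def locus_def
  by (rule exI[of _ "{P. mpol_coeffs_in F P \<and> mpol_eval (coords q) P = 0}"]) (auto simp: mpol_coeffs_in_def)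

lemma locus_mono: "F \<subseteq> F' \<Longrightarrow> locus F' q \<subseteq> locus F q"
  unfolding locus_def mpol_coeffs_in_def by blast

lemma locus_self: "q \<in> GaGm \<Longrightarrow> q \<in> locus F q"
  unfolding locus_def by blast

lemma locus_subset:
  assumes "closed_defined_over F V" "q \<in> V"
  shows "locus F q \<subseteq> V"
  using assms unfolding closed_defined_over_def locus_def by auto

text \<open>An \<open>F\<close>-homomorphism to \<open>F\<close> from the algebra generated by the
  coordinates carries \<open>q\<close> to an \<open>F\<close>-rational point of the locus. The
  product of the multiplicative coordinates is kept nonzero too, so that the new point stays in
  \<open>GaGm\<close>.\<close>

lemma locus_point:
  fixes q :: "('a::field_char_0 ^ 'n) \<times> ('a ^ 'n)"
  assumes F: "alg_closed_set F" and q: "q \<in> GaGm" and f: "f \<in> mpol_funs F UNIV" "f (coords q) \<noteq> 0"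
  shows "\<exists>a\<in>locus F q. (\<forall>j. coords a j \<in> F) \<and> f (coords a) \<noteq> 0"
proof -
  have F': "subfield_of F" using F by (simp add: alg_closed_set_def)
  obtain js :: "('n + 'n) list" where js: "set js = UNIV" using finite_list[OF finite] by blast
  define A where "A = adjoin_list F (map (coords q) js)"
  have A: "subring_of A" unfolding A_def by (rule subring_of_adjoin_list[OF F'])
  have FA: "F \<subseteq> A" unfolding A_def by (rule adjoin_list_base[OF F'])
  have qA: "coords q j \<in> A" for j unfolding A_def by (rule adjoin_list_mem[OF F']) (use js in auto)
  obtain P where P: "f = (\<lambda>a. mpol_eval a P)" "mpol_coeffs_in F P" using f by (auto simp: mpol_funs_def)
  have fA: "f (coords q) \<in> A"
    unfolding P(1) by (rule mpol_eval_in_subring[OF A P(2) FA qA])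
  define y where "y = (\<Prod>i\<in>UNIV. coords q (Inr i))"
  have yA: "y \<in> A" unfolding y_def by (intro subring_of_prod[OF A] qA)
  have "y \<noteq> 0" using q by (auto simp: y_def GaGm_def coords_def split_beta)
  then have "f (coords q) * y \<in> adjoin_list F (map (coords q) js)" "f (coords q) * y \<noteq> 0"
    using fA yA f(2) by (auto simp: A_def[symmetric] intro: subring_ofD[OF A])
  from specialisation[OF F this] obtain \<phi> where \<phi>: "ring_hom_on A \<phi>" "\<phi> ` A \<subseteq> F" "\<forall>x\<in>F. \<phi> x = x"
    "\<phi> (f (coords q) * y) \<noteq> 0" unfolding A_def by blast
  have nz: "\<phi> (f (coords q)) \<noteq> 0" "\<phi> y \<noteq> 0"
    using \<phi>(4) ring_hom_onD(4)[OF A \<phi>(1) fA yA] by auto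
  have "\<phi> y = (\<Prod>i\<in>UNIV. \<phi> (coords q (Inr i)))"
    unfolding y_def by (rule ring_hom_on_prod[OF A \<phi>(1)]) (rule qA)
  then have nz': "\<phi> (coords q (Inr i)) \<noteq> 0" for i using nz(2) by auto
  define a where "a = ((\<chi> i. \<phi> (coords q (Inl i))) :: 'a ^ 'n, (\<chi> i. \<phi> (coords q (Inr i))) :: 'a ^ 'n)"
  have ca: "coords a j = \<phi> (coords q j)" for j by (cases j) (auto simp: a_def coords_def)
  have hom: "mpol_eval (coords a) Q = \<phi> (mpol_eval (coords q) Q)" if "mpol_coeffs_in F Q" for Q
    unfolding ca by (rule mpol_eval_hom[OF A \<phi>(1) that FA \<phi>(3) qA, symmetric])
  have "a \<in> GaGm" using nz' by (auto simp: a_def GaGm_def)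
  then have "a \<in> locus F q" using hom ring_hom_onD(1)[OF A \<phi>(1)] by (auto simp: locus_def)
  moreover have "f (coords a) \<noteq> 0" using hom[OF P(2)] nz by (simp add: P(1))
  moreover have "\<forall>j. coords a j \<in> F" using ca \<phi>(2) qA by auto
  ultimately show ?thesis by blast
qed

text \<open>The coefficients are expanded in a finite set \<open>E\<close> whose span contains them;
  least cardinality makes \<open>E\<close> linearly independent over \<open>F\<close>.\<close>

lemma mpol_decomposition:
  fixes P :: "('x, 'a::field) mpol"
  assumes F: "subfield_of F"
  shows "\<exists>E f. finite E \<and> (\<forall>e\<in>E. f e \<in> mpol_funs F UNIV) \<and> (\<forall>a. mpol_eval a P = (\<Sum>e\<in>E. f e a * e)) \<and>
    (\<forall>c. (\<forall>e\<in>E. c e \<in> F) \<longrightarrow> (\<Sum>e\<in>E. c e * e) = 0 \<longrightarrow> (\<forall>e\<in>E. c e = 0))"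
proof -
  define C where "C = Poly_Mapping.lookup P ` Poly_Mapping.keys P"
  define S where "S k \<longleftrightarrow> (\<exists>E. finite E \<and> C \<subseteq> fspan F E \<and> card E = k)" for k
  have "S (card C)" unfolding S_def
    by (rule exI[of _ C]) (auto simp: C_def intro!: fspan_base[OF F])
  then obtain k where k: "S k" "\<And>j. S j \<Longrightarrow> k \<le> j" by (metis LeastI_ex Least_le)
  then obtain E where E: "finite E" "C \<subseteq> fspan F E" "card E = k" by (auto simp: S_def)
  have indep: "c e0 = 0" if c: "\<forall>e\<in>E. c e \<in> F" "(\<Sum>e\<in>E. c e * e) = 0" and e0: "e0 \<in> E" for c e0
  proof (rule ccontr)
    assume nz: "c e0 \<noteq> 0"
    have "c e0 * e0 + (\<Sum>e\<in>E-{e0}. c e * e) = 0" using c e0 E by (simp add: sum.remove)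
    then have "e0 = (\<Sum>e\<in>E-{e0}. (- (c e / c e0)) * e)"
      using nz by (simp add: sum_negf sum_divide_distrib[symmetric] field_simps eq_neg_iff_add_eq_0)
    then have e0s: "e0 \<in> fspan F (E - {e0})" unfolding fspan_def using c e0
      by (auto intro!: exI[of _ "\<lambda>e. - (c e / c e0)"] subfield_ofD[OF F])
    have "fspan F E \<subseteq> fspan F (E - {e0})"
    proof
      fix x assume "x \<in> fspan F E"
      then obtain d where d: "x = (\<Sum>e\<in>E. d e * e)" "\<forall>e\<in>E. d e \<in> F" by (auto simp: fspan_def)
      have "e \<in> fspan F (E - {e0})" if "e \<in> E" for e
        using e0s fspan_base[OF F, of "E - {e0}" e] that E by (cases "e = e0") auto
      then show "x \<in> fspan F (E - {e0})" unfolding d(1) using d(2)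
        by (intro fspan_sum[OF F] fspan_scale[OF F]) auto
    qed
    then have "S (card (E - {e0}))" using E unfolding S_def by (intro exI[of _ "E - {e0}"]) auto
    then have "card E \<le> card (E - {e0})" using k E by auto
    then show False using card_Diff1_less[OF E(1) e0] by simp
  qed
  have "\<forall>m\<in>Poly_Mapping.keys P. \<exists>c. (\<forall>e\<in>E. c e \<in> F) \<and> Poly_Mapping.lookup P m = (\<Sum>e\<in>E. c e * e)"
    using E(2) unfolding C_def fspan_def by blast
  then obtain c where c: "\<forall>m\<in>Poly_Mapping.keys P. (\<forall>e\<in>E. c m e \<in> F) \<and> Poly_Mapping.lookup P m = (\<Sum>e\<in>E. c m e * e)"
    by metis
  define f where "f e a = (\<Sum>m\<in>Poly_Mapping.keys P. c m e * (\<Prod>x\<in>Poly_Mapping.keys m. a x ^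
    Poly_Mapping.lookup m x))"
    for e and a :: "'x \<Rightarrow> 'a"
  have "f e \<in> mpol_funs F UNIV" if "e \<in> E" for e unfolding f_def
    using c that by (intro mpol_funs_sum mpol_funs_mono subring_of_subfield F) auto
  moreover have "mpol_eval a P = (\<Sum>e\<in>E. f e a * e)" for a
  proof -
    have "mpol_eval a P = (\<Sum>m\<in>Poly_Mapping.keys P. \<Sum>e\<in>E. c m e * (\<Prod>x\<in>Poly_Mapping.keys m. a x ^
      Poly_Mapping.lookup m x) * e)"
      unfolding mpol_eval_def by (rule sum.cong) (use c in \<open>auto simp: sum_distrib_right algebra_simps\<close>)
    also have "\<dots> = (\<Sum>e\<in>E. f e a * e)"
      by (subst sum.swap) (simp add: f_def sum_distrib_right)
    finally show ?thesis .
  qed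
  ultimately show ?thesis using E(1) indep by (intro exI[of _ E] exI[of _ f]) simp
qed

text \<open>A polynomial over the big field vanishes at an \<open>F\<close>-rational point iff all its components with
  respect to \<open>F\<close>-independent elements do; by \<open>locus_point\<close> the \<open>F\<close>-rational points suffice.\<close>

lemma irreducible_locus:
  fixes q :: "('a::field_char_0 ^ 'n) \<times> ('a ^ 'n)"
  assumes F: "alg_closed_set F" and q: "q \<in> GaGm"
  shows "irreducible_closed (locus F q)"
proof -
  have F': "subfield_of F" using F by (simp add: alg_closed_set_def)
  have *: "\<exists>g\<in>mpol_funs F UNIV. g (coords q) \<noteq> 0 \<and> (\<forall>a\<in>A. (\<forall>j. coords a j \<in> F) \<longrightarrow> g (coords a) = 0)"
    if A: "zariski_closed A" and "A \<subset> locus F q" for A :: "(('a ^ 'n) \<times> ('a ^ 'n)) set"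
  proof -
    obtain x where x: "x \<in> locus F q" "x \<notin> A" using \<open>A \<subset> _\<close> by blast
    from A obtain S where S: "A = {q \<in> GaGm. \<forall>P\<in>S. mpol_eval (coords q) P = 0}"
      unfolding closed_defined_over_def by blast
    then obtain P where P: "P \<in> S" "mpol_eval (coords x) P \<noteq> 0" using x by (auto simp: locus_def)
    obtain E f where E: "finite E" "\<forall>e\<in>E. f e \<in> mpol_funs F UNIV" "\<forall>a. mpol_eval a P = (\<Sum>e\<in>E. f e a * e)"
      "\<forall>c. (\<forall>e\<in>E. c e \<in> F) \<longrightarrow> (\<Sum>e\<in>E. c e * e) = 0 \<longrightarrow> (\<forall>e\<in>E. c e = 0)"
      using mpol_decomposition[OF F', of P] by blast
    obtain e where e: "e \<in> E" "f e (coords x) \<noteq> 0"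
    proof (rule ccontr)
      assume "\<not> thesis"
      then have "(\<Sum>e\<in>E. f e (coords x) * e) = 0" using that by (intro sum.neutral) auto
      then show False using P E(3) by simp
    qed
    obtain Q where Q: "f e = (\<lambda>a. mpol_eval a Q)" "mpol_coeffs_in F Q" using E(2) e by (auto simp: mpol_funs_def)
    have "f e (coords q) \<noteq> 0" using x(1) Q e(2) by (auto simp: locus_def)
    moreover have "f e (coords a) = 0" if a: "a \<in> A" "\<forall>j. coords a j \<in> F" for a
    proof -
      have "f e' (coords a) \<in> F" if "e' \<in> E" for e'
        by (rule mpol_funs_closed[OF subring_of_subfield[OF F'], of "f e'" UNIV "coords a"])
          (use E(2) that a(2) in auto)
      moreover have "(\<Sum>e\<in>E. f e (coords a) * e) = 0" using a(1) P(1) S E(3) by auto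
      ultimately show ?thesis using E(4)[rule_format, of "\<lambda>e. f e (coords a)" e] e(1) by simp
    qed
    ultimately show ?thesis using E(2) e(1) by blast
  qed
  have "locus F q = A \<or> locus F q = B"
    if AB: "zariski_closed A" "zariski_closed B" "locus F q = A \<union> B" for A B
  proof (rule ccontr)
    assume "\<not> ?thesis"
    then have sub: "A \<subset> locus F q" "B \<subset> locus F q" using AB(3) by auto
    obtain g where g: "g\<in>mpol_funs F UNIV" "g (coords q) \<noteq> 0" "\<forall>a\<in>A. (\<forall>j. coords a j \<in> F) \<longrightarrow> g (coords a) = 0"
      using *[OF AB(1) sub(1)] by blast
    obtain h where h: "h\<in>mpol_funs F UNIV" "h (coords q) \<noteq> 0" "\<forall>a\<in>B. (\<forall>j. coords a j \<in> F) \<longrightarrow> h (coords a) = 0"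
      using *[OF AB(2) sub(2)] by blast
    \<comment> \<open>The product is nonzero at \<open>q\<close>, hence at some
      \<open>F\<close>-rational point of the locus; but that point lies in \<open>A\<close> or in
      \<open>B\<close>, where one factor vanishes.\<close>
    have "(\<lambda>a. g a * h a) \<in> mpol_funs F UNIV" by (intro mpol_funs_mult subring_of_subfield F' g h)
    from locus_point[OF F q this] obtain a where a: "a \<in> locus F q" "\<forall>j. coords a j \<in> F"
      "g (coords a) * h (coords a) \<noteq> 0" using g h by auto
    from a(1) AB(3) have "a \<in> A \<or> a \<in> B" by simp
    then show False using a(2,3) g(3) h(3) by auto
  qed
  moreover have "locus F q \<noteq> {}" using locus_self[OF q, of F] by auto
  ultimately show ?thesis using zariski_closed_locus[of F q] unfolding irreducible_closed_def
    by (intro conjI allI impI)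
qed

text \<open>At some \<open>F\<close>-rational point of the locus the denominator \<open>H\<close> is
  nonzero, so \<open>G / H\<close> takes a value in \<open>F\<close> there. On the locus over
  \<open>F'\<close> the equation \<open>G = b * H\<close> holds, and \<open>b\<close> is not in
  \<open>F\<close>.\<close>

lemma locus_strict:
  assumes F: "alg_closed_set F" and q: "q \<in> GaGm" and FF': "F \<subseteq> F'" "subfield_of F'"
    and b: "b \<in> Q_adjoin (range (coords q))" "b \<in> F'" "b \<notin> F"
  shows "locus F' q \<subset> locus F q"
proof -
  have F': "subfield_of F" using F by (simp add: alg_closed_set_def)
  obtain G H where GH: "G\<in>mpol_funs F UNIV" "H\<in>mpol_funs F UNIV" "H (coords q) \<noteq> 0"
    "b = G (coords q) / H (coords q)"
    using Q_adjoin_fractions[OF F' b(1)] by blast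
  obtain a where a: "a \<in> locus F q" "\<forall>j. coords a j \<in> F" "H (coords a) \<noteq> 0"
    using locus_point[OF F q GH(2,3)] by blast
  have "a \<notin> locus F' q"
  proof
    assume a': "a \<in> locus F' q"
    have sub: "mpol_funs F UNIV \<subseteq> mpol_funs F' UNIV" using FF' by (auto simp: mpol_funs_def mpol_coeffs_in_def)
    have "(\<lambda>a. G a + (- b) * H a) \<in> mpol_funs F' UNIV"
      using GH b subfield_ofD[OF FF'(2)] sub
      by (intro mpol_funs_add mpol_funs_mult mpol_funs_const subring_of_subfield[OF FF'(2)]) auto
    then obtain P where P: "(\<lambda>a. G a + (- b) * H a) = (\<lambda>a. mpol_eval a P)" "mpol_coeffs_in F' P"
      by (auto simp: mpol_funs_def)
    have "mpol_eval (coords q) P = 0" using fun_cong[OF P(1), of "coords q"] GH by simp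
    then have "mpol_eval (coords a) P = 0" using a' P(2) by (auto simp: locus_def)
    then have "b = G (coords a) / H (coords a)" using fun_cong[OF P(1), of "coords a"] a(3)
      by (simp add: field_simps)
    moreover have "G (coords a) \<in> F" "H (coords a) \<in> F"
      using a(2) by (auto intro: mpol_funs_closed[OF subring_of_subfield[OF F'] GH(1)]
        mpol_funs_closed[OF subring_of_subfield[OF F'] GH(2)])
    ultimately show False using b(3) subfield_ofD[OF F'] by auto
  qed
  then show ?thesis using a locus_mono[OF FF'(1)] by blast
qed

lemma alg_closed_algebraic_over:
  assumes ac: "alg_closed_set (UNIV :: 'a::field set)" and F: "subfield_of (F :: 'a set)"
  shows "alg_closed_set (algebraic_over F)"
  unfolding alg_closed_set_def
proof (intro conjI ballI impI)
  fix f assume f: "f \<in> polys_over (algebraic_over F)" "degree f \<ge> 1"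
  then obtain x where "poly f x = 0" using ac by (auto simp: alg_closed_set_def polys_over_def)
  moreover have "x \<in> algebraic_over F"
    using algebraic_over_root[OF F, of f x] f \<open>poly f x = 0\<close> by (fastforce simp: polys_over_def)
  ultimately show "\<exists>x\<in>algebraic_over F. poly f x = 0" by blast
qed (rule subfield_of_algebraic_over[OF F])

theorem variety_dim_ge:
  fixes V :: "(('a::field_char_0 ^ 'n) \<times> ('a ^ 'n)) set"
  assumes ac: "alg_closed_set (UNIV :: 'a set)"
    and V: "closed_defined_over {x. algebraic x} V" and q: "q \<in> V"
    and b: "\<forall>i<k. b i \<in> Q_adjoin (range (coords q))" "algebraically_independent \<rat> k b"
  shows "enat k \<le> variety_dim V"
proof -
  define F where "F i = algebraic_over (Q_adjoin (b ` {..<i}))" for i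
  have qG: "q \<in> GaGm" using V q by (auto simp: closed_defined_over_def)
  have F: "alg_closed_set (F i)" for i
    unfolding F_def by (rule alg_closed_algebraic_over[OF ac subfield_of_Q_adjoin])
  have F_mono: "F i \<subseteq> F j" if "i \<le> j" for i j
    unfolding F_def by (intro algebraic_over_mono Q_adjoin_mono) (use that in auto)
  have "{x. algebraic x} \<subseteq> F 0"
  proof safe
    fix x :: 'a assume "algebraic x"
    then obtain p where p: "\<And>i. coeff p i \<in> \<int>" "p \<noteq> 0" "poly p x = 0" by (auto simp: algebraic_def)
    moreover have "\<int> \<subseteq> Q_adjoin (b ` {..<0})"
      using subfield_of_Rats[OF subfield_of_Q_adjoin] Ints_subset_Rats by blast
    ultimately show "x \<in> F 0" unfolding F_def algebraic_over_def by blast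
  qed
  then have V': "closed_defined_over (F 0) V"
    using V unfolding closed_defined_over_def mpol_coeffs_in_def by blast
  \<comment> \<open>Enlarging the field shrinks the locus, so the tower is traversed backwards to
    get an increasing chain. At the top stands \<open>F 0\<close>, which contains the algebraic
    numbers, so that the locus lies in \<open>V\<close>.\<close>
  define Z where "Z i = locus (F (k - i)) q" for i
  have "irreducible_closed (Z i)" for i unfolding Z_def by (rule irreducible_locus[OF F qG])
  moreover have "Z i \<subseteq> V" for i
    unfolding Z_def using locus_mono[OF F_mono[of 0]] locus_subset[OF V' q] by blast
  moreover have "Z i \<subset> Z (Suc i)" if "i < k" for i
  proof -
    define j where "j = k - Suc i"
    have j: "k - i = Suc j" "j < k" using that by (auto simp: j_def)
    have "b j \<in> F (Suc j)" unfolding F_def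
      using algebraic_over_superset[OF subfield_of_Q_adjoin] Q_adjoin_superset
        by (metis imageI lessThan_Suc_atMost atMost_iff order_refl subsetD)
    moreover have "b j \<notin> F j" unfolding F_def by (rule algebraically_independent_not_algebraic[OF b(2) j(2)])
    moreover have "subfield_of (F (Suc j))" using F by (simp add: alg_closed_set_def)
    ultimately show ?thesis unfolding Z_def j j_def[symmetric]
      using b j by (intro locus_strict[OF F qG F_mono, of j "Suc j" "b j"]) auto
  qed
  ultimately have "\<exists>Z. (\<forall>i\<le>k. irreducible_closed (Z i) \<and> Z i \<subseteq> V) \<and> (\<forall>i<k. Z i \<subset> Z (Suc i))" by blast
  then show ?thesis unfolding variety_dim_def by (intro Sup_upper) blast
qed

section \<open>Complete non-archimedean fields\<close>

locale nonarch_field =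
  fixes N :: "'a::field_char_0 \<Rightarrow> real" and p :: nat
  assumes N_nonneg: "0 \<le> N x"
    and N_eq_0_iff: "N x = 0 \<longleftrightarrow> x = 0"
    and N_mult: "N (x * y) = N x * N y"
    and N_add: "N (x + y) \<le> max (N x) (N y)"
    and N_complete: "(\<And>e. 0 < e \<Longrightarrow> \<exists>M. \<forall>i\<ge>M. \<forall>j\<ge>M. N (s i - s j) < e) \<Longrightarrow>
      \<exists>l. (\<lambda>i. N (s i - l)) \<longlonglongrightarrow> 0"
    and p_pos: "p > 0" and N_p: "N (of_nat p) < 1"
begin

lemma N_0 [simp]: "N 0 = 0" by (simp add: N_eq_0_iff)

lemma N_1 [simp]: "N 1 = 1"
  using N_mult[of 1 1] N_eq_0_iff[of 1] by simp

lemma N_pos_iff: "0 < N x \<longleftrightarrow> x \<noteq> 0"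
  using N_nonneg[of x] N_eq_0_iff[of x] by linarith

lemma N_minus [simp]: "N (- x) = N x"
proof -
  have "N (-1) * N (-1) = 1" using N_mult[of "-1" "-1"] by simp
  then have "N (-1) = 1" using N_nonneg[of "-1"] by (metis abs_of_nonneg real_sqrt_mult_self real_sqrt_one
    power2_eq_square abs_1 abs_square_eq_1)
  then show ?thesis using N_mult[of "-1" x] by simp
qed

lemma N_diff: "N (x - y) \<le> max (N x) (N y)"
  using N_add[of x "- y"] by simp

lemma N_commute: "N (x - y) = N (y - x)"
  using N_minus[of "x - y"] by simp

lemma N_power: "N (x ^ k) = N x ^ k"
  by (induction k) (auto simp: N_mult)

lemma N_inverse: "N (inverse x) = inverse (N x)"
proof (cases "x = 0")
  case False
  then have "N x * N (inverse x) = 1" by (simp add: N_mult[symmetric])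
  then show ?thesis by (metis inverse_unique)
qed simp

lemma N_divide: "N (x / y) = N x / N y"
  by (simp add: divide_inverse N_mult N_inverse)

lemma N_sum: "(\<And>i. i \<in> I \<Longrightarrow> N (f i) \<le> B) \<Longrightarrow> 0 \<le> B \<Longrightarrow> N (sum f I) \<le> B"
proof (induction I rule: infinite_finite_induct)
  case (insert i I)
  then show ?case using N_add[of "f i" "sum f I"] by fastforce
qed auto

lemma N_add_eq: "N x < N y \<Longrightarrow> N (x + y) = N y"
  using N_add[of x y] N_diff[of "x + y" x] by (auto simp: max_def split: if_splits)

lemma N_trans: "N (x - y) \<le> B \<Longrightarrow> N (y - z) \<le> B \<Longrightarrow> N (x - z) \<le> B"
  using N_add[of "x - y" "y - z"] by simp

section \<open>Limits and infinite series in an ultrametric field\<close>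

definition nlim :: "(nat \<Rightarrow> 'a) \<Rightarrow> 'a \<Rightarrow> bool" where
  "nlim s l \<longleftrightarrow> (\<lambda>k. N (s k - l)) \<longlonglongrightarrow> 0"

lemma nlimI: "b \<longlonglongrightarrow> 0 \<Longrightarrow> (\<And>k. N (s k - l) \<le> b k) \<Longrightarrow> nlim s l"
  unfolding nlim_def by (rule Lim_null_comparison[where g = b]) (auto simp: N_nonneg)

lemma nlim_const: "nlim (\<lambda>k. x) x" by (simp add: nlim_def)

lemma tendsto_max_zero: "f \<longlonglongrightarrow> (0::real) \<Longrightarrow> g \<longlonglongrightarrow> 0 \<Longrightarrow> (\<lambda>k. max (f k) (g k)) \<longlonglongrightarrow> 0"
  using tendsto_max[of f 0 sequentially g 0] by simp

lemma nlim_add: "nlim s l \<Longrightarrow> nlim s' l' \<Longrightarrow> nlim (\<lambda>k. s k + s' k) (l + l')"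
  by (rule nlimI[of "\<lambda>k. max (N (s k - l)) (N (s' k - l'))"])
    (auto simp: nlim_def intro!: tendsto_max_zero, metis N_add add_diff_add)

lemma nlim_cmult: "nlim s l \<Longrightarrow> nlim (\<lambda>k. c * s k) (c * l)"
proof -
  assume "nlim s l"
  then have "(\<lambda>k. N c * N (s k - l)) \<longlonglongrightarrow> 0" unfolding nlim_def by (rule tendsto_mult_right_zero)
  then show ?thesis by (rule nlimI) (simp add: N_mult[symmetric] right_diff_distrib)
qed

lemma nlim_diff: "nlim s l \<Longrightarrow> nlim s' l' \<Longrightarrow> nlim (\<lambda>k. s k - s' k) (l - l')"
  using nlim_add[of s l "\<lambda>k. (-1) * s' k" "(-1) * l'"] nlim_cmult[of s' l' "-1"] by simp

lemma nlim_bound: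
  assumes "nlim s l" "\<And>k. k \<ge> m \<Longrightarrow> N (s k - x) \<le> B"
  shows "N (l - x) \<le> B"
proof (rule field_le_epsilon)
  fix e :: real assume "e > 0"
  then have "\<forall>\<^sub>F k in sequentially. N (s k - l) < e"
    using assms(1) unfolding nlim_def by (rule order_tendstoD(2)[rotated])
  then obtain M where M: "\<And>k. k \<ge> M \<Longrightarrow> N (s k - l) < e" by (auto simp: eventually_sequentially)
  define k where "k = max m M"
  have "N (l - x) \<le> max (N (s k - l)) (N (s k - x))"
    using N_diff[of "s k - x" "s k - l"] by (simp add: max.commute)
  also have "\<dots> \<le> e + B" using M[of k] assms(2)[of k] N_nonneg[of "s k - x"] \<open>e > 0\<close> by (auto simp: k_def)
  finally show "N (l - x) \<le> B + e" by simp
qed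

lemma nlim_unique: "nlim s l \<Longrightarrow> nlim s l' \<Longrightarrow> l = l'"
proof -
  assume a: "nlim s l" "nlim s l'"
  from nlim_diff[OF this] have "nlim (\<lambda>k. 0) (l - l')" by simp
  from nlim_bound[OF this, of 0 0 0] have "N (l - l') = 0" using N_nonneg[of "l - l'"] by simp
  then show ?thesis by (simp add: N_eq_0_iff)
qed

definition nsums :: "(nat \<Rightarrow> 'a) \<Rightarrow> 'a \<Rightarrow> bool" where
  "nsums a l \<longleftrightarrow> nlim (\<lambda>m. \<Sum>k<m. a k) l"

lemma nsums_add: "nsums a l \<Longrightarrow> nsums b l' \<Longrightarrow> nsums (\<lambda>k. a k + b k) (l + l')"
  unfolding nsums_def by (drule (1) nlim_add) (simp add: sum.distrib)

lemma nsums_cmult: "nsums a l \<Longrightarrow> nsums (\<lambda>k. c * a k) (c * l)"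
  unfolding nsums_def by (drule nlim_cmult[of _ _ c]) (simp add: sum_distrib_left)

lemma nsums_multc: "nsums a l \<Longrightarrow> nsums (\<lambda>k. a k * c) (l * c)"
  using nsums_cmult[of a l c] by (simp add: mult.commute)

lemma nsums_diff: "nsums a l \<Longrightarrow> nsums b l' \<Longrightarrow> nsums (\<lambda>k. a k - b k) (l - l')"
  unfolding nsums_def by (drule (1) nlim_diff) (simp add: sum_subtractf)

lemma nsums_unique: "nsums a l \<Longrightarrow> nsums a l' \<Longrightarrow> l = l'"
  unfolding nsums_def by (rule nlim_unique)

lemma nsums_finite: "(\<And>k. k \<ge> m \<Longrightarrow> a k = 0) \<Longrightarrow> nsums a (\<Sum>k<m. a k)"
proof -
  assume z: "\<And>k. k \<ge> m \<Longrightarrow> a k = 0"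
  have "N ((\<Sum>k<M. a k) - (\<Sum>k<m. a k)) \<le> (if M < m then N ((\<Sum>k<M. a k) - (\<Sum>k<m. a k)) else 0)" for M
  proof (cases "M < m")
    case False
    then have "(\<Sum>k<m. a k) = (\<Sum>k<M. a k)" by (intro sum.mono_neutral_left) (auto simp: z)
    then show ?thesis by simp
  qed simp
  moreover have "(\<lambda>M. if M < m then N ((\<Sum>k<M. a k) - (\<Sum>k<m. a k)) else 0) \<longlonglongrightarrow> 0"
    by (rule tendsto_eventually) (auto simp: eventually_sequentially intro!: exI[of _ m])
  ultimately show ?thesis unfolding nsums_def by (intro nlimI)
qed

lemma nsums_0: "nsums (\<lambda>k. 0) 0" using nsums_finite[of 0 "\<lambda>k. 0"] by simp

lemma nsums_tail_bound:
  assumes "nsums a l" "\<And>k. k \<ge> m \<Longrightarrow> N (a k) \<le> B" "0 \<le> B"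
  shows "N ((\<Sum>k<m. a k) - l) \<le> B"
  unfolding N_commute[of _ l]
proof (rule nlim_bound[OF assms(1)[unfolded nsums_def], of m])
  fix M assume "m \<le> M"
  then have "(\<Sum>k<M. a k) - (\<Sum>k<m. a k) = (\<Sum>k\<in>{m..<M}. a k)"
    by (metis atLeast0LessThan sum_diff_nat_ivl zero_le)
  then show "N ((\<Sum>k<M. a k) - (\<Sum>k<m. a k)) \<le> B" using assms by (auto intro!: N_sum)
qed

lemma nsums_bound:
  assumes "nsums a l" "\<And>k. N (a k) \<le> B"
  shows "N l \<le> B"
  using nsums_tail_bound[OF assms(1), of 0 B] assms(2) order.trans[OF N_nonneg[of "a 0"] assms(2)] by simp

lemma nsums_shift: "nsums a l \<longleftrightarrow> nsums (\<lambda>k. a (k + m)) (l - (\<Sum>k<m. a k))"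
proof -
  have e: "(\<Sum>k<n. a (k + m)) - (l - (\<Sum>k<m. a k)) = (\<Sum>k<n + m. a k) - l" for n
  proof -
    have "(\<Sum>k<n. a (k + m)) + (\<Sum>k<m. a k) = (\<Sum>k<n + m. a k)"
      by (induction n) (simp_all add: add_ac)
    then show ?thesis by (simp add: algebra_simps)
  qed
  show ?thesis unfolding nsums_def nlim_def e
    by (rule iffI) (rule LIMSEQ_ignore_initial_segment, assumption, rule LIMSEQ_offset, assumption)
qed

lemma nsums_pad: "nsums a l \<Longrightarrow> nsums (\<lambda>k. if k < m then 0 else a (k - m)) l"
  by (subst nsums_shift[of _ _ m]) simp

lemma nsums_exists:
  assumes "(\<lambda>k. N (a k)) \<longlonglongrightarrow> 0"
  shows "\<exists>l. nsums a l"
  unfolding nsums_def nlim_def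
proof (rule N_complete)
  fix e :: real assume e: "0 < e"
  then obtain M where M: "\<And>k. k \<ge> M \<Longrightarrow> N (a k) < e"
    using order_tendstoD(2)[OF assms e] by (auto simp: eventually_sequentially)
  have M2: "N ((\<Sum>k<i. a k) - (\<Sum>k<j. a k)) < e" if "M \<le> j" "j \<le> i" for i j
  proof -
    have "(\<Sum>k<i. a k) - (\<Sum>k<j. a k) = (\<Sum>k\<in>{j..<i}. a k)"
      using that by (metis atLeast0LessThan sum_diff_nat_ivl zero_le)
    also have "N \<dots> < e"
    proof (cases "{j..<i} = {}")
      case False
      have "N (\<Sum>k\<in>{j..<i}. a k) \<le> Max ((\<lambda>k. N (a k)) ` {j..<i})"
        using False by (intro N_sum) (auto simp: Max_ge_iff N_nonneg intro!: Max_ge)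
      also have "\<dots> < e" using False M that by (subst Max_less_iff) auto
      finally show ?thesis .
    qed (simp only: sum.empty N_0 e)
    finally show ?thesis .
  qed
  show "\<exists>M. \<forall>i\<ge>M. \<forall>j\<ge>M. N ((\<Sum>k<i. a k) - (\<Sum>k<j. a k)) < e"
    by (rule exI[of _ M]) (metis M2 N_commute nle_le)
qed

text \<open>Both iterated sums are compared with the partial sum over the square
  \<open>j, k < m\<close>: every term outside it has norm at most \<open>b m\<close>, and so have
  the errors, by the ultrametric inequality.\<close>

lemma nsums_swap:
  assumes b: "b \<longlonglongrightarrow> 0" "\<And>m m'. m \<le> m' \<Longrightarrow> b m' \<le> b m"
    and a: "\<And>j k. N (a j k) \<le> b (max j k)"
    and s: "\<And>j. nsums (a j) (s j)" and c: "\<And>k. nsums (\<lambda>j. a j k) (c k)" and l: "nsums s l"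
  shows "nsums c l"
proof -
  have b0: "0 \<le> b m" for m using a[of m m] N_nonneg[of "a m m"] by auto
  have 1: "N ((\<Sum>j<m. \<Sum>k<m. a j k) - (\<Sum>j<m. s j)) \<le> b m" for m
    unfolding sum_subtractf[symmetric]
    by (intro N_sum nsums_tail_bound s b0) (use a b(2) order.trans in \<open>meson max.cobounded2\<close>)
  have 2: "N ((\<Sum>k<m. \<Sum>j<m. a j k) - (\<Sum>k<m. c k)) \<le> b m" for m
    unfolding sum_subtractf[symmetric]
    by (intro N_sum nsums_tail_bound c b0) (use a b(2) order.trans in \<open>meson max.cobounded1\<close>)
  have "N ((\<Sum>k<m. c k) - l) \<le> max (b m) (N ((\<Sum>j<m. s j) - l))" for m
  proof (rule N_trans)
    have "N ((\<Sum>k<m. c k) - (\<Sum>j<m. s j)) \<le> b m"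
      by (rule N_trans[of _ "\<Sum>j<m. \<Sum>k<m. a j k"]) (use 1 2[of m] in \<open>auto simp: N_commute sum.swap[of
        "\<lambda>j k. a j k"]\<close>)
    then show "N ((\<Sum>k<m. c k) - (\<Sum>j<m. s j)) \<le> max (b m) (N ((\<Sum>j<m. s j) - l))" by simp
  qed simp
  moreover have "(\<lambda>m. max (b m) (N ((\<Sum>j<m. s j) - l))) \<longlonglongrightarrow> 0"
    using b l unfolding nsums_def nlim_def by (intro tendsto_max_zero)
  ultimately show ?thesis unfolding nsums_def by (intro nlimI)
qed

lemma small_element: "e > 0 \<Longrightarrow> \<exists>k. N (of_nat p ^ k) < e"
  using real_arch_pow_inv[OF _ N_p] by (simp add: N_power)

text \<open>At a nonzero \<open>x\<close> of norm smaller than that of the first nonzero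
  coefficient, the corresponding term dominates the rest. Powers of \<open>p\<close> provide such an
  \<open>x\<close>.\<close>

lemma power_series_unique:
  assumes a: "\<And>k. N (a k) \<le> 1" and z: "\<And>x. N x < 1 \<Longrightarrow> nsums (\<lambda>k. a k * x ^ k) 0"
  shows "a k = 0"
proof (rule ccontr)
  assume "a k \<noteq> 0"
  define d where "d = (LEAST k. a k \<noteq> 0)"
  have d: "a d \<noteq> 0" "\<And>k. k < d \<Longrightarrow> a k = 0"
    using LeastI[of "\<lambda>k. a k \<noteq> 0", OF \<open>a k \<noteq> 0\<close>] not_less_Least by (auto simp: d_def)
  obtain x where x: "x \<noteq> 0" "N x < min 1 (N (a d))"
  proof -
    obtain k where "N (of_nat p ^ k) < min 1 (N (a d))"
      using small_element[of "min 1 (N (a d))"] d by (auto simp: N_pos_iff)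
    then show ?thesis using that[of "of_nat p ^ k"] p_pos by simp
  qed
  have "N ((\<Sum>k<Suc d. a k * x ^ k) - 0) \<le> N x ^ Suc d"
  proof (rule nsums_tail_bound[OF z])
    fix k assume "Suc d \<le> k"
    then have "N x ^ k \<le> N x ^ Suc d" using x by (intro power_decreasing) (auto simp: N_nonneg)
    then show "N (a k * x ^ k) \<le> N x ^ Suc d"
      using mult_mono[OF a[of k], of "N x ^ k" "N x ^ Suc d"] by (simp add: N_mult N_power N_nonneg)
  qed (use x in \<open>simp_all add: N_nonneg\<close>)
  also have "(\<Sum>k<Suc d. a k * x ^ k) = a d * x ^ d" using d by simp
  finally have "N (a d) * N x ^ d \<le> N x * N x ^ d" by (simp add: N_mult N_power)
  then have "N (a d) \<le> N x" using x by (simp add: N_pos_iff)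
  then show False using x by simp
qed

text \<open>Points are infinite sequences so that the number of variables can change in an induction
  without a change of type; a series in \<open>n\<close> variables looks only at the first
  \<open>n\<close> entries.\<close>

definition Delta :: "(nat \<Rightarrow> 'a) set" where "Delta = {t. \<forall>i. N (t i) < 1}"

lemma zero_in_Delta: "(\<lambda>i. 0) \<in> Delta" by (simp add: Delta_def)

text \<open>\<open>Filt K \<theta> n 0\<close> consists of the power series in \<open>n\<close> variables with integral coefficients in \<open>K\<close>, as
  functions on the open unit polydisc; \<open>Filt K \<theta> n j\<close> is the \<open>j\<close>-th power of its maximal ideal
  when \<open>\<theta>\<close> is the absolute value of a uniformiser of \<open>K\<close>.\<close>

primrec Filt :: "'a set \<Rightarrow> real \<Rightarrow> nat \<Rightarrow> nat \<Rightarrow> ((nat \<Rightarrow> 'a) \<Rightarrow> 'a) set" where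
  "Filt K \<theta> 0 j = {f. \<exists>x\<in>K. N x \<le> \<theta> ^ j \<and> (\<forall>t\<in>Delta. f t = x)}"
| "Filt K \<theta> (Suc n) j = {f. \<exists>c. (\<forall>k. c k \<in> Filt K \<theta> n (j - k)) \<and>
     (\<forall>t\<in>Delta. nsums (\<lambda>k. c k t * t n ^ k) (f t))}"

text \<open>\<open>\<theta>\<close> need not be the norm of an element; it only bounds all norms
  below 1 in \<open>K\<close>. Closedness under limits stands for completeness, since the ambient
  field is complete.\<close>

definition discrete_subfield :: "'a set \<Rightarrow> real \<Rightarrow> bool" where
  "discrete_subfield K \<theta> \<longleftrightarrow> subfield_of K \<and> 0 < \<theta> \<and> \<theta> < 1 \<and> (\<forall>x\<in>K. N x < 1 \<longrightarrow> N x \<le> \<theta>) \<and>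
     (\<forall>s l. (\<forall>k. s k \<in> K) \<longrightarrow> nlim s l \<longrightarrow> l \<in> K)"

text \<open>At level 0 the truncated differences stay 0 and \<open>\<theta> ^ 0 = 1\<close>. Rings
  over different fields can thus be compared although each field has its own
  \<open>\<theta>\<close>.\<close>

lemma Filt_0_cong_theta: "Filt K \<theta> n 0 = Filt K \<theta>' n 0"
  by (induction n) simp_all

lemma Filt_0_mono: "K \<subseteq> K' \<Longrightarrow> Filt K \<theta> n 0 \<subseteq> Filt K' \<theta> n 0"
  by (induction n) (simp, blast, simp, blast)

end

section \<open>Rings of integral power series\<close>

locale power_series_ring = nonarch_field N p for N :: "'a::field_char_0 \<Rightarrow> real" and p +
  fixes K :: "'a set" and \<theta> :: real
  assumes disc: "discrete_subfield K \<theta>"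
begin

abbreviation I where "I n j \<equiv> Filt K \<theta> n j"

lemma K: "subfield_of K" and theta: "0 < \<theta>" "\<theta> < 1" and K_disc: "x \<in> K \<Longrightarrow> N x < 1 \<Longrightarrow> N x \<le> \<theta>"
  and K_closed: "(\<And>k. s k \<in> K) \<Longrightarrow> nlim s l \<Longrightarrow> l \<in> K"
  using disc by (auto simp: discrete_subfield_def)

lemmas K' = subfield_ofD[OF K]

lemma theta_power_mono: "i \<le> j \<Longrightarrow> \<theta> ^ j \<le> \<theta> ^ i"
  using theta by (intro power_decreasing) auto

section \<open>Elementary operations on the filtered ring\<close>

lemma I_cong: "f \<in> I n j \<Longrightarrow> (\<And>t. t \<in> Delta \<Longrightarrow> g t = f t) \<Longrightarrow> g \<in> I n j"
  by (cases n) auto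

lemma I_SucE:
  assumes "f \<in> I (Suc n) j"
  obtains c where "\<And>k. c k \<in> I n (j - k)" "\<And>t. t \<in> Delta \<Longrightarrow> nsums (\<lambda>k. c k t * t n ^ k) (f t)"
  using assms by auto

lemma I_SucI:
  "(\<And>k. c k \<in> I n (j - k)) \<Longrightarrow> (\<And>t. t \<in> Delta \<Longrightarrow> nsums (\<lambda>k. c k t * t n ^ k) (f t)) \<Longrightarrow> f \<in> I (Suc n) j"
  by auto

lemma I_antimono: "f \<in> I n j \<Longrightarrow> i \<le> j \<Longrightarrow> f \<in> I n i"
proof (induction n arbitrary: f i j)
  case 0
  then show ?case using theta_power_mono[of i j] by force
next
  case (Suc n)
  then show ?case by simp (metis diff_le_mono)
qed

lemma I_const: "x \<in> K \<Longrightarrow> N x \<le> \<theta> ^ j \<Longrightarrow> (\<lambda>t. x) \<in> I n j"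
proof (induction n arbitrary: j x)
  case (Suc n)
  define c where "c k = (\<lambda>t::nat\<Rightarrow>'a. if k = 0 then x else 0)" for k :: nat
  have "c k \<in> I n (j - k)" for k
    using Suc.IH[of x j] Suc.IH[of 0 "j - k"] Suc.prems K' theta by (cases "k = 0") (auto simp: c_def)
  moreover have "nsums (\<lambda>k. c k t * t n ^ k) x" for t :: "nat \<Rightarrow> 'a"
    using nsums_finite[of 1 "\<lambda>k. c k t * t n ^ k"] by (simp add: c_def)
  ultimately show ?case by auto
qed auto

lemma I_0: "(\<lambda>t. 0) \<in> I n j"
  using I_const[of 0 j n] K' theta by simp

lemma I_1: "(\<lambda>t. 1) \<in> I n 0"
  using I_const[of 1 0 n] K' by simp

lemma I_Suc: "f \<in> I n j \<Longrightarrow> f \<in> I (Suc n) j"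
proof -
  assume f: "f \<in> I n j"
  define c where "c k = (if k = 0 then f else (\<lambda>t. 0))" for k :: nat
  have "c k \<in> I n (j - k)" for k using f I_0 by (cases "k = 0") (auto simp: c_def)
  moreover have "nsums (\<lambda>k. c k t * t n ^ k) (f t)" for t :: "nat \<Rightarrow> 'a"
    using nsums_finite[of 1 "\<lambda>k. c k t * t n ^ k"] by (simp add: c_def)
  ultimately show ?thesis by auto
qed

lemma I_var: "i < n \<Longrightarrow> (\<lambda>t. t i) \<in> I n 1"
proof (induction n)
  case (Suc n)
  show ?case
  proof (cases "i = n")
    case True
    define c where "c k = (\<lambda>t::nat\<Rightarrow>'a. if k = 1 then 1 else (0::'a))" for k :: nat
    have "c k \<in> I n (1 - k)" for k using I_0 I_1 by (cases "k = 1") (auto simp: c_def)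
    moreover have "nsums (\<lambda>k. c k t * t n ^ k) (t n)" for t :: "nat \<Rightarrow> 'a"
      using nsums_finite[of 2 "\<lambda>k. c k t * t n ^ k"] by (simp add: c_def numeral_2_eq_2)
    ultimately show ?thesis using True by auto
  next
    case False then show ?thesis using Suc I_Suc by simp
  qed
qed simp

lemma I_add: "f \<in> I n j \<Longrightarrow> g \<in> I n j \<Longrightarrow> (\<lambda>t. f t + g t) \<in> I n j"
proof (induction n arbitrary: f g j)
  case 0
  then obtain x y where "x \<in> K" "N x \<le> \<theta> ^ j" "\<forall>t\<in>Delta. f t = x" "y \<in> K" "N y \<le> \<theta> ^ j" "\<forall>t\<in>Delta. g t = y" by auto
  then show ?case using N_add[of x y] K' by (auto intro!: bexI[of _ "x + y"])
next
  case (Suc n)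
  then obtain c d where "\<forall>k. c k \<in> I n (j - k)" "\<forall>t\<in>Delta. nsums (\<lambda>k. c k t * t n ^ k) (f t)"
    "\<forall>k. d k \<in> I n (j - k)" "\<forall>t\<in>Delta. nsums (\<lambda>k. d k t * t n ^ k) (g t)" by auto
  then show ?case using Suc.IH
    by (auto intro!: exI[of _ "\<lambda>k t. c k t + d k t"] nsums_add simp: distrib_right)
qed

lemma I_sum: "(\<And>i. i \<in> X \<Longrightarrow> f i \<in> I n j) \<Longrightarrow> (\<lambda>t. \<Sum>i\<in>X. f i t) \<in> I n j"
proof (induction X rule: infinite_finite_induct)
  case (insert x X)
  then show ?case using I_add[of "f x" n j "\<lambda>t. \<Sum>i\<in>X. f i t"] by simp
qed (auto simp: I_0)

lemma I_scale: "x \<in> K \<Longrightarrow> N x \<le> \<theta> ^ i \<Longrightarrow> f \<in> I n j \<Longrightarrow> (\<lambda>t. x * f t) \<in> I n (i + j)"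
proof (induction n arbitrary: f i j)
  case 0
  then obtain y where "y \<in> K" "N y \<le> \<theta> ^ j" "\<forall>t\<in>Delta. f t = y" by auto
  then show ?case using 0 K' theta
    by (auto intro!: bexI[of _ "x * y"] mult_mono simp: N_mult power_add N_nonneg)
next
  case (Suc n)
  then obtain c where c: "\<forall>k. c k \<in> I n (j - k)" "\<forall>t\<in>Delta. nsums (\<lambda>k. c k t * t n ^ k) (f t)" by auto
  have "(\<lambda>t. x * c k t) \<in> I n (i + j - k)" for k
    by (rule I_antimono[OF Suc.IH[OF Suc.prems(1,2), of "c k" "j - k"]]) (use c in auto)
  then show ?case using c
    by (auto intro!: exI[of _ "\<lambda>k t. x * c k t"] nsums_cmult simp: mult.assoc)
qed

lemma I_minus: "f \<in> I n j \<Longrightarrow> (\<lambda>t. - f t) \<in> I n j"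
  using I_scale[of "-1" 0 f n j] K' by simp

lemma I_diff: "f \<in> I n j \<Longrightarrow> g \<in> I n j \<Longrightarrow> (\<lambda>t. f t - g t) \<in> I n j"
  using I_add[of f n j "\<lambda>t. - g t"] I_minus by simp

text \<open>In the filtration, a constant of norm below 1 and each variable have weight one, so a
  series of level \<open>j\<close> has norm at most \<open>rho n t ^ j\<close> at \<open>t\<close>.
  Including \<open>\<theta>\<close> accounts for the coefficients.\<close>

definition rho :: "nat \<Rightarrow> (nat \<Rightarrow> 'a) \<Rightarrow> real" where
  "rho n t = Max (insert \<theta> ((\<lambda>i. N (t i)) ` {..<n}))"

lemma rho_bounds: "\<theta> \<le> rho n t" "i < n \<Longrightarrow> N (t i) \<le> rho n t" "t \<in> Delta \<Longrightarrow> rho n t < 1" "0 < rho n t"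
proof -
  show "\<theta> \<le> rho n t" "i < n \<Longrightarrow> N (t i) \<le> rho n t" unfolding rho_def by (auto intro!: Max_ge)
  then show "0 < rho n t" using theta by linarith
  show "rho n t < 1" if "t \<in> Delta" unfolding rho_def using theta that by (auto simp: Delta_def)
qed

lemma I_bound:
  assumes t: "t \<in> Delta" and r: "\<theta> \<le> r" "r < 1" "\<And>i. i < n \<Longrightarrow> N (t i) \<le> r" and f: "f \<in> I n j"
  shows "N (f t) \<le> r ^ j"
  using f r(3)
proof (induction n arbitrary: f j)
  case 0
  then obtain x where "N x \<le> \<theta> ^ j" "f t = x" using t by auto
  moreover have "\<theta> ^ j \<le> r ^ j" using r theta by (intro power_mono) auto
  ultimately show ?case by simp
next
  case (Suc n)
  then obtain c where c: "\<forall>k. c k \<in> I n (j - k)" "nsums (\<lambda>k. c k t * t n ^ k) (f t)" using t by auto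
  have "N (c k t * t n ^ k) \<le> r ^ j" for k
  proof -
    have "N (c k t) * N (t n) ^ k \<le> r ^ (j - k) * r ^ k"
      using Suc.IH[of "c k" "j - k"] c Suc.prems theta r by (intro mult_mono power_mono) (auto simp: N_nonneg)
    also have "\<dots> = r ^ (j - k + k)" by (simp add: power_add)
    also have "\<dots> \<le> r ^ j" using r theta by (intro power_decreasing) auto
    finally show ?thesis by (simp add: N_mult N_power)
  qed
  then show ?case using nsums_bound[OF c(2)] by simp
qed

lemma I_bound_rho: "t \<in> Delta \<Longrightarrow> f \<in> I n j \<Longrightarrow> N (f t) \<le> rho n t ^ j"
  by (rule I_bound) (auto simp: rho_bounds)

lemma I_bound_1: "t \<in> Delta \<Longrightarrow> f \<in> I n j \<Longrightarrow> N (f t) \<le> 1"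
  using I_antimono[of f n j 0] I_bound_rho[of t f n 0] by simp

lemma I_bound_less: "t \<in> Delta \<Longrightarrow> f \<in> I n 1 \<Longrightarrow> N (f t) < 1"
  using I_bound_rho[of t f n 1] rho_bounds(3)[of t n] by simp

lemma rho_power_0: "t \<in> Delta \<Longrightarrow> (\<lambda>k. rho n t ^ (k - s)) \<longlonglongrightarrow> 0"
proof -
  assume "t \<in> Delta"
  then have "(\<lambda>k. rho n t ^ k) \<longlonglongrightarrow> 0" using rho_bounds(3)[of t n] rho_bounds(4)[of n t]
    by (intro LIMSEQ_realpow_zero) auto
  then show ?thesis by (intro LIMSEQ_offset[of "\<lambda>k. rho n t ^ (k - s)" s]) simp
qed

section \<open>Summation, products, substitution and inverses\<close>

lemma I_sums_exists:
  assumes "\<And>j. h j \<in> I n (j - s)"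
  shows "\<exists>f. \<forall>t\<in>Delta. nsums (\<lambda>j. h j t) (f t)"
proof -
  have "\<exists>l. nsums (\<lambda>j. h j t) l" if "t \<in> Delta" for t
  proof (rule nsums_exists, rule Lim_null_comparison[OF _ rho_power_0[OF that, of n s]])
    show "\<forall>\<^sub>F k in sequentially. norm (N (h k t)) \<le> rho n t ^ (k - s)"
      using I_bound_rho[OF that assms] by (simp add: N_nonneg)
  qed
  then show ?thesis by metis
qed

text \<open>Completeness for the topology defined by the filtration. The shift \<open>s\<close> makes the induction work:
  the \<open>k\<close>-th coefficient of \<open>h j\<close> only lies in step \<open>j - s - k\<close>.\<close>

lemma I_complete:
  assumes "\<And>j. h j \<in> I n (max (j - s) m)" "\<And>t. t \<in> Delta \<Longrightarrow> nsums (\<lambda>j. h j t) (f t)"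
  shows "f \<in> I n m"
  using assms
proof (induction n arbitrary: h f s m)
  case 0
  have "\<exists>x. x \<in> K \<and> N x \<le> \<theta> ^ max (j - s) m \<and> (\<forall>t\<in>Delta. h j t = x)" for j
    using 0(1)[of j] by auto
  then obtain x where x: "\<And>j. x j \<in> K" "\<And>j. N (x j) \<le> \<theta> ^ max (j - s) m" "\<And>j t. t \<in> Delta \<Longrightarrow> h j t = x j"
    by metis
  define l where "l = f (\<lambda>i. 0)"
  have l: "nsums x l" using 0(2)[OF zero_in_Delta] x(3) zero_in_Delta by (simp add: l_def)
  have "l \<in> K" using l unfolding nsums_def by (rule K_closed[rotated]) (auto intro!: subfield_of_sum[OF K] x)
  moreover have "N l \<le> \<theta> ^ m"
    by (rule nsums_bound[OF l]) (rule order.trans[OF x(2) theta_power_mono], simp)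
  moreover have "f t = l" if "t \<in> Delta" for t
    using nsums_unique[of x "f t" l] 0(2)[OF that] x(3)[OF that] l by simp
  ultimately show ?case by auto
next
  case (Suc n)
  have "\<exists>c. (\<forall>k. c k \<in> I n (max (j - s) m - k)) \<and> (\<forall>t\<in>Delta. nsums (\<lambda>k. c k t * t n ^ k) (h j t))" for j
    using Suc.prems(1)[of j] by simp
  then obtain c where c: "\<And>j k. c j k \<in> I n (max (j - s) m - k)"
    "\<And>j t. t \<in> Delta \<Longrightarrow> nsums (\<lambda>k. c j k t * t n ^ k) (h j t)" by metis
  have c': "c j k \<in> I n (max (j - (s + k)) (m - k))" for j k
    by (rule I_antimono[OF c(1)]) auto
  have "\<exists>C. \<forall>t\<in>Delta. nsums (\<lambda>j. c j k t) (C t)" for k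
    by (rule I_sums_exists[of _ _ "s + k"]) (rule I_antimono[OF c'], simp)
  then obtain C where C: "\<And>k t. t \<in> Delta \<Longrightarrow> nsums (\<lambda>j. c j k t) (C k t)" by metis
  have "C k \<in> I n (m - k)" for k
    by (rule Suc.IH[of "\<lambda>j. c j k" "s + k", OF c' C])
  moreover have "nsums (\<lambda>k. C k t * t n ^ k) (f t)" if t: "t \<in> Delta" for t
  proof (rule nsums_swap[where b = "\<lambda>k. rho (Suc n) t ^ (k - s)" and a = "\<lambda>j k. c j k t * t n ^ k"])
    let ?r = "rho (Suc n) t"
    have r: "0 < ?r" "?r < 1" using rho_bounds t by auto
    show "(\<lambda>k. ?r ^ (k - s)) \<longlonglongrightarrow> 0" by (rule rho_power_0[OF t])
    show "?r ^ (m' - s) \<le> ?r ^ (m - s)" if "m \<le> m'" for m m' using r that by (intro power_decreasing) auto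
    show "nsums (\<lambda>k. c j k t * t n ^ k) (h j t)" for j by (rule c(2)[OF t])
    show "nsums (\<lambda>j. c j k t * t n ^ k) (C k t * t n ^ k)" for k by (rule nsums_multc[OF C[OF t]])
    show "nsums (\<lambda>j. h j t) (f t)" by (rule Suc.prems(2)[OF t])
    fix j k
    have "N (c j k t) \<le> ?r ^ (j - s - k)"
    proof (rule I_bound[OF t])
      show "c j k \<in> I n (j - s - k)" by (rule I_antimono[OF c(1)]) auto
      show "N (t i) \<le> ?r" if "i < n" for i using rho_bounds(2)[of i "Suc n" t] that by simp
    qed (use r rho_bounds in auto)
    then have "N (c j k t) * N (t n) ^ k \<le> ?r ^ (j - s - k) * ?r ^ k"
      using r rho_bounds(2)[of n "Suc n" t] by (intro mult_mono power_mono) (auto simp: N_nonneg)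
    also have "\<dots> = ?r ^ (j - s - k + k)" by (simp add: power_add)
    also have "\<dots> \<le> ?r ^ (max j k - s)" using r by (intro power_decreasing) auto
    finally show "N (c j k t * t n ^ k) \<le> ?r ^ (max j k - s)" by (simp add: N_mult N_power)
  qed
  ultimately show ?case by auto
qed

lemma I_times_var_power: "f \<in> I (Suc n) j \<Longrightarrow> (\<lambda>t. f t * t n ^ b) \<in> I (Suc n) (j + b)"
proof -
  assume "f \<in> I (Suc n) j"
  then obtain c where c: "\<And>k. c k \<in> I n (j - k)"
    "\<And>t. t \<in> Delta \<Longrightarrow> nsums (\<lambda>k. c k t * t n ^ k) (f t)" by (rule I_SucE) (rule that)
  define d where "d k = (if k < b then (\<lambda>t. 0) else c (k - b))" for k
  have "d k \<in> I n (j + b - k)" for k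
    using c(1)[of "k - b"] I_0 by (cases "k < b") (auto simp: d_def)
  moreover have "nsums (\<lambda>k. d k t * t n ^ k) (f t * t n ^ b)" if "t \<in> Delta" for t
  proof -
    have "(if k < b then 0 else c (k - b) t * t n ^ (k - b) * t n ^ b) = d k t * t n ^ k" for k
      by (auto simp: d_def mult.assoc power_add[symmetric])
    then show ?thesis
      using nsums_pad[OF nsums_multc[OF c(2)[OF that], of "t n ^ b"], of b] by simp
  qed
  ultimately show ?thesis by auto
qed

text \<open>Multiplying \<open>f\<close> by the expansion of \<open>g\<close> gives terms whose
  level grows with the power of the last variable, so completeness sums them; beforehand only
  products in fewer variables are needed.\<close>

lemma I_mult: "f \<in> I n i \<Longrightarrow> g \<in> I n j \<Longrightarrow> (\<lambda>t. f t * g t) \<in> I n (i + j)"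
proof (induction n arbitrary: f g i j)
  case 0
  then obtain x where x: "x \<in> K" "N x \<le> \<theta> ^ i" "\<forall>t\<in>Delta. f t = x" by auto
  have "(\<lambda>t. x * g t) \<in> I 0 (i + j)" by (rule I_scale[OF x(1,2) 0(2)])
  then show ?case by (rule I_cong) (use x in auto)
next
  case (Suc n)
  obtain c where c: "\<And>k. c k \<in> I n (i - k)" "\<And>t. t \<in> Delta \<Longrightarrow> nsums (\<lambda>k. c k t * t n ^ k) (f t)"
    by (rule I_SucE[OF Suc.prems(1)]) (rule that)
  obtain d where d: "\<And>k. d k \<in> I n (j - k)" "\<And>t. t \<in> Delta \<Longrightarrow> nsums (\<lambda>k. d k t * t n ^ k) (g t)"
    by (rule I_SucE[OF Suc.prems(2)]) (rule that)
  have 1: "(\<lambda>t. f t * e t) \<in> I (Suc n) (i + l)" if e: "e \<in> I n l" for e l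
  proof -
    have "(\<lambda>t. c k t * e t) \<in> I n (i + l - k)" for k
      by (rule I_antimono[OF Suc.IH[OF c(1) e]]) simp
    moreover have "nsums (\<lambda>k. c k t * e t * t n ^ k) (f t * e t)" if "t \<in> Delta" for t
      using nsums_multc[OF c(2)[OF that], of "e t"] by (simp add: algebra_simps)
    ultimately show ?thesis by (auto intro!: exI[of _ "\<lambda>k t. c k t * e t"])
  qed
  have "(\<lambda>t. f t * d k t * t n ^ k) \<in> I (Suc n) (max (k - 0) (i + j))" for k
    by (rule I_antimono[OF I_times_var_power[OF 1[OF d(1)]]]) auto
  then show ?case
    by (rule I_complete) (use nsums_cmult[OF d(2)] in \<open>simp add: mult.assoc\<close>)
qed

lemma I_power: "f \<in> I n j \<Longrightarrow> (\<lambda>t. f t ^ k) \<in> I n (j * k)"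
  by (induction k) (use I_1 I_mult in auto)

text \<open>The substituted series have level one, so their \<open>k\<close>-th powers have level
  \<open>k\<close> and the substituted expansion converges by completeness.\<close>

lemma I_compose:
  assumes u: "\<And>i. i < m \<Longrightarrow> (\<lambda>t. u t i) \<in> I n 1" and D: "\<And>t. t \<in> Delta \<Longrightarrow> u t \<in> Delta"
  shows "f \<in> I m j \<Longrightarrow> (\<lambda>t. f (u t)) \<in> I n j"
  using u
proof (induction m arbitrary: f j)
  case 0
  then obtain x where x: "x \<in> K" "N x \<le> \<theta> ^ j" "\<forall>t\<in>Delta. f t = x" by auto
  show ?case by (rule I_cong[OF I_const[OF x(1,2)]]) (use x D in auto)
next
  case (Suc m)
  from Suc.prems(1) obtain c where c: "\<And>k. c k \<in> I m (j - k)"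
    "\<And>t. t \<in> Delta \<Longrightarrow> nsums (\<lambda>k. c k t * t m ^ k) (f t)" by (rule I_SucE) (rule that)
  have "(\<lambda>t. c k (u t) * u t m ^ k) \<in> I n (max (k - 0) j)" for k
  proof (rule I_antimono)
    have "(\<lambda>t. c k (u t)) \<in> I n (j - k)" using Suc.prems(2) by (intro Suc.IH[OF c(1)]) auto
    then show "(\<lambda>t. c k (u t) * u t m ^ k) \<in> I n (j - k + 1 * k)"
      by (rule I_mult) (rule I_power[OF Suc.prems(2)], simp)
  qed auto
  then show ?case by (rule I_complete) (use c(2)[OF D] in auto)
qed

lemma I_depends: "f \<in> I n j \<Longrightarrow> t \<in> Delta \<Longrightarrow> t' \<in> Delta \<Longrightarrow> (\<And>i. i < n \<Longrightarrow> t i = t' i) \<Longrightarrow> f t = f t'"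
proof (induction n arbitrary: f j)
  case (Suc n)
  from Suc.prems(1) obtain c where c: "\<And>k. c k \<in> I n (j - k)"
    "\<And>t. t \<in> Delta \<Longrightarrow> nsums (\<lambda>k. c k t * t n ^ k) (f t)" by (rule I_SucE) (rule that)
  have "c k t = c k t'" for k using Suc.prems by (intro Suc.IH[OF c(1)]) auto
  moreover have "t n = t' n" using Suc.prems by auto
  ultimately have "nsums (\<lambda>k. c k t' * t' n ^ k) (f t)" using c(2)[of t] Suc.prems by simp
  then show ?case using c(2)[of t'] Suc.prems nsums_unique by blast
qed auto

lemma I_value_in_K: "f \<in> I n j \<Longrightarrow> t \<in> Delta \<Longrightarrow> (\<And>i. i < n \<Longrightarrow> t i \<in> K) \<Longrightarrow> f t \<in> K"
proof (induction n arbitrary: f j)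
  case (Suc n)
  from Suc.prems(1) obtain c where c: "\<And>k. c k \<in> I n (j - k)"
    "\<And>t. t \<in> Delta \<Longrightarrow> nsums (\<lambda>k. c k t * t n ^ k) (f t)" by (rule I_SucE) (rule that)
  have "c k t \<in> K" for k using Suc.prems by (intro Suc.IH[OF c(1)]) auto
  then have "(\<Sum>k<m. c k t * t n ^ k) \<in> K" for m using Suc.prems
    by (intro subfield_of_sum[OF K] K') auto
  then show ?case using c(2)[OF Suc.prems(2)] unfolding nsums_def by (rule K_closed)
qed auto

text \<open>By discreteness a constant term of norm below 1 has norm at most
  \<open>\<theta>\<close>, hence level one; every positive power of a variable contributes a level
  by itself.\<close>

lemma I_maximal: "f \<in> I n 0 \<Longrightarrow> N (f (\<lambda>i. 0)) < 1 \<Longrightarrow> f \<in> I n 1"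
proof (induction n arbitrary: f)
  case 0
  then obtain x where x: "x \<in> K" "\<forall>t\<in>Delta. f t = x" by auto
  then show ?case using K_disc[OF x(1)] zero_in_Delta 0 by (auto intro!: bexI[of _ x])
next
  case (Suc n)
  then obtain c where c: "\<And>k. c k \<in> I n 0" "\<And>t. t \<in> Delta \<Longrightarrow> nsums (\<lambda>k. c k t * t n ^ k) (f t)" by auto
  have "nsums (\<lambda>k. c k (\<lambda>i. 0) * 0 ^ k) (c 0 (\<lambda>i. 0))"
    using nsums_finite[of 1 "\<lambda>k. c k (\<lambda>i. 0) * 0 ^ k"] by simp
  then have "f (\<lambda>i. 0) = c 0 (\<lambda>i. 0)" using c(2)[OF zero_in_Delta] nsums_unique by blast
  then have "c 0 \<in> I n 1" using Suc.IH[OF c(1)] Suc.prems by simp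
  then have "c k \<in> I n (1 - k)" for k using c(1) by (cases k) auto
  then show ?case using c(2) by auto
qed

lemma I_geometric:
  assumes w: "w \<in> I n 1"
  shows "(\<lambda>t. inverse (1 - w t)) \<in> I n 0"
proof -
  obtain g where g: "\<forall>t\<in>Delta. nsums (\<lambda>j. w t ^ j) (g t)"
    using I_sums_exists[of "\<lambda>j t. w t ^ j" n 0] I_power[OF w] by auto
  have "g \<in> I n 0"
    by (rule I_complete[of "\<lambda>j t. w t ^ j" _ 0]) (use I_power[OF w] g in auto)
  moreover have "inverse (1 - w t) = g t" if t: "t \<in> Delta" for t
  proof -
    have n: "nsums (\<lambda>j. w t ^ j) (g t)" using g t by auto
    from nsums_diff[OF n nsums_cmult[OF n, of "w t"]]
    have "nsums (\<lambda>j. w t ^ j - w t ^ Suc j) (g t - w t * g t)" by simp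
    moreover have "nsums (\<lambda>j. w t ^ j - w t ^ Suc j) 1"
    proof -
      have "(\<lambda>k. rho n t ^ (k - 0)) \<longlonglongrightarrow> 0" by (rule rho_power_0[OF t])
      moreover have "N ((\<Sum>j<k. w t ^ j - w t ^ Suc j) - 1) \<le> rho n t ^ (k - 0)" for k
      proof -
        have "(\<Sum>j<k. w t ^ j - w t ^ Suc j) = 1 - w t ^ k" by (induction k) auto
        then show ?thesis using I_bound_rho[OF t I_power[OF w, of k]] by simp
      qed
      ultimately show ?thesis unfolding nsums_def by (rule nlimI)
    qed
    ultimately have "g t - w t * g t = 1" using nsums_unique by blast
    then have "(1 - w t) * g t = 1" by (simp add: algebra_simps)
    then show ?thesis by (rule inverse_unique)
  qed
  ultimately show ?thesis by (rule I_cong)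
qed

lemma I_inverse:
  assumes f: "f \<in> I n 0" "N (f (\<lambda>i. 0)) = 1"
  shows "(\<lambda>t. inverse (f t)) \<in> I n 0"
proof -
  define x where "x = f (\<lambda>i. 0)"
  have x: "x \<in> K" "N x = 1" "x \<noteq> 0"
    using I_value_in_K[OF f(1) zero_in_Delta] f K'(1) N_eq_0_iff[of x] by (auto simp: x_def)
  have ix: "inverse x \<in> K" "N (inverse x) \<le> \<theta> ^ 0" using x K' by (auto simp: N_inverse)
  define w where "w t = 1 - inverse x * f t" for t
  have "w \<in> I n 0" unfolding w_def using I_scale[OF ix f(1)] by (intro I_diff I_1) simp
  then have "w \<in> I n 1" by (rule I_maximal) (use x in \<open>simp add: w_def x_def\<close>)
  from I_scale[OF ix I_geometric[OF this]] have "(\<lambda>t. inverse x * inverse (1 - w t)) \<in> I n 0" by simp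
  then show ?thesis by (rule I_cong) (use x in \<open>simp add: w_def field_simps\<close>)
qed

declare Filt.simps [simp del]

end

section \<open>Weierstrass division\<close>


context nonarch_field
begin

lemma nsums_pad_power:
  assumes "nsums (\<lambda>k. a k * x ^ k) l"
  shows "nsums (\<lambda>k. (if k < m then 0 else a (k - m)) * x ^ k) (l * x ^ m)"
proof -
  have "(if k < m then 0 else a (k - m) * x ^ (k - m) * x ^ m) = (if k < m then 0 else a (k - m)) * x ^ k" for k
    by (auto simp: mult.assoc power_add[symmetric])
  then show ?thesis using nsums_pad[OF nsums_multc[OF assms, of "x ^ m"], of m] by simp
qed

lemma nsums_sum: "(\<And>i. i \<in> X \<Longrightarrow> nsums (a i) (l i)) \<Longrightarrow> nsums (\<lambda>k. \<Sum>i\<in>X. a i k) (\<Sum>i\<in>X. l i)"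
  by (induction X rule: infinite_finite_induct) (auto intro: nsums_0 nsums_add)

text \<open>A coordinate change interchanging the variables \<open>0\<close> and \<open>n\<close> and moving the curve \<open>x \<mapsto> (x ^ M i)\<^sub>i\<close>
  (with \<open>M 0 = 1\<close>) to the last coordinate axis; \<open>unshear\<close> is its inverse.\<close>

definition shear :: "(nat \<Rightarrow> nat) \<Rightarrow> nat \<Rightarrow> (nat \<Rightarrow> 'a) \<Rightarrow> nat \<Rightarrow> 'a" where
  "shear M n t = (\<lambda>i. if i = 0 then t n else if i < n then t i + t n ^ M i
     else if i = n then t 0 + t n ^ M n else t i)"

definition unshear :: "(nat \<Rightarrow> nat) \<Rightarrow> nat \<Rightarrow> (nat \<Rightarrow> 'a) \<Rightarrow> nat \<Rightarrow> 'a" where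
  "unshear M n t = (\<lambda>i. if i = n then t 0 else if i = 0 then t n - t 0 ^ M n
     else if i < n then t i - t 0 ^ M i else t i)"

lemma shear_unshear: "shear M n (unshear M n t) = t"
  by (auto simp: unshear_def shear_def)

lemma N_power_less_1: "N x < 1 \<Longrightarrow> m \<ge> 1 \<Longrightarrow> N (x ^ m) < 1"
  by (simp add: N_power N_nonneg power_less_one_iff)

lemma shear_in_Delta: "(\<And>i. M i \<ge> 1) \<Longrightarrow> t \<in> Delta \<Longrightarrow> shear M n t \<in> Delta"
  using N_add[of "t _" "t _ ^ M _"] N_power_less_1
  by (fastforce simp: Delta_def shear_def intro: le_less_trans[OF N_add])

lemma unshear_in_Delta: "(\<And>i. M i \<ge> 1) \<Longrightarrow> t \<in> Delta \<Longrightarrow> unshear M n t \<in> Delta"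
  using N_power_less_1 by (fastforce simp: Delta_def unshear_def intro: le_less_trans[OF N_diff])

lemma curve_in_Delta: "(\<And>i. M i \<ge> 1) \<Longrightarrow> N x < 1 \<Longrightarrow> (\<lambda>i. x ^ M i) \<in> Delta"
  using N_power_less_1 by (simp add: Delta_def)

end

context power_series_ring
begin

lemma I_var_power: "i < n \<Longrightarrow> m \<ge> 1 \<Longrightarrow> (\<lambda>t. t i ^ m) \<in> I n 1"
  using I_power[OF I_var, of i n m] by (auto intro: I_antimono)

lemma shear_I: "(\<And>i. M i \<ge> 1) \<Longrightarrow> i < Suc n \<Longrightarrow> (\<lambda>t. shear M n t i) \<in> I (Suc n) 1"
  unfolding shear_def
  by (cases "i = 0"; cases "i < n"; cases "i = n") (auto intro!: I_add I_var[unfolded One_nat_def]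
    I_var_power[unfolded One_nat_def])

lemma unshear_I: "(\<And>i. M i \<ge> 1) \<Longrightarrow> i < Suc n \<Longrightarrow> (\<lambda>t. unshear M n t i) \<in> I (Suc n) 1"
  unfolding unshear_def
  by (cases "i = 0"; cases "i < n"; cases "i = n") (auto intro!: I_diff I_var[unfolded One_nat_def]
    I_var_power[unfolded One_nat_def])

lemma I_compose_shear: "(\<And>i. M i \<ge> 1) \<Longrightarrow> f \<in> I (Suc n) j \<Longrightarrow> (\<lambda>t. f (shear M n t)) \<in> I (Suc n) j"
  using I_compose[of "Suc n" "shear M n" "Suc n" f j] shear_I[of M _ n] shear_in_Delta[of M _ n] by blast

lemma I_compose_unshear: "(\<And>i. M i \<ge> 1) \<Longrightarrow> f \<in> I (Suc n) j \<Longrightarrow> (\<lambda>t. f (unshear M n t)) \<in> I (Suc n) j"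
  using I_compose[of "Suc n" "unshear M n" "Suc n" f j] unshear_I[of M _ n] unshear_in_Delta[of M _ n] by blast

lemma curve_coeffs:
  assumes g: "g \<in> I n 0" and M: "\<And>i. M i \<ge> 1"
  shows "\<exists>e. (\<forall>l. e l \<in> K \<and> N (e l) \<le> 1) \<and> (\<forall>x. N x < 1 \<longrightarrow> nsums (\<lambda>l. e l * x ^ l) (g (\<lambda>i. x ^ M i)))"
proof -
  have "(\<lambda>s. g (\<lambda>i. s 0 ^ M i)) \<in> I (Suc 0) 0"
  proof (rule I_compose[OF _ _ g])
    show "(\<lambda>t. t 0 ^ M i) \<in> I (Suc 0) 1" for i by (rule I_var_power) (use M in auto)
    show "(\<lambda>i. t 0 ^ M i) \<in> Delta" if "t \<in> Delta" for t
      by (rule curve_in_Delta) (use M that in \<open>auto simp: Delta_def\<close>)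
  qed
  then obtain c where c: "\<And>k. c k \<in> I 0 0"
    "\<And>t. t \<in> Delta \<Longrightarrow> nsums (\<lambda>k. c k t * t 0 ^ k) (g (\<lambda>i. t 0 ^ M i))" by (auto simp: Filt.simps)
  have "\<exists>e. e \<in> K \<and> N e \<le> 1 \<and> (\<forall>t\<in>Delta. c k t = e)" for k using c(1)[of k] by (auto simp: Filt.simps)
  then obtain e where e: "\<And>k. e k \<in> K" "\<And>k. N (e k) \<le> 1" "\<And>k t. t \<in> Delta \<Longrightarrow> c k t = e k" by metis
  have "nsums (\<lambda>l. e l * x ^ l) (g (\<lambda>i. x ^ M i))" if "N x < 1" for x
  proof -
    have "(\<lambda>i. x) \<in> Delta" using that by (simp add: Delta_def)
    from c(2)[OF this] e(3)[OF this] show ?thesis by simp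
  qed
  then show ?thesis using e by blast
qed

lemma I_split:
  assumes c: "\<And>k. c k \<in> I n j" "\<And>t. t \<in> Delta \<Longrightarrow> nsums (\<lambda>k. c k t * t n ^ k) (f t)"
  shows "\<exists>R. (\<forall>t\<in>Delta. nsums (\<lambda>k. c (k + m) t * t n ^ k) (R t) \<and> f t = (\<Sum>k<m. c k t * t n ^ k) + t n ^ m * R t)"
proof -
  have "\<exists>l. nsums (\<lambda>k. c (k + m) t * t n ^ k) l" if t: "t \<in> Delta" for t
  proof (rule nsums_exists, rule Lim_null_comparison)
    have "N (t n) < 1" using t by (auto simp: Delta_def)
    then show "(\<lambda>k. N (t n) ^ k) \<longlonglongrightarrow> 0" by (intro LIMSEQ_realpow_zero) (auto simp: N_nonneg)
    show "\<forall>\<^sub>F k in sequentially. norm (N (c (k + m) t * t n ^ k)) \<le> N (t n) ^ k"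
      using I_bound_1[OF t c(1)] by (intro always_eventually allI)
        (simp add: N_nonneg N_mult N_power mult_left_le_one_le)
  qed
  then obtain R where R: "\<And>t. t \<in> Delta \<Longrightarrow> nsums (\<lambda>k. c (k + m) t * t n ^ k) (R t)" by metis
  have "f t = (\<Sum>k<m. c k t * t n ^ k) + t n ^ m * R t" if t: "t \<in> Delta" for t
  proof -
    have "nsums (\<lambda>k. c (k + m) t * t n ^ (k + m)) (t n ^ m * R t)"
      using nsums_cmult[OF R[OF t], of "t n ^ m"] by (simp add: power_add algebra_simps)
    moreover have "nsums (\<lambda>k. c (k + m) t * t n ^ (k + m)) (f t - (\<Sum>k<m. c k t * t n ^ k))"
      using c(2)[OF t] by (subst (asm) nsums_shift[of _ _ m])
    ultimately have "t n ^ m * R t = f t - (\<Sum>k<m. c k t * t n ^ k)" using nsums_unique by blast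
    then show ?thesis by simp
  qed
  then show ?thesis using R by blast
qed

text \<open>The set may be infinite, so the maximum exists only by discreteness: an element of
  larger norm than one of least exponent \<open>mu\<close> would have a strictly smaller exponent,
  as the ratio of the norms is at most \<open>\<theta>\<close>.\<close>

lemma discrete_max:
  assumes "S \<noteq> {}" "\<And>k. k \<in> S \<Longrightarrow> g k \<in> K \<and> g k \<noteq> 0 \<and> N (g k) \<le> 1"
  shows "\<exists>k\<in>S. \<forall>l\<in>S. N (g l) \<le> N (g k)"
proof -
  define mu where "mu k = (LEAST j. \<theta> ^ j \<le> N (g k))" for k
  have mu: "\<theta> ^ mu k \<le> N (g k)" if "k \<in> S" for k
  proof -
    have "0 < N (g k)" using assms(2)[OF that] by (simp add: N_pos_iff)
    then obtain j where "\<theta> ^ j < N (g k)" using real_arch_pow_inv theta by blast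
    then show ?thesis unfolding mu_def by (intro LeastI[of "\<lambda>j. \<theta> ^ j \<le> N (g k)" j]) simp
  qed
  obtain k where k: "k \<in> S" "\<And>l. l \<in> S \<Longrightarrow> mu k \<le> mu l"
    using assms(1) ex_has_least_nat[of "\<lambda>k. k \<in> S" _ mu] by blast
  have "N (g l) \<le> N (g k)" if l: "l \<in> S" for l
  proof (rule ccontr)
    assume "\<not> N (g l) \<le> N (g k)"
    then have lt: "N (g k / g l) < 1" using assms(2)[OF l] by (simp add: N_divide N_pos_iff)
    moreover have "g k / g l \<in> K" using assms(2) k(1) l by (auto intro: K')
    ultimately have "N (g k / g l) \<le> \<theta>" using K_disc by blast
    then have le: "N (g k) \<le> \<theta> * N (g l)" using assms(2)[OF l] by (simp add: N_divide N_pos_iff field_simps)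
    have "\<theta> ^ mu k \<le> \<theta> * N (g l)" using mu[OF k(1)] le by simp
    moreover have "\<theta> * N (g l) \<le> \<theta>" using assms(2)[OF l] theta by simp
    ultimately have "mu k \<noteq> 0" using theta by (intro notI) simp
    then obtain j where j: "mu k = Suc j" by (cases "mu k") auto
    then have "\<theta> ^ j \<le> N (g l)" using \<open>\<theta> ^ mu k \<le> \<theta> * N (g l)\<close> theta by simp
    then have "mu l \<le> j" unfolding mu_def by (rule Least_le)
    then show False using k(2)[OF l] j by simp
  qed
  then show ?thesis using k(1) by blast
qed

text \<open>\<open>b\<close> is the expansion of \<open>f\<close> along the curve, with a unit
  coefficient in degree \<open>D\<close>. The condition \<open>M 0 = 1\<close> makes the first
  coordinate the parameter of the curve, as the shear requires; \<open>D = 0\<close> for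
  \<open>n = 0\<close> ensures that the exponent \<open>Suc D\<close> chosen for the first variable
  is 1.\<close>

definition primitive_curve :: "nat \<Rightarrow> ((nat \<Rightarrow> 'a) \<Rightarrow> 'a) \<Rightarrow> (nat \<Rightarrow> nat) \<Rightarrow> nat \<Rightarrow> (nat \<Rightarrow> 'a) \<Rightarrow> bool" where
  "primitive_curve n f M D b \<longleftrightarrow> (\<forall>i. M i \<ge> 1) \<and> (n = 0 \<longrightarrow> D = 0) \<and> (n > 0 \<longrightarrow> M 0 = 1) \<and>
     (\<forall>k. b k \<in> K \<and> N (b k) \<le> 1) \<and> N (b D) = 1 \<and>
     (\<forall>x. N x < 1 \<longrightarrow> nsums (\<lambda>k. b k * x ^ k) (f (\<lambda>i. x ^ M i)))"

text \<open>Dividing by the largest coefficient, one finds a curve of the form \<open>x \<mapsto> (x ^ M i)\<^sub>i\<close> along which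
  the quotient has a unit coefficient: the exponent of the last variable is chosen so large that
  the first slice with a unit coefficient cannot interfere with the later ones.\<close>

lemma content_primitive:
  "f \<in> I n 0 \<Longrightarrow> (\<forall>t\<in>Delta. f t = 0) \<or>
    (\<exists>\<gamma> f1 M D b. \<gamma> \<in> K \<and> \<gamma> \<noteq> 0 \<and> N \<gamma> \<le> 1 \<and> f1 \<in> I n 0 \<and> (\<forall>t\<in>Delta. f t = \<gamma> * f1 t) \<and> primitive_curve n f1 M D b)"
proof (induction n arbitrary: f)
  case 0
  then obtain x where x: "x \<in> K" "N x \<le> 1" "\<forall>t\<in>Delta. f t = x" by (auto simp: Filt.simps)
  show ?case
  proof (cases "x = 0")
    case False
    define b where "b k = (if k = 0 then 1 else 0 :: 'a)" for k :: nat
    have "primitive_curve 0 (\<lambda>t. 1) (\<lambda>i. 1) 0 b"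
      unfolding primitive_curve_def
      using K' nsums_finite[of 1 "\<lambda>k. b k * _ ^ k"] by (auto simp: b_def)
    then show ?thesis using x False I_1[of 0] by (intro disjI2 exI[of _ x] exI[of _ "\<lambda>t. 1"]) auto
  qed (use x in auto)
next
  case (Suc n)
  from Suc.prems obtain c where c: "\<And>k. c k \<in> I n 0"
    "\<And>t. t \<in> Delta \<Longrightarrow> nsums (\<lambda>k. c k t * t n ^ k) (f t)" by (auto simp: Filt.simps)
  define S where "S = {k. \<exists>t\<in>Delta. c k t \<noteq> 0}"
  show ?case
  proof (cases "S = {}")
    case True
    have "f t = 0" if t: "t \<in> Delta" for t
      using c(2)[OF t] True t nsums_unique[OF _ nsums_0, of "f t"] by (simp add: S_def)
    then show ?thesis by blast
  next
    case False
    have "\<exists>\<gamma> f1 M D b. k \<in> S \<longrightarrow> \<gamma> \<in> K \<and> \<gamma> \<noteq> 0 \<and> N \<gamma> \<le> 1 \<and> f1 \<in> I n 0 \<and> (\<forall>t\<in>Delta. c k t = \<gamma> * f1 t) \<and>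
      primitive_curve n f1 M D b" for k
      using Suc.IH[OF c(1)[of k]] unfolding S_def by (cases "k \<in> S") (auto simp: S_def)
    then obtain \<gamma> g M' D' b' where g: "\<And>k. k \<in> S \<Longrightarrow> \<gamma> k \<in> K \<and> \<gamma> k \<noteq> 0 \<and> N (\<gamma> k) \<le> 1 \<and> g k \<in> I n 0 \<and>
        (\<forall>t\<in>Delta. c k t = \<gamma> k * g k t) \<and> primitive_curve n (g k) (M' k) (D' k) (b' k)"
      by metis
    obtain k1 where k1: "k1 \<in> S" "\<And>l. l \<in> S \<Longrightarrow> N (\<gamma> l) \<le> N (\<gamma> k1)"
      using discrete_max[OF False, of \<gamma>] g by blast
    \<comment> \<open>The first slice of maximal content: earlier slices have strictly smaller
      content, later ones at most the same.\<close>
    define k0 where "k0 = (LEAST k. k \<in> S \<and> N (\<gamma> k) = N (\<gamma> k1))"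
    have k0: "k0 \<in> S" "N (\<gamma> k0) = N (\<gamma> k1)"
      using LeastI[of "\<lambda>k. k \<in> S \<and> N (\<gamma> k) = N (\<gamma> k1)" k1] k1 by (auto simp: k0_def)
    have k0_max: "N (\<gamma> l) \<le> N (\<gamma> k0)" if "l \<in> S" for l using k1(2)[OF that] k0 by simp
    have k0_least: "N (\<gamma> l) < N (\<gamma> k0)" if "l \<in> S" "l < k0" for l
      using not_less_Least[of l "\<lambda>k. k \<in> S \<and> N (\<gamma> k) = N (\<gamma> k1)"] that k1(2)[of l] k0
        by (fastforce simp: k0_def[symmetric])
    define \<gamma>0 where "\<gamma>0 = \<gamma> k0"
    have \<gamma>0: "\<gamma>0 \<in> K" "\<gamma>0 \<noteq> 0" "N \<gamma>0 \<le> 1" "0 < N \<gamma>0" using g[OF k0(1)] by (auto simp: \<gamma>0_def N_pos_iff)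
    \<comment> \<open>With exponent \<open>D + 1\<close> for the last variable, multiplying a slice
      by the \<open>k\<close>-th power of that variable shifts its expansion along the curve by
      \<open>(D + 1) * k\<close>.\<close>
    define M where "M = (M' k0)(n := Suc (D' k0))"
    define D where "D = D' k0"
    define b where "b = b' k0"
    have prim: "primitive_curve n (g k0) (M' k0) D b" using g[OF k0(1)] by (simp add: D_def b_def)
    then have M1: "M i \<ge> 1" for i by (auto simp: M_def primitive_curve_def)
    define c' where "c' k t = c k t / \<gamma>0" for k t
    define rat where "rat k = (if k \<in> S then \<gamma> k / \<gamma>0 else 0)" for k
    have rat: "rat k \<in> K" "N (rat k) \<le> 1" for k
      using g k0_max \<gamma>0 K' by (auto simp: rat_def N_divide \<gamma>0_def)
    have rat_less: "N (rat k) < 1" if "k < k0" for k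
      using k0_least[OF _ that] \<gamma>0 by (auto simp: rat_def N_divide \<gamma>0_def)
    have c'_rat: "\<exists>h\<in>I n 0. \<forall>t\<in>Delta. c' k t = rat k * h t" for k
    proof (cases "k \<in> S")
      case True
      then show ?thesis using g[OF True] by (intro bexI[of _ "g k"]) (auto simp: c'_def rat_def)
    next
      case False
      then show ?thesis using I_0 by (intro bexI[of _ "\<lambda>t. 0"]) (auto simp: c'_def rat_def S_def)
    qed
    then obtain h where h: "\<And>k. h k \<in> I n 0" "\<And>k t. t \<in> Delta \<Longrightarrow> c' k t = rat k * h k t" by metis
    have c': "c' k \<in> I n 0" for k
      by (rule I_cong[OF I_scale[of "rat k" 0 "h k" n 0, simplified]]) (use rat h in auto)
    define f1 where "f1 t = f t / \<gamma>0" for t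
    have f1: "nsums (\<lambda>k. c' k t * t n ^ k) (f1 t)" if "t \<in> Delta" for t
      using nsums_multc[OF c(2)[OF that], of "inverse \<gamma>0"] by (simp add: c'_def f1_def field_simps)
    have f1_I: "f1 \<in> I (Suc n) 0" using c' f1 by (auto intro!: I_SucI[of c'])
    obtain R where R: "\<And>t. t \<in> Delta \<Longrightarrow> nsums (\<lambda>k. c' (k + Suc k0) t * t n ^ k) (R t)"
      "\<And>t. t \<in> Delta \<Longrightarrow> f1 t = (\<Sum>k<Suc k0. c' k t * t n ^ k) + t n ^ Suc k0 * R t"
      using I_split[OF c' f1, of "Suc k0"] by blast
    have R_I: "R \<in> I (Suc n) 0" using c' R(1) by (intro I_SucI[of "\<lambda>k. c' (k + Suc k0)"]) simp_all
    obtain e where e: "\<And>l. e l \<in> K" "\<And>l. N (e l) \<le> 1" "\<And>x. N x < 1 \<Longrightarrow> nsums (\<lambda>l. e l * x ^ l) (R (\<lambda>i. x ^ M i))"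
      using curve_coeffs[OF R_I, of M] M1 by blast
    have "\<exists>a. (\<forall>l. a l \<in> K \<and> N (a l) \<le> 1) \<and> (\<forall>x. N x < 1 \<longrightarrow> nsums (\<lambda>l. a l * x ^ l) (h k (\<lambda>i. x ^ M i)))" for k
      using curve_coeffs[OF h(1), of M] M1 by blast
    then obtain a where a: "\<And>k l. a k l \<in> K" "\<And>k l. N (a k l) \<le> 1"
      "\<And>k x. N x < 1 \<Longrightarrow> nsums (\<lambda>l. a k l * x ^ l) (h k (\<lambda>i. x ^ M i))" by metis
    define pad where "pad m s l = (if l < m then 0 else s (l - m))" for m and s :: "nat \<Rightarrow> 'a" and l :: nat
    have pad: "nsums (\<lambda>l. pad m s l * x ^ l) (y * x ^ m)" if "nsums (\<lambda>l. s l * x ^ l) y" for m s x y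
      unfolding pad_def by (rule nsums_pad_power[OF that])
    define d where "d k l = rat k * a k l" for k l
    have d: "nsums (\<lambda>l. d k l * x ^ l) (c' k (\<lambda>i. x ^ M i))" if "N x < 1" for k x
      using nsums_cmult[OF a(3)[OF that, of k], of "rat k"] h(2)[OF curve_in_Delta[OF M1 that]]
      by (simp add: d_def mult.assoc)
    have d_K: "d k l \<in> K" for k l using rat a by (auto simp: d_def intro: K')
    have d_le: "N (d k l) \<le> 1" for k l using rat a by (auto simp: d_def N_mult N_nonneg intro: mult_le_one)
    have d_theta: "N (d k l) \<le> \<theta>" if "k < k0" for k l
    proof (rule K_disc[OF d_K])
      show "N (d k l) < 1" using rat_less[OF that] a(2)[of k l]
        by (simp add: d_def N_mult) (metis N_nonneg mult_left_le order_le_less_trans)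
    qed
    have b: "nsums (\<lambda>l. b l * x ^ l) (c' k0 (\<lambda>i. x ^ M i))" if x: "N x < 1" for x
    proof -
      have "c' k0 (\<lambda>i. x ^ M i) = c' k0 (\<lambda>i. x ^ M' k0 i)"
        by (rule I_depends[OF c']) (use x prim M1 in \<open>auto simp: M_def primitive_curve_def intro!: curve_in_Delta\<close>)
      also have "\<dots> = g k0 (\<lambda>i. x ^ M' k0 i)"
        using g[OF k0(1)] \<gamma>0 curve_in_Delta[of "M' k0" x] x prim
        by (auto simp: c'_def \<gamma>0_def primitive_curve_def)
      finally show ?thesis using prim x by (simp add: primitive_curve_def)
    qed
    define B where "B l = (\<Sum>k<k0. pad (Suc D * k) (d k) l) + pad (Suc D * k0) b l + pad (Suc D * Suc k0) e l" for l
    have B: "nsums (\<lambda>l. B l * x ^ l) (f1 (\<lambda>i. x ^ M i))" if x: "N x < 1" for x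
    proof -
      let ?X = "\<lambda>i. x ^ M i"
      have X: "?X \<in> Delta" by (rule curve_in_Delta[OF M1 x])
      have "nsums (\<lambda>l. (\<Sum>k<k0. pad (Suc D * k) (d k) l * x ^ l) + pad (Suc D * k0) b l * x ^ l + pad (Suc D
        * Suc k0) e l * x ^ l)
         ((\<Sum>k<k0. c' k ?X * x ^ (Suc D * k)) + c' k0 ?X * x ^ (Suc D * k0) + R ?X * x ^ (Suc D * Suc k0))"
        by (intro nsums_add nsums_sum pad d b e(3) x)
      moreover have "f1 ?X = (\<Sum>k<k0. c' k ?X * x ^ (Suc D * k)) + c' k0 ?X * x ^ (Suc D * k0) + R ?X * x ^
        (Suc D * Suc k0)"
      proof -
        have XM: "(x ^ M n) ^ k = x ^ (Suc D * k)" for k by (simp only: M_def D_def fun_upd_same power_mult)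
        have "f1 ?X = (\<Sum>k<Suc k0. c' k ?X * x ^ (Suc D * k)) + x ^ (Suc D * Suc k0) * R ?X"
          unfolding R(2)[OF X] XM ..
        then show ?thesis by (simp add: mult.commute)
      qed
      moreover have "(\<Sum>k<k0. pad (Suc D * k) (d k) l * x ^ l) + pad (Suc D * k0) b l * x ^ l + pad (Suc D *
        Suc k0) e l * x ^ l
          = B l * x ^ l" for l
        by (simp add: B_def distrib_right sum_distrib_right)
      ultimately show ?thesis by simp
    qed
    have bK: "b l \<in> K" "N (b l) \<le> 1" for l using prim by (auto simp: primitive_curve_def)
    have pad_K: "pad m s l \<in> K" if "\<And>l. s l \<in> K" for m s l using that K' by (auto simp: pad_def)
    have pad_N: "N (pad m s l) \<le> y" if "\<And>l. N (s l) \<le> y" "0 \<le> y" for m s l y using that by (auto simp: pad_def)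
    have B_K: "B l \<in> K" for l unfolding B_def
      by (intro K' subfield_of_sum[OF K] pad_K d_K bK e)
    have "N ((\<Sum>k<k0. pad (Suc D * k) (d k) l) + pad (Suc D * k0) b l) \<le> 1" for l
      by (rule order.trans[OF N_add]) (auto intro!: N_sum pad_N d_le bK)
    then have B_N: "N (B l) \<le> 1" for l unfolding B_def
      by (intro order.trans[OF N_add]) (auto intro!: pad_N e)
    \<comment> \<open>This degree lies below \<open>(D + 1) * (k0 + 1)\<close>, so the tail
      contributes nothing there. The slices before \<open>k0\<close> contribute norm at most
      \<open>\<theta>\<close>, and slice \<open>k0\<close> contributes the unit
      \<open>b D\<close>.\<close>
    define D1 where "D1 = D + Suc D * k0"
    have "N (\<Sum>k<k0. pad (Suc D * k) (d k) D1) \<le> \<theta>"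
      by (intro N_sum pad_N d_theta) (use theta in auto)
    moreover have "pad (Suc D * k0) b D1 = b D" by (simp add: pad_def D1_def)
    moreover have "N (b D) = 1" using prim by (simp add: primitive_curve_def)
    moreover have "pad (Suc D * Suc k0) e D1 = 0" by (simp add: pad_def D1_def)
    ultimately have B_D1: "N (B D1) = 1" unfolding B_def using theta by (simp add: N_add_eq)
    have "M 0 = 1" using prim by (cases "n = 0") (auto simp: M_def D_def[symmetric] primitive_curve_def)
    then have "primitive_curve (Suc n) f1 M D1 B"
      unfolding primitive_curve_def using M1 B_K B_N B_D1 B by auto
    moreover have "\<forall>t\<in>Delta. f t = \<gamma>0 * f1 t" using \<gamma>0 by (simp add: f1_def)
    ultimately show ?thesis using \<gamma>0 f1_I by blast
  qed
qed

text \<open>Weierstrass regularity of order \<open>d\<close> in the last variable, expressed by the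
  constant terms of the coefficients: the first unit among them is the \<open>d\<close>-th.\<close>

definition regular :: "nat \<Rightarrow> nat \<Rightarrow> ((nat \<Rightarrow> 'a) \<Rightarrow> 'a) \<Rightarrow> (nat \<Rightarrow> (nat \<Rightarrow> 'a) \<Rightarrow> 'a) \<Rightarrow> bool" where
  "regular n d f c \<longleftrightarrow> (\<forall>k. c k \<in> I n 0) \<and> (\<forall>t\<in>Delta. nsums (\<lambda>k. c k t * t n ^ k) (f t)) \<and>
     N (c d (\<lambda>i. 0)) = 1 \<and> (\<forall>k<d. N (c k (\<lambda>i. 0)) < 1)"

text \<open>On the last coordinate axis the sheared series is \<open>f\<close> along the curve, so
  by uniqueness of expansions the constant terms of its coefficients are the \<open>b k\<close>. The
  order is the first index of a unit, which may be smaller than \<open>D\<close>.\<close>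

lemma regular_shear:
  assumes f: "f \<in> I (Suc n) 0" and prim: "primitive_curve (Suc n) f M D b"
  shows "\<exists>d c. regular n d (\<lambda>t. f (shear M n t)) c"
proof -
  have M: "\<And>i. M i \<ge> 1" "M 0 = 1" using prim by (auto simp: primitive_curve_def)
  obtain c where c: "\<And>k. c k \<in> I n 0" "\<And>t. t \<in> Delta \<Longrightarrow> nsums (\<lambda>k. c k t * t n ^ k) (f (shear M n t))"
    using I_compose_shear[of M f n 0] M(1) f by (auto simp: Filt.simps)
  have "c k (\<lambda>i. 0) - b k = 0" for k
  proof (rule power_series_unique[where a = "\<lambda>k. c k (\<lambda>i. 0) - b k"])
    show "N (c k (\<lambda>i. 0) - b k) \<le> 1" for k
      by (rule order.trans[OF N_diff]) (use I_bound_1[OF zero_in_Delta c(1)[of k]] prim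
        in \<open>auto simp: primitive_curve_def\<close>)
    fix x assume x: "N x < 1"
    \<comment> \<open>The entries beyond \<open>n\<close> do not affect the coefficients; this
      choice makes \<open>shear M n t\<close> exactly the point of the curve.\<close>
    define t where "t i = (if i < n then 0 else if i = n then x else x ^ M i)" for i
    have t: "t \<in> Delta" using x M N_power_less_1 by (auto simp: Delta_def t_def)
    have "shear M n t = (\<lambda>i. x ^ M i)" using M(2) by (auto simp: shear_def t_def fun_eq_iff)
    moreover have "c k t = c k (\<lambda>i. 0)" for k by (rule I_depends[OF c(1) t zero_in_Delta]) (simp add: t_def)
    ultimately have "nsums (\<lambda>k. c k (\<lambda>i. 0) * x ^ k) (f (\<lambda>i. x ^ M i))"
      using c(2)[OF t] by (simp add: t_def)
    from nsums_diff[OF this, of "\<lambda>k. b k * x ^ k" "f (\<lambda>i. x ^ M i)"] prim x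
    show "nsums (\<lambda>k. (c k (\<lambda>i. 0) - b k) * x ^ k) 0" by (simp add: primitive_curve_def left_diff_distrib)
  qed
  then have cb: "c k (\<lambda>i. 0) = b k" for k by simp
  define d where "d = (LEAST k. N (b k) = 1)"
  have "N (b d) = 1" unfolding d_def by (rule LeastI[of _ D]) (use prim in \<open>simp add: primitive_curve_def\<close>)
  moreover have "N (b k) < 1" if "k < d" for k
    using not_less_Least[OF that[unfolded d_def]] prim by (auto simp: primitive_curve_def less_le)
  ultimately have "regular n d (\<lambda>t. f (shear M n t)) c" using c cb by (auto simp: regular_def)
  then show ?thesis by blast
qed

text \<open>Here the last variable has weight zero and only the coefficients carry the level. With
  \<open>Filt\<close>, splitting off \<open>t n ^ d\<close> could lower the level by
  \<open>d\<close>, and the correction steps of the division would not gain.\<close>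

definition G :: "nat \<Rightarrow> nat \<Rightarrow> ((nat \<Rightarrow> 'a) \<Rightarrow> 'a) set" where
  "G n j = {f. \<exists>c. (\<forall>k. c k \<in> I n j) \<and> (\<forall>t\<in>Delta. nsums (\<lambda>k. c k t * t n ^ k) (f t))}"

lemma G_subset_I: "f \<in> G n j \<Longrightarrow> f \<in> I (Suc n) j"
proof -
  assume "f \<in> G n j"
  then obtain c where c: "\<And>k. c k \<in> I n j" "\<And>t. t \<in> Delta \<Longrightarrow> nsums (\<lambda>k. c k t * t n ^ k) (f t)"
    unfolding G_def by blast
  show ?thesis by (rule I_SucI[of c]) (auto intro: I_antimono c)
qed

lemma G_0: "G n 0 = I (Suc n) 0"
  by (simp add: G_def Filt.simps)

lemma G_minus: "f \<in> G n j \<Longrightarrow> (\<lambda>t. - f t) \<in> G n j"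
proof -
  assume "f \<in> G n j"
  then obtain c where c: "\<And>k. c k \<in> I n j" "\<And>t. t \<in> Delta \<Longrightarrow> nsums (\<lambda>k. c k t * t n ^ k) (f t)"
    unfolding G_def by blast
  show ?thesis unfolding G_def
    using I_minus[OF c(1)] nsums_cmult[OF c(2), of _ "-1"] by (auto intro!: exI[of _ "\<lambda>k t. - c k t"])
qed

lemma G_polynomial:
  assumes "\<And>k. k < d \<Longrightarrow> c k \<in> I n j"
  shows "(\<lambda>t. \<Sum>k<d. c k t * t n ^ k) \<in> G n j"
proof -
  define c' where "c' k = (if k < d then c k else (\<lambda>t. 0))" for k
  have "c' k \<in> I n j" for k using assms I_0 by (simp add: c'_def)
  moreover have "nsums (\<lambda>k. c' k t * t n ^ k) (\<Sum>k<d. c k t * t n ^ k)" for t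
    using nsums_finite[of d "\<lambda>k. c' k t * t n ^ k"] by (simp add: c'_def)
  ultimately show ?thesis unfolding G_def by blast
qed

text \<open>The Cauchy product. Convergence comes from the powers of the last variable alone, since
  the coefficients are only known to be bounded by 1.\<close>

lemma G_mult:
  assumes "f \<in> G n i" "g \<in> G n j"
  shows "(\<lambda>t. f t * g t) \<in> G n (i + j)"
proof -
  obtain c where c: "\<And>k. c k \<in> I n i" "\<And>t. t \<in> Delta \<Longrightarrow> nsums (\<lambda>k. c k t * t n ^ k) (f t)"
    using assms(1) unfolding G_def by blast
  obtain d where d: "\<And>k. d k \<in> I n j" "\<And>t. t \<in> Delta \<Longrightarrow> nsums (\<lambda>k. d k t * t n ^ k) (g t)"
    using assms(2) unfolding G_def by blast
  define e where "e l t = (\<Sum>k<Suc l. c (l - k) t * d k t)" for l t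
  have "e l \<in> I n (i + j)" for l unfolding e_def by (intro I_sum I_mult c d)
  moreover have "nsums (\<lambda>l. e l t * t n ^ l) (f t * g t)" if t: "t \<in> Delta" for t
  proof (rule nsums_swap[where b = "\<lambda>m. N (t n) ^ m" and s = "\<lambda>k. f t * (d k t * t n ^ k)"
        and a = "\<lambda>k l. (if l < k then 0 else c (l - k) t * d k t) * t n ^ l"])
    have tn: "N (t n) < 1" "0 \<le> N (t n)" using t N_nonneg by (auto simp: Delta_def)
    show "(\<lambda>m. N (t n) ^ m) \<longlonglongrightarrow> 0" using tn by (intro LIMSEQ_realpow_zero)
    show "N (t n) ^ m' \<le> N (t n) ^ m" if "m \<le> m'" for m m' using tn that by (intro power_decreasing) auto
    show "N ((if l < k then 0 else c (l - k) t * d k t) * t n ^ l) \<le> N (t n) ^ max k l" for k l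
    proof (cases "l < k")
      case False
      have "N (c (l - k) t) * N (d k t) \<le> 1" using I_bound_1[OF t c(1)] I_bound_1[OF t d(1)] N_nonneg
        by (intro mult_le_one) auto
      then show ?thesis using False tn N_nonneg by (simp add: N_mult N_power max_def mult_left_le_one_le)
    qed (use tn in simp)
    show "nsums (\<lambda>l. (if l < k then 0 else c (l - k) t * d k t) * t n ^ l) (f t * (d k t * t n ^ k))" for k
    proof -
      have "nsums (\<lambda>l. c l t * d k t * t n ^ l) (f t * d k t)"
        using nsums_multc[OF c(2)[OF t], of "d k t"] by (simp add: algebra_simps)
      from nsums_pad_power[OF this, of k] show ?thesis by (simp add: mult.assoc)
    qed
    show "nsums (\<lambda>k. f t * (d k t * t n ^ k)) (f t * g t)" by (rule nsums_cmult[OF d(2)[OF t]])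
    show "nsums (\<lambda>k. (if l < k then 0 else c (l - k) t * d k t) * t n ^ l) (e l t * t n ^ l)" for l
      using nsums_finite[of "Suc l" "\<lambda>k. (if l < k then 0 else c (l - k) t * d k t) * t n ^ l"]
      by (simp add: e_def sum_distrib_right distrib_right)
  qed
  ultimately show ?thesis unfolding G_def by blast
qed

context
  fixes n d :: nat and f :: "(nat \<Rightarrow> 'a) \<Rightarrow> 'a" and c :: "nat \<Rightarrow> (nat \<Rightarrow> 'a) \<Rightarrow> 'a"
  assumes reg: "regular n d f c"
begin

text \<open>Split \<open>f\<close> as \<open>P + t n ^ d * U\<close>. The coefficients of
  \<open>P\<close> lie in the maximal ideal, and \<open>U\<close> has a unit constant term, hence an
  inverse \<open>V\<close>. So \<open>t n ^ d\<close> can be exchanged for a multiple of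
  \<open>f\<close> up to an error of level one.\<close>

lemma regular_decomposition:
  shows "\<exists>P V. P \<in> G n 1 \<and> V \<in> G n 0 \<and> (\<forall>t\<in>Delta. N (V t) = 1 \<and> t n ^ d = V t * f t - V t * P t)"
proof -
  have c: "\<And>k. c k \<in> I n 0" "\<And>t. t \<in> Delta \<Longrightarrow> nsums (\<lambda>k. c k t * t n ^ k) (f t)"
    "N (c d (\<lambda>i. 0)) = 1" "\<And>k. k < d \<Longrightarrow> N (c k (\<lambda>i. 0)) < 1" using reg by (auto simp: regular_def)
  define P where "P t = (\<Sum>k<d. c k t * t n ^ k)" for t
  have P: "P \<in> G n 1" unfolding P_def by (intro G_polynomial I_maximal c)
  obtain U where U: "\<And>t. t \<in> Delta \<Longrightarrow> nsums (\<lambda>k. c (k + d) t * t n ^ k) (U t)"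
    "\<And>t. t \<in> Delta \<Longrightarrow> f t = P t + t n ^ d * U t" using I_split[OF c(1,2), of d] unfolding P_def by blast
  have U_I: "U \<in> I (Suc n) 0" using c(1) U(1) by (intro I_SucI[of "\<lambda>k. c (k + d)"]) simp_all
  have "nsums (\<lambda>k. c (k + d) (\<lambda>i. 0) * 0 ^ k) (c d (\<lambda>i. 0))"
    using nsums_finite[of 1 "\<lambda>k. c (k + d) (\<lambda>i. 0) * 0 ^ k"] by simp
  then have U0: "U (\<lambda>i. 0) = c d (\<lambda>i. 0)" using U(1)[OF zero_in_Delta] nsums_unique by blast
  define V where "V t = inverse (U t)" for t
  have V_I: "V \<in> I (Suc n) 0" unfolding V_def by (rule I_inverse[OF U_I]) (simp add: U0 c)
  have N_U: "N (U t) = 1" if t: "t \<in> Delta" for t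
  proof -
    define w where "w t = U t - c d (\<lambda>i. 0)" for t
    have "c d (\<lambda>i. 0) \<in> K" using I_value_in_K[OF c(1) zero_in_Delta] K' by simp
    then have "w \<in> I (Suc n) 0" unfolding w_def using c(3) by (intro I_diff U_I I_const) auto
    then have "w \<in> I (Suc n) 1" by (rule I_maximal) (simp add: w_def U0)
    then have "N (w t) < 1" by (rule I_bound_less[OF t])
    then show ?thesis using N_add_eq[of "w t" "c d (\<lambda>i. 0)"] c(3) by (simp add: w_def)
  qed
  have "t n ^ d = V t * f t - V t * P t \<and> N (V t) = 1" if t: "t \<in> Delta" for t
  proof -
    have "U t \<noteq> 0" using N_U[OF t] by auto
    moreover have "N (V t) = 1" using N_U[OF t] by (simp add: V_def N_inverse)
    ultimately show ?thesis using U(2)[OF t] by (simp add: V_def field_simps)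
  qed
  then show ?thesis using P V_I G_0 by blast
qed

text \<open>In the high part of \<open>h\<close>, replace \<open>t n ^ d\<close> by
  \<open>V * f - V * P\<close>; the factor \<open>P\<close> gains one level.\<close>

lemma division_step:
  assumes h: "h \<in> G n j"
  shows "\<exists>q r h'. q \<in> G n j \<and> (\<forall>i. r i \<in> I n j) \<and> h' \<in> G n (Suc j) \<and>
    (\<forall>t\<in>Delta. h t = q t * f t + (\<Sum>i<d. r i t * t n ^ i) + h' t)"
proof -
  obtain P V where PV: "P \<in> G n 1" "V \<in> G n 0" "\<And>t. t \<in> Delta \<Longrightarrow> t n ^ d = V t * f t - V t * P t"
    using regular_decomposition by blast
  obtain r where r: "\<And>k. r k \<in> I n j" "\<And>t. t \<in> Delta \<Longrightarrow> nsums (\<lambda>k. r k t * t n ^ k) (h t)"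
    using h unfolding G_def by blast
  obtain R where R: "\<And>t. t \<in> Delta \<Longrightarrow> nsums (\<lambda>k. r (k + d) t * t n ^ k) (R t)"
    "\<And>t. t \<in> Delta \<Longrightarrow> h t = (\<Sum>k<d. r k t * t n ^ k) + t n ^ d * R t" using I_split[OF r, of d] by blast
  have R_G: "R \<in> G n j" using r(1) R(1) unfolding G_def by (auto intro!: exI[of _ "\<lambda>k. r (k + d)"])
  define q where "q t = V t * R t" for t
  have q: "q \<in> G n j" using G_mult[OF PV(2) R_G] by (simp add: q_def[abs_def])
  have "(\<lambda>t. - (P t * q t)) \<in> G n (Suc j)" using G_minus[OF G_mult[OF PV(1) q]] by simp
  moreover have "h t = q t * f t + (\<Sum>i<d. r i t * t n ^ i) + - (P t * q t)" if t: "t \<in> Delta" for t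
    unfolding R(2)[OF t] PV(3)[OF t] by (simp add: q_def algebra_simps)
  ultimately show ?thesis using q r(1) by blast
qed

text \<open>The error of each step is divided again. Its level grows by one each time, so the
  quotients and the remainders can be summed by completeness.\<close>

lemma division:
  assumes h: "h \<in> G n j"
  shows "\<exists>q r. q \<in> I (Suc n) j \<and> (\<forall>i. r i \<in> I n j) \<and>
    (\<forall>t\<in>Delta. h t = q t * f t + (\<Sum>i<d. r i t * t n ^ i))"
proof -
  define rel where "rel m h q r h' \<longleftrightarrow> q \<in> G n (j + m) \<and> (\<forall>i. r i \<in> I n (j + m)) \<and> h' \<in> G n (Suc (j + m)) \<and>
    (\<forall>t\<in>Delta. h t = q t * f t + (\<Sum>i<d. r i t * t n ^ i) + h' t)" for m h q r h'
  have "\<exists>H. \<forall>m. (H m \<in> G n (j + m) \<and> (m = 0 \<longrightarrow> H m = h)) \<and> (\<exists>q r. rel m (H m) q r (H (Suc m)))"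
  proof (rule dependent_nat_choice)
    show "\<exists>x. x \<in> G n (j + 0) \<and> (0 = 0 \<longrightarrow> x = h)" using h by auto
    fix x m assume "x \<in> G n (j + m) \<and> (m = 0 \<longrightarrow> x = h)"
    then obtain q r h' where "rel m x q r h'" using division_step[of x "j + m"] unfolding rel_def by blast
    then show "\<exists>y. (y \<in> G n (j + Suc m) \<and> (Suc m = 0 \<longrightarrow> y = h)) \<and> (\<exists>q r. rel m x q r y)"
      by (intro exI[of _ h']) (auto simp: rel_def)
  qed
  then obtain H where H: "\<And>m. H m \<in> G n (j + m)" "H 0 = h" "\<And>m. \<exists>q r. rel m (H m) q r (H (Suc m))" by blast
  then obtain q r where qr: "\<And>m. rel m (H m) (q m) (r m) (H (Suc m))" by metis
  have q: "q m \<in> I (Suc n) (max (m - 0) j)" and r: "r m i \<in> I n (max (m - 0) j)" for m i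
    using qr[of m] by (auto simp: rel_def intro: I_antimono[OF G_subset_I] I_antimono)
  obtain Q where Q: "\<And>t. t \<in> Delta \<Longrightarrow> nsums (\<lambda>m. q m t) (Q t)"
    using I_sums_exists[of q "Suc n" 0] I_antimono[OF q] by (metis max.cobounded1)
  have "\<exists>R. \<forall>t\<in>Delta. nsums (\<lambda>m. r m i t) (R t)" for i
    by (rule I_sums_exists[of _ n 0]) (rule I_antimono[OF r], simp)
  then obtain R where R: "\<And>i t. t \<in> Delta \<Longrightarrow> nsums (\<lambda>m. r m i t) (R i t)" by metis
  have "Q \<in> I (Suc n) j" by (rule I_complete[OF q Q])
  moreover have "R i \<in> I n j" for i by (rule I_complete[OF r R])
  moreover have "h t = Q t * f t + (\<Sum>i<d. R i t * t n ^ i)" if t: "t \<in> Delta" for t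
  proof (rule nsums_unique)
    show "nsums (\<lambda>m. q m t * f t + (\<Sum>i<d. r m i t * t n ^ i)) (Q t * f t + (\<Sum>i<d. R i t * t n ^ i))"
      by (intro nsums_add nsums_sum nsums_multc Q R t)
    have step: "q m t * f t + (\<Sum>i<d. r m i t * t n ^ i) = H m t - H (Suc m) t" for m
      using qr[of m] t by (simp add: rel_def)
    have "(\<Sum>m<k. q m t * f t + (\<Sum>i<d. r m i t * t n ^ i)) = h t - H k t" for k
      unfolding step by (induction k) (simp_all add: H(2))
    then have "N ((\<Sum>m<k. q m t * f t + (\<Sum>i<d. r m i t * t n ^ i)) - h t) \<le> rho (Suc n) t ^ (k - 0)" for k
      using I_bound_rho[OF t I_antimono[OF G_subset_I[OF H(1)[of k]], of k]] by simp
    then show "nsums (\<lambda>m. q m t * f t + (\<Sum>i<d. r m i t * t n ^ i)) (h t)"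
      unfolding nsums_def using rho_power_0[OF t, of "Suc n" 0] by (intro nlimI)
  qed
  ultimately show ?thesis by blast
qed

text \<open>Dividing the error \<open>- (P * V)\<close> of the exchange formula by \<open>f\<close>
  leaves a remainder of degree below \<open>d\<close> with coefficients in the maximal ideal. The
  factor \<open>E = V + q\<close> never vanishes, because \<open>V\<close> has norm 1 and
  \<open>q\<close> has level one.\<close>

lemma distinguished_polynomial:
  "\<exists>E r. E \<in> I (Suc n) 0 \<and> (\<forall>t\<in>Delta. E t \<noteq> 0) \<and> (\<forall>i. r i \<in> I n 1) \<and>
    (\<forall>t\<in>Delta. t n ^ d = E t * f t + (\<Sum>i<d. r i t * t n ^ i))"
proof -
  obtain P V where PV: "P \<in> G n 1" "V \<in> G n 0" "\<And>t. t \<in> Delta \<Longrightarrow> t n ^ d = V t * f t - V t * P t"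
    "\<And>t. t \<in> Delta \<Longrightarrow> N (V t) = 1" using regular_decomposition by blast
  have "(\<lambda>t. - (P t * V t)) \<in> G n 1" using G_minus[OF G_mult[OF PV(1,2)]] by simp
  from division[OF this] obtain q r where qr: "q \<in> I (Suc n) 1" "\<And>i. r i \<in> I n 1"
    "\<And>t. t \<in> Delta \<Longrightarrow> - (P t * V t) = q t * f t + (\<Sum>i<d. r i t * t n ^ i)" by blast
  have "(\<lambda>t. V t + q t) \<in> I (Suc n) 0"
    using PV(2) I_antimono[OF qr(1), of 0] by (intro I_add) (auto simp: G_0)
  moreover have "V t + q t \<noteq> 0" if t: "t \<in> Delta" for t
    using N_add_eq[of "q t" "V t"] I_bound_less[OF t qr(1)] PV(4)[OF t] by (auto simp: add.commute)
  moreover have "t n ^ d = (V t + q t) * f t + (\<Sum>i<d. r i t * t n ^ i)" if t: "t \<in> Delta" for t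
  proof -
    have "t n ^ d = V t * f t + - (P t * V t)" using PV(3)[OF t] by (simp add: mult.commute)
    then show ?thesis unfolding qr(3)[OF t] by (simp add: algebra_simps)
  qed
  ultimately show ?thesis using qr(2) by blast
qed

end

end

section \<open>Points of prime ideals\<close>

definition prime_ideal_on :: "'r::comm_ring_1 set \<Rightarrow> 'r set \<Rightarrow> bool" where
  "prime_ideal_on A J \<longleftrightarrow> J \<subseteq> A \<and> 0 \<in> J \<and> (\<forall>f\<in>J. \<forall>g\<in>J. f + g \<in> J) \<and> (\<forall>f\<in>A. \<forall>g\<in>J. f * g \<in> J) \<and>
    (\<forall>f\<in>A. \<forall>g\<in>A. f * g \<in> J \<longrightarrow> f \<in> J \<or> g \<in> J) \<and> 1 \<notin> J"

context power_series_ring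
begin

text \<open>Weierstrass preparation in one variable: for \<open>n = 0\<close> the coefficients
  \<open>r i\<close> are constants on \<open>Delta\<close>, so all zeros in the disc are roots of a
  monic polynomial.\<close>

lemma finite_zeros:
  assumes e: "\<And>k. e k \<in> K" "\<And>k. N (e k) \<le> 1" and nz: "e k0 \<noteq> 0"
  shows "finite {x. N x < 1 \<and> nsums (\<lambda>k. e k * x ^ k) 0}"
proof -
  have eI: "(\<lambda>t. e k) \<in> I 0 0" for k by (rule I_const) (use e in auto)
  have term_I: "(\<lambda>t. e k * t 0 ^ k) \<in> I 1 k" for k
    using I_mult[OF I_const[of "e k" 0 1] I_power[OF I_var[of 0 1], of k]] e by simp
  obtain F where F: "\<And>t. t \<in> Delta \<Longrightarrow> nsums (\<lambda>k. e k * t 0 ^ k) (F t)"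
    using I_sums_exists[of "\<lambda>k t. e k * t 0 ^ k" 1 0] term_I by auto
  have F_I: "F \<in> I (Suc 0) 0"
    by (rule I_SucI[where c = "\<lambda>k t. e k"]) (use eI F in auto)
  have nonzero: "\<not> (\<forall>t\<in>Delta. F t = 0)"
  proof
    assume z: "\<forall>t\<in>Delta. F t = 0"
    have "e k0 = 0"
    proof (rule power_series_unique[where a = e])
      fix x assume "N x < 1"
      then have "(\<lambda>i. x) \<in> Delta" by (simp add: Delta_def)
      then show "nsums (\<lambda>k. e k * x ^ k) 0" using F z by fastforce
    qed (rule e)
    then show False using nz by simp
  qed
  then obtain \<gamma> f1 M D b where f1: "\<gamma> \<in> K" "\<gamma> \<noteq> 0" "f1 \<in> I (Suc 0) 0" "\<forall>t\<in>Delta. F t = \<gamma> * f1 t"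
    "primitive_curve (Suc 0) f1 M D b" using content_primitive[OF F_I] by blast
  have "shear M 0 = (\<lambda>t. t)" by (auto simp: shear_def fun_eq_iff)
  then obtain d c where reg: "regular 0 d f1 c" using regular_shear[OF f1(3,5)] by auto
  obtain E r where E: "\<And>t. t \<in> Delta \<Longrightarrow> E t \<noteq> 0" "\<And>i. r i \<in> I 0 1"
    "\<And>t. t \<in> Delta \<Longrightarrow> t 0 ^ d = E t * f1 t + (\<Sum>i<d. r i t * t 0 ^ i)"
    using distinguished_polynomial[OF reg] by blast
  define q where "q = monom 1 d - (\<Sum>i<d. monom (r i (\<lambda>i. 0)) i)"
  have "coeff q d = 1" by (simp add: q_def coeff_sum)
  then have "q \<noteq> 0" by auto
  then have "finite {x. poly q x = 0}" by (rule poly_roots_finite)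
  moreover have "{x. N x < 1 \<and> nsums (\<lambda>k. e k * x ^ k) 0} \<subseteq> {x. poly q x = 0}"
  proof safe
    fix x assume x: "N x < 1" "nsums (\<lambda>k. e k * x ^ k) 0"
    define t where "t = (\<lambda>i::nat. x)"
    have t: "t \<in> Delta" using x by (simp add: t_def Delta_def)
    have "F t = 0" using F[OF t] x(2) nsums_unique by (auto simp: t_def)
    then have "f1 t = 0" using f1 t by auto
    moreover have "r i t = r i (\<lambda>i. 0)" for i by (rule I_depends[OF E(2) t zero_in_Delta]) simp
    ultimately have "x ^ d = (\<Sum>i<d. r i (\<lambda>i. 0) * x ^ i)" using E(3)[OF t] by (simp add: t_def)
    then show "poly q x = 0" by (simp add: q_def poly_sum poly_monom)
  qed
  ultimately show ?thesis by (rule finite_subset[rotated])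
qed

text \<open>A diagonal construction: step \<open>i\<close> moves by at most
  \<open>r ^ (i + 1)\<close> and ends at distance at least \<open>r ^ (i + 1)\<close> from
  \<open>y i\<close>; all later moves are smaller, so the limit is not \<open>y i\<close>. If the
  current point is too close, a power of \<open>p\<close> is added, which stays in
  \<open>K\<close>.\<close>

lemma avoid_countable:
  assumes Y: "countable Y"
  shows "\<exists>x\<in>K. N x < 1 \<and> x \<notin> Y"
proof -
  define y where "y = from_nat_into (insert 0 Y)"
  have y: "Y \<subseteq> range y" unfolding y_def using range_from_nat_into[of "insert 0 Y"] Y by auto
  define r where "r = N (of_nat p)"
  have r: "0 < r" "r < 1" using p_pos N_p by (auto simp: r_def N_pos_iff)
  have Np: "N (of_nat p ^ k) = r ^ k" for k by (simp add: N_power r_def)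
  have pK: "of_nat p ^ k \<in> K" for k
    using subfield_of_Rats[OF K] by (intro K') auto
  have "\<exists>s. \<forall>i. (s i \<in> K \<and> (i = 0 \<longrightarrow> s i = 0)) \<and> (N (s (Suc i) - s i) \<le> r ^ Suc i \<and>
    N (s (Suc i) - y i) \<ge> r ^ Suc i)"
  proof (rule dependent_nat_choice)
    show "\<exists>x. x \<in> K \<and> ((0::nat) = 0 \<longrightarrow> x = 0)" using K' by auto
    fix x and i :: nat assume "x \<in> K \<and> (i = 0 \<longrightarrow> x = 0)"
    then have x: "x \<in> K" by simp
    show "\<exists>z. (z \<in> K \<and> (Suc i = 0 \<longrightarrow> z = 0)) \<and> (N (z - x) \<le> r ^ Suc i \<and> N (z - y i) \<ge> r ^ Suc i)"
    proof (cases "N (x - y i) \<ge> r ^ Suc i")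
      case True
      then show ?thesis using x r by (intro exI[of _ x]) auto
    next
      case False
      let ?z = "x + of_nat p ^ Suc i"
      have "N (?z - y i) = N ((x - y i) + of_nat p ^ Suc i)" by (simp add: algebra_simps)
      also have "\<dots> = r ^ Suc i" using False by (subst N_add_eq) (simp_all only: Np not_le)
      finally have "N (?z - y i) = r ^ Suc i" .
      moreover have "N (?z - x) = r ^ Suc i" by (simp only: add_diff_cancel_left' Np)
      moreover have "?z \<in> K" by (rule K'(3)[OF x pK])
      ultimately show ?thesis by (intro exI[of _ ?z]) simp
    qed
  qed
  then obtain s where s: "\<And>i. s i \<in> K" "\<And>i. N (s (Suc i) - s i) \<le> r ^ Suc i" "\<And>i. N (s (Suc i) - y i) \<ge> r ^ Suc i"
    "s 0 = 0" by blast
  have r0: "(\<lambda>i. r ^ Suc i) \<longlonglongrightarrow> 0" using r by (intro LIMSEQ_Suc LIMSEQ_realpow_zero) auto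
  have "\<exists>l. nsums (\<lambda>i. s (Suc i) - s i) l"
    by (rule nsums_exists, rule Lim_null_comparison[OF _ r0]) (use s N_nonneg in auto)
  then obtain l where l: "nsums (\<lambda>i. s (Suc i) - s i) l" by blast
  have tele: "(\<Sum>i<m. s (Suc i) - s i) = s m - s 0" for m by (rule sum_lessThan_telescope)
  have tail: "N (s m - l) \<le> r ^ Suc m" for m
  proof -
    have "N ((\<Sum>i<m. s (Suc i) - s i) - l) \<le> r ^ Suc m"
    proof (rule nsums_tail_bound[OF l])
      fix k assume "m \<le> k"
      then have "r ^ Suc k \<le> r ^ Suc m" using r by (intro power_decreasing) auto
      then show "N (s (Suc k) - s k) \<le> r ^ Suc m" using s(2)[of k] by simp
    qed (use r in auto)
    then show ?thesis by (simp add: tele s(4))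
  qed
  have "l \<in> K"
  proof (rule K_closed[of s])
    show "nlim s l" by (rule nlimI[OF r0 tail])
  qed (rule s)
  moreover have "N l < 1" using tail[of 0] r s(4) by simp
  moreover have "l \<noteq> y i" for i
  proof
    assume "l = y i"
    then have "N (s (Suc i) - y i) \<le> r ^ Suc (Suc i)" using tail[of "Suc i"] by simp
    moreover have "r ^ Suc (Suc i) < r ^ Suc i" using r by simp
    ultimately show False using s(3)[of i] by linarith
  qed
  ultimately show ?thesis using y by blast
qed

end

text \<open>Each series lives over one closed discretely valued field, but a set of series may need
  many of them. \<open>K0\<close> lies in every member and supplies points at which a series can be
  evaluated inside its own field.\<close>

locale power_series_family = nonarch_field N p for N :: "'a::field_char_0 \<Rightarrow> real" and p +
  fixes \<K> :: "'a set set" and K0 :: "'a set"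
  assumes family_discrete: "K \<in> \<K> \<Longrightarrow> \<exists>\<theta>. discrete_subfield K \<theta>"
    and family_directed: "K \<in> \<K> \<Longrightarrow> K' \<in> \<K> \<Longrightarrow> \<exists>K''\<in>\<K>. K \<union> K' \<subseteq> K''"
    and K0: "K0 \<in> \<K>" "K \<in> \<K> \<Longrightarrow> K0 \<subseteq> K"
    and alg_closed: "degree (q :: 'a poly) \<ge> 1 \<Longrightarrow> \<exists>x. poly q x = 0"
begin

text \<open>The value \<open>1/2\<close> is a placeholder: level 0 of the filtration does not depend
  on \<open>\<theta>\<close>.\<close>

definition B :: "nat \<Rightarrow> ((nat \<Rightarrow> 'a) \<Rightarrow> 'a) set" where
  "B n = (\<Union>K\<in>\<K>. Filt K (1/2) n 0)"

lemma B_I: "f \<in> Filt K \<theta> n 0 \<Longrightarrow> K \<in> \<K> \<Longrightarrow> f \<in> B n"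
  unfolding B_def using Filt_0_cong_theta by blast

lemma ring_instance: "K \<in> \<K> \<Longrightarrow> \<exists>\<theta>. power_series_ring N p K \<theta>"
  using family_discrete nonarch_field_axioms unfolding power_series_ring_def power_series_ring_axioms_def by blast

lemma B_E2:
  assumes "f \<in> B n" "g \<in> B m"
  obtains K \<theta> where "K \<in> \<K>" "power_series_ring N p K \<theta>" "f \<in> Filt K \<theta> n 0" "g \<in> Filt K \<theta> m 0"
proof -
  obtain K1 K2 where K12: "K1 \<in> \<K>" "K2 \<in> \<K>" "f \<in> Filt K1 (1/2) n 0" "g \<in> Filt K2 (1/2) m 0"
    using assms by (auto simp: B_def)
  then obtain K where K: "K \<in> \<K>" "K1 \<union> K2 \<subseteq> K" using family_directed by blast
  obtain \<theta> where "power_series_ring N p K \<theta>" using ring_instance K by blast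
  moreover have "f \<in> Filt K \<theta> n 0" "g \<in> Filt K \<theta> m 0"
    using K12 Filt_0_mono[of K1 K] Filt_0_mono[of K2 K] K Filt_0_cong_theta by blast+
  ultimately show ?thesis using that K by blast
qed

lemma B_E:
  assumes "f \<in> B n"
  obtains K \<theta> where "K \<in> \<K>" "power_series_ring N p K \<theta>" "f \<in> Filt K \<theta> n 0"
  using B_E2[OF assms assms] that by blast

lemma B_const: "K \<in> \<K> \<Longrightarrow> x \<in> K \<Longrightarrow> N x \<le> 1 \<Longrightarrow> (\<lambda>t. x) \<in> B n"
  using ring_instance[of K] power_series_ring.I_const[of N p K _ x 0 n] B_I by fastforce

lemma subring_of_B: "subring_of (B n)"
  unfolding subring_of_def
proof (intro conjI ballI)
  obtain \<theta> where R: "power_series_ring N p K0 \<theta>" using ring_instance K0 by blast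
  show "0 \<in> B n" "1 \<in> B n"
    using power_series_ring.I_0[OF R, of n 0] power_series_ring.I_1[OF R, of n] B_I K0
    by (auto simp: zero_fun_def one_fun_def)
next
  fix f g assume "f \<in> B n" "g \<in> B n"
  then obtain K \<theta> where 1: "K \<in> \<K>" "power_series_ring N p K \<theta>" "f \<in> Filt K \<theta> n 0" "g \<in> Filt K \<theta> n 0"
    by (rule B_E2)
  interpret power_series_ring N p K \<theta> by (rule 1(2))
  show "f + g \<in> B n" "f - g \<in> B n" "f * g \<in> B n"
    using I_add[OF 1(3,4)] I_diff[OF 1(3,4)] I_mult[OF 1(3,4)] B_I[OF _ 1(1)]
    by (auto simp: plus_fun_def times_fun_def fun_diff_def)
qed

lemmas B_ring = subring_ofD[OF subring_of_B]

lemma B_Suc: "f \<in> B n \<Longrightarrow> f \<in> B (Suc n)"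
proof -
  assume "f \<in> B n"
  then obtain K \<theta> where K: "K \<in> \<K>" "power_series_ring N p K \<theta>" "f \<in> Filt K \<theta> n 0" by (rule B_E) (rule that)
  then show ?thesis using power_series_ring.I_Suc B_I by blast
qed

lemma B_var: "i < n \<Longrightarrow> (\<lambda>t. t i) \<in> B n"
proof -
  assume i: "i < n"
  obtain \<theta> where R: "power_series_ring N p K0 \<theta>" using ring_instance K0 by blast
  show ?thesis
    using power_series_ring.I_antimono[OF R power_series_ring.I_var[OF R i]] B_I[OF _ K0(1)] by blast
qed

lemma B_shear:
  assumes M: "\<And>i. M i \<ge> 1" and f: "f \<in> B (Suc n)"
  shows "(\<lambda>t. f (shear M n t)) \<in> B (Suc n)" "(\<lambda>t. f (unshear M n t)) \<in> B (Suc n)"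
proof -
  obtain K \<theta> where K: "K \<in> \<K>" "power_series_ring N p K \<theta>" "f \<in> Filt K \<theta> (Suc n) 0" using f
    by (rule B_E) (rule that)
  interpret R: power_series_ring N p K \<theta> by (rule K(2))
  show "(\<lambda>t. f (shear M n t)) \<in> B (Suc n)"
    by (rule B_I[OF R.I_compose_shear[OF _ K(3)] K(1)]) (rule M)
  show "(\<lambda>t. f (unshear M n t)) \<in> B (Suc n)"
    by (rule B_I[OF R.I_compose_unshear[OF _ K(3)] K(1)]) (rule M)
qed

lemma B_depends: "f \<in> B n \<Longrightarrow> t \<in> Delta \<Longrightarrow> t' \<in> Delta \<Longrightarrow> (\<And>i. i < n \<Longrightarrow> t i = t' i) \<Longrightarrow> f t = f t'"
  by (erule B_E) (rule power_series_ring.I_depends)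

text \<open>Each series has a coefficient that is not identically zero; where all these coefficients
  are nonzero, each series has finitely many zeros in the last variable. Coordinates in
  \<open>K0\<close> keep the specialised coefficients in the field of the series.\<close>

lemma avoid_zeros:
  assumes "countable X" "X \<subseteq> B n" "\<And>g. g \<in> X \<Longrightarrow> \<exists>t\<in>Delta. g t \<noteq> 0"
  shows "\<exists>t\<in>Delta. (\<forall>i. t i \<in> K0) \<and> (\<forall>g\<in>X. g t \<noteq> 0)"
  using assms
proof (induction n arbitrary: X)
  case 0
  have "g (\<lambda>i. 0) \<noteq> 0" if g: "g \<in> X" for g
  proof -
    obtain t where "t \<in> Delta" "g t \<noteq> 0" using 0(3)[OF g] by blast
    then show ?thesis using B_depends[of g 0 t "\<lambda>i. 0"] zero_in_Delta 0(2) g by auto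
  qed
  moreover have "0 \<in> K0" using ring_instance[OF K0(1)] power_series_ring.K'(1) by blast
  ultimately show ?case using zero_in_Delta by (intro bexI[of _ "\<lambda>i. 0"]) auto
next
  case (Suc n)
  define Q where "Q g c k K \<theta> \<longleftrightarrow> K \<in> \<K> \<and> power_series_ring N p K \<theta> \<and> (\<forall>k. c k \<in> Filt K \<theta> n 0) \<and>
      (\<forall>t\<in>Delta. nsums (\<lambda>k. c k t * t n ^ k) (g t)) \<and> (\<exists>t\<in>Delta. c k t \<noteq> 0)" for g c k K \<theta>
  have "\<exists>c k K \<theta>. Q g c k K \<theta>" if g: "g \<in> X" for g
  proof -
    have "g \<in> B (Suc n)" using g Suc.prems by auto
    then obtain K \<theta> where K: "K \<in> \<K>" "power_series_ring N p K \<theta>" "g \<in> Filt K \<theta> (Suc n) 0" by (rule B_E) (rule that)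
    then obtain c where c: "\<forall>k. c k \<in> Filt K \<theta> n 0" "\<forall>t\<in>Delta. nsums (\<lambda>k. c k t * t n ^ k) (g t)" by auto
    have "\<exists>k. \<exists>t\<in>Delta. c k t \<noteq> 0"
    proof (rule ccontr)
      assume z: "\<not> ?thesis"
      have "g t = 0" if "t \<in> Delta" for t
        using c(2) z that nsums_unique[OF _ nsums_0, of "g t"] by auto
      then show False using Suc.prems(3)[OF g] by blast
    qed
    then obtain k where "\<exists>t\<in>Delta. c k t \<noteq> 0" by blast
    then show ?thesis using K c
      unfolding Q_def by (intro exI[of _ K] exI[of _ \<theta>] exI[of _ c] exI[of _ k]) simp
  qed
  then obtain c k Kf \<theta> where "\<And>g. g \<in> X \<Longrightarrow> Q g (c g) (k g) (Kf g) (\<theta> g)" by metis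
  then have c: "\<And>g. g \<in> X \<Longrightarrow> Kf g \<in> \<K>" "\<And>g. g \<in> X \<Longrightarrow> power_series_ring N p (Kf g) (\<theta> g)"
    "\<And>g k. g \<in> X \<Longrightarrow> c g k \<in> Filt (Kf g) (\<theta> g) n 0"
    "\<And>g t. g \<in> X \<Longrightarrow> t \<in> Delta \<Longrightarrow> nsums (\<lambda>k. c g k t * t n ^ k) (g t)"
    "\<And>g. g \<in> X \<Longrightarrow> \<exists>t\<in>Delta. c g (k g) t \<noteq> 0" unfolding Q_def by simp_all
  have "\<exists>t\<in>Delta. (\<forall>i. t i \<in> K0) \<and> (\<forall>h\<in>(\<lambda>g. c g (k g)) ` X. h t \<noteq> 0)"
  proof (rule Suc.IH)
    show "countable ((\<lambda>g. c g (k g)) ` X)" using Suc.prems(1) by simp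
    show "(\<lambda>g. c g (k g)) ` X \<subseteq> B n" using B_I[OF c(3) c(1)] by blast
    show "\<exists>t\<in>Delta. h t \<noteq> 0" if "h \<in> (\<lambda>g. c g (k g)) ` X" for h using that c(5) by auto
  qed
  then obtain t where t: "t \<in> Delta" "\<And>i. t i \<in> K0" "\<And>g. g \<in> X \<Longrightarrow> c g (k g) t \<noteq> 0" by blast
  define Y where "Y = (\<Union>g\<in>X. {x. N x < 1 \<and> nsums (\<lambda>k. c g k t * x ^ k) 0})"
  have "countable {x. N x < 1 \<and> nsums (\<lambda>k. c g k t * x ^ k) 0}" if g: "g \<in> X" for g
  proof -
    interpret power_series_ring N p "Kf g" "\<theta> g" by (rule c(2)[OF g])
    show ?thesis
    proof (rule countable_finite, rule finite_zeros[where e = "\<lambda>k. c g k t"])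
      show "c g k t \<in> Kf g" for k
        by (rule I_value_in_K[OF c(3)[OF g] t(1)]) (use t(2) K0(2) c(1)[OF g] in blast)
      show "N (c g k t) \<le> 1" for k by (rule I_bound_1[OF t(1) c(3)[OF g]])
      show "c g (k g) t \<noteq> 0" by (rule t(3)[OF g])
    qed
  qed
  then have "countable Y" unfolding Y_def using Suc.prems(1) by blast
  then obtain x where x: "x \<in> K0" "N x < 1" "x \<notin> Y"
    using ring_instance[OF K0(1)] power_series_ring.avoid_countable by blast
  define t' where "t' = t(n := x)"
  have t': "t' \<in> Delta" using t(1) x by (simp add: t'_def Delta_def)
  have "g t' \<noteq> 0" if g: "g \<in> X" for g
  proof
    assume "g t' = 0"
    moreover have "c g k t' = c g k t" for k
      by (rule power_series_ring.I_depends[OF c(2)[OF g] c(3)[OF g] t' t(1)]) (simp add: t'_def)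
    ultimately have "nsums (\<lambda>k. c g k t * x ^ k) 0" using c(4)[OF g t'] by (simp add: t'_def)
    then show False using x g unfolding Y_def by blast
  qed
  moreover have "t' i \<in> K0" for i using t(2) x(1) by (simp add: t'_def)
  ultimately show ?case using t' by (intro bexI[of _ t']) simp_all
qed

text \<open>Elements of \<open>B n\<close> are functions with arbitrary values off
  \<open>Delta\<close>, so those vanishing on \<open>Delta\<close> have to be put into the ideal.
  The constant \<open>p\<close> is excluded because an ideal containing it has no point.\<close>

definition good_prime :: "nat \<Rightarrow> ((nat \<Rightarrow> 'a) \<Rightarrow> 'a) set \<Rightarrow> bool" where
  "good_prime n J \<longleftrightarrow> prime_ideal_on (B n) J \<and> (\<forall>f\<in>B n. (\<forall>t\<in>Delta. f t = 0) \<longrightarrow> f \<in> J) \<and>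
     (\<lambda>t. of_nat p) \<notin> J"

lemma good_primeD:
  assumes "good_prime n J"
  shows "J \<subseteq> B n" "0 \<in> J" "f \<in> J \<Longrightarrow> g \<in> J \<Longrightarrow> f + g \<in> J" "f \<in> B n \<Longrightarrow> g \<in> J \<Longrightarrow> f * g \<in> J"
    "f \<in> B n \<Longrightarrow> g \<in> B n \<Longrightarrow> f * g \<in> J \<Longrightarrow> f \<in> J \<or> g \<in> J" "1 \<notin> J"
    "f \<in> B n \<Longrightarrow> (\<And>t. t \<in> Delta \<Longrightarrow> f t = 0) \<Longrightarrow> f \<in> J" "(\<lambda>t. of_nat p) \<notin> J"
  using assms by (auto simp: good_prime_def prime_ideal_on_def)

lemma good_prime_cong:
  assumes J: "good_prime n J" and "f \<in> J" "g \<in> B n" "\<And>t. t \<in> Delta \<Longrightarrow> g t = f t"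
  shows "g \<in> J"
proof -
  have "f \<in> B n" using good_primeD(1)[OF J] assms by auto
  then have "g - f \<in> J" using assms by (intro good_primeD(7)[OF J] B_ring) auto
  then have "(g - f) + f \<in> J" using assms by (intro good_primeD(3)[OF J])
  then show ?thesis by simp
qed

text \<open>A nonzero integral constant divides a power of \<open>p\<close> in the ring, so it
  cannot lie in a prime ideal avoiding \<open>p\<close>.\<close>

lemma good_prime_const:
  assumes J: "good_prime n J" and KK: "K \<in> \<K>" "\<gamma> \<in> K" "\<gamma> \<noteq> 0" "N \<gamma> \<le> 1"
  shows "(\<lambda>t. \<gamma>) \<notin> J"
proof
  assume \<gamma>: "(\<lambda>t. \<gamma>) \<in> J"
  obtain \<theta> where "power_series_ring N p K \<theta>" using ring_instance KK by blast
  then interpret power_series_ring N p K \<theta> .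
  obtain k where k: "N (of_nat p ^ k) < N \<gamma>" using small_element[of "N \<gamma>"] KK by (auto simp: N_pos_iff)
  have pK: "of_nat p \<in> K" using subfield_of_Rats[OF K] by auto
  have "of_nat p ^ k / \<gamma> \<in> K" using pK KK by (intro K')
  moreover have "N (of_nat p ^ k / \<gamma>) \<le> 1" using k KK by (simp add: N_divide N_pos_iff)
  ultimately have "(\<lambda>t. of_nat p ^ k / \<gamma>) * (\<lambda>t. \<gamma>) \<in> J"
    using B_const KK(1) \<gamma> by (intro good_primeD(4)[OF J])
  then have pk: "(\<lambda>t. of_nat p ^ k) \<in> J" using KK by (simp add: times_fun_def)
  have pB: "(\<lambda>t. of_nat p ^ k) \<in> B n" for k
    using pK KK(1) N_p by (intro B_const) (auto simp: N_power N_nonneg power_le_one intro: K')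
  have "(\<lambda>t. of_nat p ^ k) \<notin> J" for k
  proof (induction k)
    case 0
    then show ?case using good_primeD(6)[OF J] by (simp add: one_fun_def)
  next
    case (Suc k)
    then show ?case
      using good_primeD(5)[OF J pB[of 1] pB[of k]] good_primeD(8)[OF J] by (auto simp: times_fun_def)
  qed
  then show False using pk by blast
qed

lemma poly_fun_apply: "poly h F t = eval_via (\<lambda>a. a t) h (F t)"
  for h :: "((nat \<Rightarrow> 'a) \<Rightarrow> 'a) poly"
  by (induction h) (auto simp: map_poly_pCons)

lemma sum_fun_apply: "(\<Sum>i\<in>A. f i) t = (\<Sum>i\<in>A. f i t)" for f :: "'i \<Rightarrow> 'x \<Rightarrow> 'y::comm_monoid_add"
  by (induction A rule: infinite_finite_induct) auto

lemma power_fun_apply: "(f ^ k) t = f t ^ k" for f :: "'x \<Rightarrow> 'y::monoid_mult"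
  by (induction k) auto

lemma regular_extend:
  assumes reg: "power_series_ring.regular N K \<theta> n d f c" and R: "power_series_ring N p K \<theta>"
    and R': "power_series_ring N p K' \<theta>'" and sub: "K \<subseteq> K'"
  shows "power_series_ring.regular N K' \<theta>' n d f c"
proof -
  have "Filt K \<theta> n 0 \<subseteq> Filt K' \<theta>' n 0" using Filt_0_mono[OF sub] Filt_0_cong_theta by blast
  then show ?thesis using reg
    unfolding power_series_ring.regular_def[OF R] power_series_ring.regular_def[OF R'] by blast
qed

text \<open>By Weierstrass division, the quotient by \<open>J\<close> is generated by the last coordinate over the series in
  the other variables, so that \<open>hom_extension\<close> lifts points.\<close>

lemma point_of_prime_step:
  assumes IH: "\<And>J X. good_prime n J \<Longrightarrow> countable X \<Longrightarrow> X \<subseteq> B n \<Longrightarrow> X \<inter> J = {} \<Longrightarrow>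
      \<exists>t\<in>Delta. (\<forall>f\<in>J. f t = 0) \<and> (\<forall>g\<in>X. g t \<noteq> 0)"
    and J: "good_prime (Suc n) J" and X: "countable X" "X \<subseteq> B (Suc n)" "X \<inter> J = {}"
    and K: "K \<in> \<K>" "power_series_ring N p K \<theta>"
    and f: "f \<in> J" "power_series_ring.regular N K \<theta> n d f c"
  shows "\<exists>t\<in>Delta. (\<forall>f\<in>J. f t = 0) \<and> (\<forall>g\<in>X. g t \<noteq> 0)"
proof -
  note JD = good_primeD[OF J]
  define Xn where "Xn = (\<lambda>t::nat\<Rightarrow>'a. t n)"
  \<comment> \<open>The polynomial relations that the last coordinate satisfies modulo
    \<open>J\<close>, with coefficients among the series in the other variables.\<close>
  define P where "P = {h \<in> polys_over (B n). poly h Xn \<in> J}"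
  have XnB: "Xn \<in> B (Suc n)" unfolding Xn_def by (rule B_var) simp
  have poly_B: "poly h Xn \<in> B (Suc n)" if "h \<in> polys_over (B n)" for h
    using that by (induction h) (auto simp: polys_over_pCons intro: B_ring B_Suc XnB)
  note polys_B = subring_ofD[OF subring_of_polys_over[OF subring_of_B]]
  interpret P: poly_prime "B n" P
  proof unfold_locales
    show "f \<in> P \<or> g \<in> P" if "f \<in> polys_over (B n)" "g \<in> polys_over (B n)" "f * g \<in> P" for f g
      using that JD(5)[of "poly f Xn" "poly g Xn"] poly_B by (auto simp: P_def)
    show "1 \<notin> P" using JD(6) by (simp add: P_def)
  qed (auto simp: P_def subring_of_B intro: JD polys_B poly_B)
  have PJ: "P.J = B n \<inter> J"
    unfolding P.J_def using B_ring(1) by (auto simp: P_def polys_over_pCons polys_B(1))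
  have J0: "good_prime n P.J"
    unfolding good_prime_def prime_ideal_on_def PJ
    using JD B_ring B_Suc by (auto simp: subset_iff)
  have ev: "poly h Xn t = eval_via (\<lambda>a. a t) h (t n)" for h t by (simp add: poly_fun_apply Xn_def)
  obtain E r where E: "E \<in> Filt K \<theta> (Suc n) 0" "\<And>t. t \<in> Delta \<Longrightarrow> E t \<noteq> 0" "\<And>i. r i \<in> Filt K \<theta> n 1"
    "\<And>t. t \<in> Delta \<Longrightarrow> t n ^ d = E t * f t + (\<Sum>i<d. r i t * t n ^ i)"
    using power_series_ring.distinguished_polynomial[OF K(2) f(2)] by blast
  have EB: "E \<in> B (Suc n)" by (rule B_I[OF E(1) K(1)])
  have rB: "r i \<in> B n" for i
    using power_series_ring.I_antimono[OF K(2) E(3), of 0] by (intro B_I[OF _ K(1)]) simp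
  have fB: "f \<in> B (Suc n)" using f(1) JD(1) by auto
  have sum_polys: "(\<Sum>i<d. monom (s i) i) \<in> polys_over (B n)" if "\<And>i. s i \<in> B n" for s
    using that by (intro subring_of_sum[OF subring_of_polys_over[OF subring_of_B]] polys_over_monom B_ring)
  have poly_sum': "poly (\<Sum>i<d. monom (s i) i) Xn t = (\<Sum>i<d. s i t * t n ^ i)" for s t
    by (simp add: poly_sum poly_monom sum_fun_apply power_fun_apply Xn_def)
  \<comment> \<open>The distinguished polynomial of \<open>f\<close>. Being monic, it shows that
    \<open>P\<close> is not contained in the polynomials over \<open>P.J\<close>.\<close>
  define w where "w = monom 1 d - (\<Sum>i<d. monom (r i) i)"
  have w_polys: "w \<in> polys_over (B n)" unfolding w_def
    by (intro polys_B(4) sum_polys rB polys_over_monom B_ring)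
  have w_eval: "poly w Xn t = t n ^ d - (\<Sum>i<d. r i t * t n ^ i)" for t
    by (simp add: w_def poly_sum' poly_monom power_fun_apply) (simp add: Xn_def)
  have "poly w Xn \<in> J"
    by (rule good_prime_cong[OF J JD(4)[OF EB f(1)] poly_B[OF w_polys]]) (use E(4) in \<open>simp add: w_eval\<close>)
  then have wP: "w \<in> P" using w_polys by (simp add: P_def)
  have "coeff w d = 1" by (simp add: w_def coeff_sum)
  then have "w \<notin> polys_over P.J" using P.J_1 by (auto simp: polys_over_def intro!: exI[of _ d])
  then have "\<not> P \<subseteq> polys_over P.J" using wP by blast
  from P.hom_extension[where ?'b = 'a, OF this] obtain m where m: "m\<in>P" "degree m \<ge> 1"
      "lead_coeff m \<in> B n" "lead_coeff m \<notin> P.J"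
    and ext: "\<forall>(\<phi> :: ((nat \<Rightarrow> 'a) \<Rightarrow> 'a) \<Rightarrow> 'a) \<tau>. ring_hom_on (B n) \<phi> \<longrightarrow> \<phi> ` P.J \<subseteq> {0} \<longrightarrow> \<phi> (lead_coeff m) \<noteq> 0 \<longrightarrow>
        eval_via \<phi> m \<tau> = 0 \<longrightarrow> (\<forall>h\<in>P. eval_via \<phi> h \<tau> = 0)"
    and nz: "\<forall>r\<in>polys_over (B n) - P. \<exists>N\<in>B n - P.J. \<forall>(\<phi> :: ((nat \<Rightarrow> 'a) \<Rightarrow> 'a) \<Rightarrow> 'a) \<tau>. ring_hom_on (B n) \<phi> \<longrightarrow>
        (\<forall>h\<in>P. eval_via \<phi> h \<tau> = 0) \<longrightarrow> \<phi> N \<noteq> 0 \<longrightarrow> eval_via \<phi> r \<tau> \<noteq> 0"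
    by - (elim bexE conjE, rule that, assumption+)
  \<comment> \<open>\<open>f\<close> is regular over \<open>K\<close>, while \<open>g\<close> may
    need another field; both are moved to a common larger member of the family before
    dividing.\<close>
  have divB: "\<exists>s\<in>polys_over (B n). \<exists>q\<in>B (Suc n). \<forall>t\<in>Delta. g t = q t * f t + poly s Xn t" if g:
    "g \<in> B (Suc n)" for g
  proof -
    obtain K1 \<theta>1 where 1: "K1 \<in> \<K>" "power_series_ring N p K1 \<theta>1" "g \<in> Filt K1 \<theta>1 (Suc n) 0"
      using g by (rule B_E) (rule that)
    obtain K2 where 2: "K2 \<in> \<K>" "K \<union> K1 \<subseteq> K2" using family_directed[OF K(1) 1(1)] by blast
    obtain \<theta>2 where R2: "power_series_ring N p K2 \<theta>2" using ring_instance[OF 2(1)] by blast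
    have reg: "power_series_ring.regular N K2 \<theta>2 n d f c"
      by (rule regular_extend[OF f(2) K(2) R2]) (use 2 in auto)
    have "g \<in> Filt K2 \<theta>2 (Suc n) 0"
      using 1(3) Filt_0_mono[of K1 K2] Filt_0_cong_theta 2(2) by blast
    then have "g \<in> power_series_ring.G N K2 \<theta>2 n 0" by (simp add: power_series_ring.G_0[OF R2])
    from power_series_ring.division[OF R2 reg this] obtain q s where qs: "q \<in> Filt K2 \<theta>2 (Suc n) 0"
      "\<And>i. s i \<in> Filt K2 \<theta>2 n 0" "\<And>t. t \<in> Delta \<Longrightarrow> g t = q t * f t + (\<Sum>i<d. s i t * t n ^ i)" by blast
    have "s i \<in> B n" for i by (rule B_I[OF qs(2) 2(1)])
    then show ?thesis using qs(3) B_I[OF qs(1) 2(1)]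
      by (intro bexI[of _ "\<Sum>i<d. monom (s i) i"] bexI[of _ q] sum_polys) (simp_all add: poly_sum')
  qed
  have rem_P: "s \<in> P \<longleftrightarrow> g \<in> J"
    if g: "g \<in> B (Suc n)" and s: "s \<in> polys_over (B n)" "q \<in> B (Suc n)"
      "\<forall>t\<in>Delta. g t = q t * f t + poly s Xn t" for g s q
  proof
    assume "s \<in> P"
    then have "q * f + poly s Xn \<in> J" using s f(1) by (auto simp: P_def intro: JD)
    then show "g \<in> J" by (rule good_prime_cong[OF J _ g]) (use s in simp)
  next
    assume gJ: "g \<in> J"
    have "g + (- q) * f \<in> J" using gJ s f(1) B_ring by (intro JD(3,4)) auto
    then have "poly s Xn \<in> J" by (rule good_prime_cong[OF J _ poly_B[OF s(1)]]) (use s in simp)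
    then show "s \<in> P" using s by (simp add: P_def)
  qed
  have "\<exists>s q. s \<in> polys_over (B n) \<and> q \<in> B (Suc n) \<and> (\<forall>t\<in>Delta. g t = q t * f t + poly s Xn t)" if "g \<in> X" for g
    using divB[of g] X(2) that by blast
  then obtain s q where sq: "\<And>g. g \<in> X \<Longrightarrow> s g \<in> polys_over (B n)" "\<And>g. g \<in> X \<Longrightarrow> q g \<in> B (Suc n)"
    "\<And>g t. g \<in> X \<Longrightarrow> t \<in> Delta \<Longrightarrow> g t = q g t * f t + poly (s g) Xn t" by metis
  have "s g \<notin> P" if "g \<in> X" for g
    using rem_P[of g "s g" "q g"] sq that X by blast
  then have "\<exists>M. M \<in> B n - P.J \<and> (\<forall>(\<phi> :: ((nat \<Rightarrow> 'a) \<Rightarrow> 'a) \<Rightarrow> 'a) \<tau>. ring_hom_on (B n) \<phi> \<longrightarrow>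
        (\<forall>h\<in>P. eval_via \<phi> h \<tau> = 0) \<longrightarrow> \<phi> M \<noteq> 0 \<longrightarrow> eval_via \<phi> (s g) \<tau> \<noteq> 0)" if "g \<in> X" for g
    using nz[rule_format, of "s g"] sq(1)[OF that] that by blast
  then obtain M where M: "\<And>g. g \<in> X \<Longrightarrow> M g \<in> B n - P.J"
    "\<And>g (\<phi> :: ((nat \<Rightarrow> 'a) \<Rightarrow> 'a) \<Rightarrow> 'a) \<tau>. g \<in> X \<Longrightarrow> ring_hom_on (B n) \<phi> \<Longrightarrow>
        (\<forall>h\<in>P. eval_via \<phi> h \<tau> = 0) \<Longrightarrow> \<phi> (M g) \<noteq> 0 \<Longrightarrow> eval_via \<phi> (s g) \<tau> \<noteq> 0" by metis
  \<comment> \<open>The induction hypothesis is applied to the contracted prime. The series to be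
    kept nonzero are the leading coefficient of \<open>m\<close> and one \<open>M g\<close> for each
    \<open>g\<close> in \<open>X\<close>, still countably many.\<close>
  have "\<exists>t\<in>Delta. (\<forall>f\<in>P.J. f t = 0) \<and> (\<forall>g\<in>insert (lead_coeff m) (M ` X). g t \<noteq> 0)"
    using X(1) M(1) m(3,4) by (intro IH[OF J0]) auto
  then obtain t where t: "t \<in> Delta" "\<And>f. f \<in> P.J \<Longrightarrow> f t = 0" "lead_coeff m t \<noteq> 0" "\<And>g. g \<in> X \<Longrightarrow> M g t \<noteq> 0"
    by blast
  define \<phi> where "\<phi> = (\<lambda>a :: (nat \<Rightarrow> 'a) \<Rightarrow> 'a. a t)"
  have \<phi>: "ring_hom_on (B n) \<phi>" by (simp add: ring_hom_on_def \<phi>_def)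
  have "coeff (map_poly \<phi> m) (degree m) \<noteq> 0" using t(3) by (simp add: coeff_map_poly \<phi>_def)
  then have "degree (map_poly \<phi> m) \<ge> 1" using m(2) le_degree order.trans by blast
  then obtain \<tau> where \<tau>: "eval_via \<phi> m \<tau> = 0" using alg_closed by blast
  have P0: "eval_via \<phi> h \<tau> = 0" if "h \<in> P" for h
    using ext[rule_format, of \<phi> \<tau> h] \<phi> \<tau> that t(2,3) by (auto simp: \<phi>_def)
  \<comment> \<open>The new coordinate is a root of the specialised \<open>w\<close>, whose lower
    coefficients have norm at most \<open>\<rho> < 1\<close>. At a root of norm at least 1 the
    leading term would dominate.\<close>
  have N\<tau>: "N \<tau> < 1"
  proof (rule ccontr)
    assume "\<not> N \<tau> < 1"
    then have ge: "1 \<le> N \<tau>" by simp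
    define \<rho> where "\<rho> = power_series_ring.rho N \<theta> n t"
    have \<rho>: "0 < \<rho>" "\<rho> < 1" using power_series_ring.rho_bounds(3,4)[OF K(2)] t(1) by (auto simp: \<rho>_def)
    have "eval_via \<phi> w \<tau> = \<tau> ^ d - (\<Sum>i<d. r i t * \<tau> ^ i)"
      using poly_fun_apply[of w "\<lambda>_. \<tau>" t] by (simp add: \<phi>_def w_def poly_sum poly_monom sum_fun_apply
        power_fun_apply fun_diff_def)
    then have "\<tau> ^ d = (\<Sum>i<d. r i t * \<tau> ^ i)" using P0[OF wP] by simp
    moreover have "N (\<Sum>i<d. r i t * \<tau> ^ i) \<le> \<rho> * N \<tau> ^ d"
    proof (rule N_sum)
      fix i assume "i \<in> {..<d}"
      then have "N \<tau> ^ i \<le> N \<tau> ^ d" using ge by (intro power_increasing) auto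
      moreover have "N (r i t) \<le> \<rho>" using power_series_ring.I_bound_rho[OF K(2) t(1) E(3)] by (simp add: \<rho>_def)
      ultimately show "N (r i t * \<tau> ^ i) \<le> \<rho> * N \<tau> ^ d"
        using \<rho> by (simp add: N_mult N_power N_nonneg mult_mono)
    qed (use \<rho> N_nonneg in simp)
    ultimately have "N \<tau> ^ d \<le> \<rho> * N \<tau> ^ d" by (simp add: N_power[symmetric])
    moreover have "0 < N \<tau> ^ d" using ge by simp
    ultimately show False using \<rho> by simp
  qed
  define t' where "t' = t(n := \<tau>)"
  have t': "t' \<in> Delta" using t(1) N\<tau> by (simp add: t'_def Delta_def)
  have poly_t': "poly h Xn t' = eval_via \<phi> h \<tau>" if "h \<in> polys_over (B n)" for h
    using that
  proof (induction h)
    case (pCons a h)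
    have "a t' = a t"
    proof (rule B_depends[of a n t' t, OF _ t' t(1)])
      show "a \<in> B n" using pCons.prems by (simp add: polys_over_pCons)
    qed (simp add: t'_def)
    moreover have "Xn t' = \<tau>" by (simp add: Xn_def t'_def)
    ultimately show ?case using pCons by (simp add: polys_over_pCons map_poly_pCons \<phi>_def)
  qed simp
  have "E t' * f t' = 0"
    using P0[OF wP] poly_t'[OF w_polys] E(4)[OF t'] by (simp add: w_eval)
  then have f0: "f t' = 0" using E(2)[OF t'] by simp
  have "h t' = 0" if h: "h \<in> J" for h
  proof -
    have hB: "h \<in> B (Suc n)" using h JD(1) by auto
    obtain s q where s: "s \<in> polys_over (B n)" "q \<in> B (Suc n)" "\<forall>t\<in>Delta. h t = q t * f t + poly s Xn t"
      using divB[OF hB] by blast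
    then have "s \<in> P" using rem_P[OF hB s] h by simp
    then show ?thesis using s(3) t' f0 poly_t'[OF s(1)] P0 by simp
  qed
  moreover have "g t' \<noteq> 0" if g: "g \<in> X" for g
    using sq(3)[OF g t'] f0 poly_t'[OF sq(1)[OF g]] M(2)[OF g \<phi>, of \<tau>] P0 t(4)[OF g] by (simp add: \<phi>_def)
  ultimately show ?thesis using t' by blast
qed

text \<open>If \<open>J\<close> contains only functions vanishing on \<open>Delta\<close>, countable
  avoidance gives the point. Otherwise a nonzero member is divided by its content, a constant
  outside \<open>J\<close>, and a shear makes it regular; the step applies to the sheared
  prime.\<close>

theorem point_of_prime:
  "good_prime n J \<Longrightarrow> countable X \<Longrightarrow> X \<subseteq> B n \<Longrightarrow> X \<inter> J = {} \<Longrightarrow>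
    \<exists>t\<in>Delta. (\<forall>f\<in>J. f t = 0) \<and> (\<forall>g\<in>X. g t \<noteq> 0)"
proof (induction n arbitrary: J X)
  case 0
  note JD = good_primeD[OF 0(1)]
  have const: "f t = f (\<lambda>i. 0)" if "f \<in> B 0" "t \<in> Delta" for f t
    by (rule B_depends[OF that(1,2) zero_in_Delta]) simp
  have "f (\<lambda>i. 0) = 0" if f: "f \<in> J" for f
  proof (rule ccontr)
    assume nz: "f (\<lambda>i. 0) \<noteq> 0"
    have fB: "f \<in> B 0" using f JD(1) by auto
    then obtain K \<theta> where K: "K \<in> \<K>" "power_series_ring N p K \<theta>" "f \<in> Filt K \<theta> 0 0" by (rule B_E) (rule that)
    then have fK: "f (\<lambda>i. 0) \<in> K" "N (f (\<lambda>i. 0)) \<le> 1"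
      using power_series_ring.I_value_in_K[OF K(2,3) zero_in_Delta] power_series_ring.I_bound_1[OF K(2)
        zero_in_Delta K(3)] by auto
    have "(\<lambda>t. f (\<lambda>i. 0)) \<in> J"
      by (rule good_prime_cong[OF 0(1) f B_const[OF K(1) fK]]) (use const[OF fB] in simp)
    then show False using good_prime_const[OF 0(1) K(1) fK(1) nz fK(2)] by simp
  qed
  moreover have "g (\<lambda>i. 0) \<noteq> 0" if g: "g \<in> X" for g
  proof
    assume "g (\<lambda>i. 0) = 0"
    then have "g \<in> J" using const[of g] 0(3) g by (intro JD(7)) auto
    then show False using 0(4) g by auto
  qed
  ultimately show ?case using zero_in_Delta by blast
next
  case (Suc n)
  note JD = good_primeD[OF Suc.prems(1)]
  show ?case
  proof (cases "\<forall>f\<in>J. \<forall>t\<in>Delta. f t = 0")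
    case True
    have "\<exists>t\<in>Delta. g t \<noteq> 0" if "g \<in> X" for g
      using JD(7)[of g] Suc.prems(3,4) that by blast
    then obtain t where "t \<in> Delta" "\<forall>g\<in>X. g t \<noteq> 0"
      using avoid_zeros[OF Suc.prems(2,3)] by blast
    then show ?thesis using True by blast
  next
    case False
    then obtain f where f: "f \<in> J" "\<not> (\<forall>t\<in>Delta. f t = 0)" by blast
    have "f \<in> B (Suc n)" using f(1) JD(1) by auto
    then obtain K \<theta> where K: "K \<in> \<K>" "power_series_ring N p K \<theta>" "f \<in> Filt K \<theta> (Suc n) 0" by (rule B_E) (rule that)
    obtain \<gamma> f1 M D b where f1: "\<gamma> \<in> K" "\<gamma> \<noteq> 0" "N \<gamma> \<le> 1" "f1 \<in> Filt K \<theta> (Suc n) 0" "\<forall>t\<in>Delta. f t = \<gamma> * f1 t"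
      "power_series_ring.primitive_curve N K (Suc n) f1 M D b"
      using power_series_ring.content_primitive[OF K(2,3)] f(2) by blast
    have M: "\<And>i. M i \<ge> 1" using f1(6) by (simp add: power_series_ring.primitive_curve_def[OF K(2)])
    have f1B: "f1 \<in> B (Suc n)" by (rule B_I[OF f1(4) K(1)])
    have \<gamma>B: "(\<lambda>t. \<gamma>) \<in> B (Suc n)" by (rule B_const[OF K(1) f1(1,3)])
    have "(\<lambda>t. \<gamma>) * f1 \<in> J"
      by (rule good_prime_cong[OF Suc.prems(1) f(1) B_ring(5)[OF \<gamma>B f1B]]) (use f1(5) in simp)
    then have f1J: "f1 \<in> J"
      using JD(5)[OF \<gamma>B f1B] good_prime_const[OF Suc.prems(1) K(1) f1(1-3)] by blast
    obtain d c where reg: "power_series_ring.regular N K \<theta> n d (\<lambda>t. f1 (shear M n t)) c"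
      using power_series_ring.regular_shear[OF K(2) f1(4,6)] by blast
    define J' where "J' = {h \<in> B (Suc n). (\<lambda>t. h (unshear M n t)) \<in> J}"
    define X' where "X' = (\<lambda>g t. g (shear M n t)) ` X"
    have sh: "(\<lambda>t. f (shear M n t)) \<in> B (Suc n)" and ush: "(\<lambda>t. f (unshear M n t)) \<in> B (Suc n)"
      if "f \<in> B (Suc n)" for f
      using B_shear[of M f n] M that by blast+
    have J'_shear: "(\<lambda>t. h (shear M n t)) \<in> J' \<longleftrightarrow> h \<in> J" if "h \<in> B (Suc n)" for h
      using sh[OF that] by (simp add: J'_def shear_unshear)
    have J': "good_prime (Suc n) J'"
      unfolding good_prime_def prime_ideal_on_def
    proof (intro conjI ballI impI)
      show "J' \<subseteq> B (Suc n)" by (auto simp: J'_def)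
      show "0 \<in> J'" using JD(2) B_ring(1) by (simp add: J'_def zero_fun_def)
      show "f + g \<in> J'" if "f \<in> J'" "g \<in> J'" for f g
        using that JD(3)[of "\<lambda>t. f (unshear M n t)" "\<lambda>t. g (unshear M n t)"] B_ring(3)[of f "Suc n" g]
          by (simp add: J'_def plus_fun_def)
      show "f * g \<in> J'" if "f \<in> B (Suc n)" "g \<in> J'" for f g
        using that JD(4)[of "\<lambda>t. f (unshear M n t)" "\<lambda>t. g (unshear M n t)"] ush[of f] B_ring(5)[of f
          "Suc n" g] by (simp add: J'_def times_fun_def)
      show "f \<in> J' \<or> g \<in> J'" if "f \<in> B (Suc n)" "g \<in> B (Suc n)" "f * g \<in> J'" for f g
        using that JD(5)[of "\<lambda>t. f (unshear M n t)" "\<lambda>t. g (unshear M n t)"] ush[of f] ush[of g]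
          by (simp add: J'_def times_fun_def)
      show "1 \<notin> J'" using JD(6) by (simp add: J'_def one_fun_def)
      show "f \<in> J'" if "f \<in> B (Suc n)" "\<forall>t\<in>Delta. f t = 0" for f
        using that JD(7)[OF ush[of f]] unshear_in_Delta[OF M] by (simp add: J'_def)
      show "(\<lambda>t. of_nat p) \<notin> J'" using JD(8) by (simp add: J'_def)
    qed
    have "\<exists>t\<in>Delta. (\<forall>f\<in>J'. f t = 0) \<and> (\<forall>g\<in>X'. g t \<noteq> 0)"
    proof (rule point_of_prime_step[OF Suc.IH J' _ _ _ K(1,2) _ reg])
      show "countable X'" using Suc.prems(2) by (simp add: X'_def)
      show "X' \<subseteq> B (Suc n)" using Suc.prems(3) sh by (auto simp: X'_def)
      show "X' \<inter> J' = {}" using Suc.prems(3,4) J'_shear by (auto simp: X'_def)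
      show "(\<lambda>t. f1 (shear M n t)) \<in> J'" using J'_shear[OF f1B] f1J by simp
    qed
    then obtain t where t: "t \<in> Delta" "\<And>f. f \<in> J' \<Longrightarrow> f t = 0" "\<And>g. g \<in> X' \<Longrightarrow> g t \<noteq> 0" by blast
    show ?thesis
    proof (intro bexI conjI ballI)
      show "shear M n t \<in> Delta" by (rule shear_in_Delta[OF M t(1)])
      show "f (shear M n t) = 0" if "f \<in> J" for f
        using t(2)[of "\<lambda>t. f (shear M n t)"] J'_shear[of f] that JD(1) by auto
      show "g (shear M n t) \<noteq> 0" if "g \<in> X" for g
        using t(3)[of "\<lambda>t. g (shear M n t)"] that by (auto simp: X'_def)
    qed
  qed
qed

text \<open>Compactness: a maximal ideal among those vanishing on the set and avoiding all products of
  the functions is prime, and its point would be uncovered.\<close>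

theorem countable_cover_finite:
  assumes Z: "Z \<subseteq> Delta" and closed: "\<And>t. t \<in> Delta \<Longrightarrow> (\<And>f. f \<in> B n \<Longrightarrow> (\<And>z. z \<in> Z \<Longrightarrow> f z = 0) \<Longrightarrow> f t = 0) \<Longrightarrow> t \<in> Z"
    and X: "countable X" "X \<subseteq> B n" and cover: "\<And>z. z \<in> Z \<Longrightarrow> \<exists>g\<in>X. g z = 0"
  shows "\<exists>Y\<subseteq>X. finite Y \<and> (\<forall>z\<in>Z. \<exists>g\<in>Y. g z = 0)"
proof (rule ccontr)
  assume no: "\<not> ?thesis"
  \<comment> \<open>The functions whose zeros in \<open>Z\<close> are covered by finitely many
    members of \<open>X\<close>: a multiplicative set containing \<open>X\<close>, 1 and the
    constant \<open>p\<close>. It misses the ideal \<open>IZ\<close> because there is no finite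
    subcover.\<close>
  define W where "W = {w \<in> B n. \<exists>Y\<subseteq>X. finite Y \<and> (\<forall>z\<in>Z. w z = 0 \<longrightarrow> (\<exists>g\<in>Y. g z = 0))}"
  define IZ where "IZ = {f \<in> B n. \<forall>z\<in>Z. f z = 0}"
  have W_disj: "IZ \<inter> W = {}"
  proof (rule ccontr)
    assume "IZ \<inter> W \<noteq> {}"
    then obtain w where w: "w \<in> IZ" "w \<in> W" by blast
    from w(2) obtain Y where "Y \<subseteq> X" "finite Y" "\<forall>z\<in>Z. w z = 0 \<longrightarrow> (\<exists>g\<in>Y. g z = 0)"
      unfolding W_def by auto
    moreover from w(1) have "\<forall>z\<in>Z. w z = 0" unfolding IZ_def by simp
    ultimately
    have "\<forall>z\<in>Z. \<exists>g\<in>Y. g z = 0" by simp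
    with \<open>Y \<subseteq> X\<close> \<open>finite Y\<close> show False using no by blast
  qed
  have W_mult: "f * g \<in> W" if "f \<in> W" "g \<in> W" for f g
  proof -
    obtain Y Y' where "Y \<subseteq> X" "finite Y" "\<forall>z\<in>Z. f z = 0 \<longrightarrow> (\<exists>g\<in>Y. g z = 0)"
      "Y' \<subseteq> X" "finite Y'" "\<forall>z\<in>Z. g z = 0 \<longrightarrow> (\<exists>g\<in>Y'. g z = 0)" using \<open>f \<in> W\<close> \<open>g \<in> W\<close> by (auto simp: W_def)
    then have "Y \<union> Y' \<subseteq> X \<and> finite (Y \<union> Y') \<and> (\<forall>z\<in>Z. (f * g) z = 0 \<longrightarrow> (\<exists>g\<in>Y \<union> Y'. g z = 0))" by auto
    moreover have "f * g \<in> B n" using that by (intro B_ring(5)) (auto simp: W_def)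
    ultimately show ?thesis unfolding W_def mem_Collect_eq by (intro conjI exI[of _ "Y \<union> Y'"]) simp_all
  qed
  have W_X: "X \<subseteq> W"
  proof
    fix g assume "g \<in> X"
    then show "g \<in> W" using X(2) by (auto simp: W_def intro!: exI[of _ "{g}"])
  qed
  have W_1: "1 \<in> W" using B_ring(2) by (auto simp: W_def)
  obtain \<theta> where R: "power_series_ring N p K0 \<theta>" using ring_instance K0 by blast
  have "of_nat p \<in> K0" using subfield_of_Rats[OF power_series_ring.K[OF R]] by auto
  then have "(\<lambda>t. of_nat p) \<in> B n" using K0(1) N_p by (intro B_const) auto
  then have W_p: "(\<lambda>t. of_nat p) \<in> W" using p_pos by (auto simp: W_def)
  define ideal where "ideal J \<longleftrightarrow> J \<subseteq> B n \<and> 0 \<in> J \<and> (\<forall>f\<in>J. \<forall>g\<in>J. f + g \<in> J) \<and> (\<forall>f\<in>B n. \<forall>g\<in>J. f * g \<in> J)" for J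
  define \<A> where "\<A> = {J. ideal J \<and> IZ \<subseteq> J \<and> J \<inter> W = {}}"
  have "IZ \<in> \<A>" using W_disj B_ring by (auto simp: \<A>_def ideal_def IZ_def)
  moreover have "\<Union>\<C> \<in> \<A>" if \<C>: "\<C> \<noteq> {}" "subset.chain \<A> \<C>" for \<C>
  proof -
    have sub: "\<And>J. J \<in> \<C> \<Longrightarrow> ideal J \<and> IZ \<subseteq> J \<and> J \<inter> W = {}"
      using \<C>(2) by (auto simp: subset.chain_def \<A>_def)
    have "f + g \<in> \<Union>\<C>" if fg: "f \<in> \<Union>\<C>" "g \<in> \<Union>\<C>" for f g
    proof -
      obtain J J' where "J \<in> \<C>" "J' \<in> \<C>" "f \<in> J" "g \<in> J'" using fg by blast
      moreover have "J \<subseteq> J' \<or> J' \<subseteq> J" using \<C>(2) calculation by (auto simp: subset_chain_def)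
      ultimately show ?thesis using sub unfolding ideal_def by (metis UnionI subsetD)
    qed
    moreover have "\<Union>\<C> \<subseteq> B n" "0 \<in> \<Union>\<C>" "\<forall>f\<in>B n. \<forall>g\<in>\<Union>\<C>. f * g \<in> \<Union>\<C>"
      using sub \<C>(1) unfolding ideal_def by blast+
    moreover have "IZ \<subseteq> \<Union>\<C>" "\<Union>\<C> \<inter> W = {}" using sub \<C>(1) by blast+
    ultimately show ?thesis unfolding \<A>_def ideal_def by blast
  qed
  ultimately obtain J where J: "J \<in> \<A>" "\<And>J'. J' \<in> \<A> \<Longrightarrow> J \<subseteq> J' \<Longrightarrow> J' = J"
    using subset_Zorn_nonempty[of \<A>] by blast
  have Ji: "J \<subseteq> B n" "0 \<in> J" "\<And>f g. f \<in> J \<Longrightarrow> g \<in> J \<Longrightarrow> f + g \<in> J"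
    "\<And>f g. f \<in> B n \<Longrightarrow> g \<in> J \<Longrightarrow> f * g \<in> J" "IZ \<subseteq> J" "J \<inter> W = {}"
    using J(1) by (auto simp: \<A>_def ideal_def)
  have meets: "\<exists>j\<in>J. \<exists>b\<in>B n. j + b * f \<in> W" if f: "f \<in> B n" "f \<notin> J" for f
  proof -
    define J' where "J' = {j + b * f | j b. j \<in> J \<and> b \<in> B n}"
    have JJ': "J \<subseteq> J'"
    proof
      fix j assume "j \<in> J"
      moreover have "j = j + 0 * f" by simp
      ultimately show "j \<in> J'" using B_ring(1) unfolding J'_def by blast
    qed
    have "f = 0 + 1 * f" by simp
    then have "f \<in> J'" using Ji(2) B_ring(2) unfolding J'_def by blast
    then have "J' \<noteq> J" using f by blast
    then have "J' \<notin> \<A>" using J(2)[of J'] JJ' by blast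
    moreover have "ideal J'" unfolding ideal_def
    proof (intro conjI ballI)
      show "J' \<subseteq> B n" using Ji(1) f(1) B_ring by (auto simp: J'_def)
      show "0 \<in> J'" using JJ' Ji(2) by blast
    next
      fix g h assume "g \<in> J'" "h \<in> J'"
      then obtain j b j' b' where *: "g = j + b * f" "h = j' + b' * f" "j \<in> J" "b \<in> B n" "j' \<in> J" "b' \<in> B n"
        unfolding J'_def by blast
      then have "g + h = (j + j') + (b + b') * f" by (simp add: algebra_simps)
      then show "g + h \<in> J'" using Ji(3)[OF *(3,5)] B_ring(3)[OF *(4,6)] unfolding J'_def by blast
    next
      fix g h assume g: "g \<in> B n" and "h \<in> J'"
      then obtain j b where *: "h = j + b * f" "j \<in> J" "b \<in> B n" unfolding J'_def by blast
      then have "g * h = g * j + (g * b) * f" by (simp add: algebra_simps)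
      then show "g * h \<in> J'" using Ji(4)[OF g *(2)] B_ring(5)[OF g *(3)] unfolding J'_def by blast
    qed
    moreover have "IZ \<subseteq> J'" using Ji(5) JJ' by blast
    ultimately have "J' \<inter> W \<noteq> {}" unfolding \<A>_def by blast
    then show ?thesis unfolding J'_def by blast
  qed
  have prime: "f \<in> J \<or> g \<in> J" if fg: "f \<in> B n" "g \<in> B n" "f * g \<in> J" for f g
  proof (rule ccontr)
    assume "\<not> ?thesis"
    then obtain j b j' b' where *: "j \<in> J" "b \<in> B n" "j + b * f \<in> W" "j' \<in> J" "b' \<in> B n" "j' + b' * g \<in> W"
      using meets[of f] meets[of g] fg by blast
    have "(j + b * f) * (j' + b' * g) = (j' + b' * g) * j + ((b * f) * j' + (b * b') * (f * g))"
      by (simp add: algebra_simps)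
    moreover have "\<dots> \<in> J"
    proof (intro Ji(3))
      show "(j' + b' * g) * j \<in> J" using *(1,6) by (intro Ji(4)) (auto simp: W_def)
      show "(b * f) * j' \<in> J" using *(2,4) fg by (intro Ji(4) B_ring(5))
      show "(b * b') * (f * g) \<in> J" by (rule Ji(4)[OF B_ring(5)[OF *(2,5)] fg(3)])
    qed
    ultimately show False using W_mult[OF *(3,6)] Ji(6) by auto
  qed
  have "f \<in> J" if "f \<in> B n" "\<forall>t\<in>Delta. f t = 0" for f
    using that Ji(5) Z by (auto simp: IZ_def)
  moreover have "1 \<notin> J" "(\<lambda>t. of_nat p) \<notin> J" using W_1 W_p Ji(6) by blast+
  ultimately have "good_prime n J"
    unfolding good_prime_def prime_ideal_on_def
    by (intro conjI ballI impI Ji(1-4)) (use prime in \<open>simp_all\<close>)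
  moreover have "X \<inter> J = {}" using W_X Ji(6) by blast
  ultimately obtain t where t: "t \<in> Delta" "\<forall>f\<in>J. f t = 0" "\<forall>g\<in>X. g t \<noteq> 0"
    using point_of_prime[OF _ X] by blast
  have "t \<in> Z" using t(2) Ji(5) by (intro closed[OF t(1)]) (auto simp: IZ_def)
  then show False using cover t(3) by blast
qed

end

section \<open>Closed subfields\<close>

context nonarch_field
begin

lemma nlim_mult:
  assumes "nlim s l" "nlim s' l'"
  shows "nlim (\<lambda>k. s k * s' k) (l * l')"
proof (rule nlimI)
  show "(\<lambda>k. (N (s k - l) + N l) * N (s' k - l') + N l' * N (s k - l)) \<longlonglongrightarrow> 0"
    using assms unfolding nlim_def by (auto intro!: tendsto_eq_intros)
  fix k
  have "s k * s' k - l * l' = s k * (s' k - l') + l' * (s k - l)" by (simp add: algebra_simps)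
  then have "N (s k * s' k - l * l') \<le> max (N (s k) * N (s' k - l')) (N l' * N (s k - l))"
    using N_add[of "s k * (s' k - l')" "l' * (s k - l)"] by (simp add: N_mult)
  also have "\<dots> \<le> N (s k) * N (s' k - l') + N l' * N (s k - l)" by (simp add: N_nonneg)
  also have "N (s k) \<le> N (s k - l) + N l"
    using N_add[of "s k - l" l] N_nonneg[of l] N_nonneg[of "s k - l"] by simp
  finally show "N (s k * s' k - l * l') \<le> (N (s k - l) + N l) * N (s' k - l') + N l' * N (s k - l)"
    by (simp add: N_nonneg mult_right_mono)
qed

lemma nlim_eventually: "nlim s l \<Longrightarrow> e > 0 \<Longrightarrow> \<forall>\<^sub>F k in sequentially. N (s k - l) < e"
  unfolding nlim_def by (rule order_tendstoD(2))

lemma nlim_inverse: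
  assumes "nlim s l" "l \<noteq> 0"
  shows "nlim (\<lambda>k. inverse (s k)) (inverse l)"
  unfolding nlim_def
proof (rule Lim_null_comparison)
  show "(\<lambda>k. N (s k - l) / (N l * N l)) \<longlonglongrightarrow> 0"
    using assms unfolding nlim_def by (auto intro!: tendsto_eq_intros simp: N_eq_0_iff)
  have "\<forall>\<^sub>F k in sequentially. N (s k - l) < N l"
    by (rule nlim_eventually) (use assms in \<open>auto simp: N_pos_iff\<close>)
  then show "\<forall>\<^sub>F k in sequentially. norm (N (inverse (s k) - inverse l)) \<le> N (s k - l) / (N l * N l)"
  proof eventually_elim
    case (elim k)
    then have "N (s k) = N l" using N_add_eq[of "s k - l" l] by simp
    moreover have "s k \<noteq> 0" using calculation assms by (metis N_eq_0_iff)
    moreover have "inverse (s k) - inverse l = (l - s k) / (s k * l)"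
      using calculation assms by (simp add: field_simps)
    ultimately show ?case using assms by (simp add: N_divide N_mult N_commute[of l] N_nonneg)
  qed
qed

lemma nlim_poly: "nlim s l \<Longrightarrow> nlim (\<lambda>k. poly q (s k)) (poly q l)"
  by (induction q) (auto intro!: nlim_add nlim_mult nlim_const)

definition ncl :: "'a set \<Rightarrow> 'a set" where
  "ncl F = {x. \<exists>s. (\<forall>k. s k \<in> F) \<and> nlim s x}"

lemma ncl_iff: "x \<in> ncl F \<longleftrightarrow> (\<forall>e>0. \<exists>y\<in>F. N (x - y) < e)"
proof
  assume "x \<in> ncl F"
  then obtain s where s: "\<forall>k. s k \<in> F" "nlim s x" by (auto simp: ncl_def)
  show "\<forall>e>0. \<exists>y\<in>F. N (x - y) < e"
  proof safe
    fix e :: real assume "e > 0"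
    from nlim_eventually[OF s(2) this] obtain k where "N (s k - x) < e"
      by (auto simp: eventually_sequentially)
    then show "\<exists>y\<in>F. N (x - y) < e" using s(1) N_commute by metis
  qed
next
  assume *: "\<forall>e>0. \<exists>y\<in>F. N (x - y) < e"
  have "\<exists>y\<in>F. N (x - y) < inverse (real (Suc k))" for k using * by simp
  then obtain s where s: "\<And>k. s k \<in> F" "\<And>k. N (x - s k) < inverse (real (Suc k))" by metis
  have "nlim s x" by (rule nlimI[OF LIMSEQ_inverse_real_of_nat]) (use s(2) N_commute in \<open>auto intro: less_imp_le\<close>)
  then show "x \<in> ncl F" using s(1) by (auto simp: ncl_def)
qed

lemma ncl_superset: "F \<subseteq> ncl F"
  unfolding ncl_def by (auto intro!: exI[of _ "\<lambda>k. _"] nlim_const)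

lemma ncl_mono: "F \<subseteq> F' \<Longrightarrow> ncl F \<subseteq> ncl F'"
  unfolding ncl_def by blast

lemma ncl_closed: "(\<And>k. s k \<in> ncl F) \<Longrightarrow> nlim s l \<Longrightarrow> l \<in> ncl F"
  unfolding ncl_iff[of l]
proof safe
  fix e :: real assume s: "\<And>k. s k \<in> ncl F" "nlim s l" and e: "e > 0"
  from nlim_eventually[OF s(2) e] obtain k where k: "N (s k - l) < e" by (auto simp: eventually_sequentially)
  obtain y where y: "y \<in> F" "N (s k - y) < e" using s(1)[of k] e unfolding ncl_iff by blast
  have "N (l - y) \<le> max (N (l - s k)) (N (s k - y))" using N_add[of "l - s k" "s k - y"] by simp
  then show "\<exists>y\<in>F. N (l - y) < e" using k y N_commute[of l "s k"] by (intro bexI[of _ y]) auto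
qed

lemma subfield_of_ncl:
  assumes F: "subfield_of F"
  shows "subfield_of (ncl F)"
  unfolding subfield_of_def
proof (intro conjI ballI)
  show "0 \<in> ncl F" "1 \<in> ncl F" using ncl_superset subfield_ofD[OF F] by auto
next
  fix x y assume "x \<in> ncl F" "y \<in> ncl F"
  then obtain s s' where s: "\<forall>k. s k \<in> F" "nlim s x" "\<forall>k. s' k \<in> F" "nlim s' y" by (auto simp: ncl_def)
  show "x + y \<in> ncl F" unfolding ncl_def mem_Collect_eq
    using nlim_add[OF s(2,4)] s(1,3) subfield_ofD(3)[OF F] by (intro exI[of _ "\<lambda>k. s k + s' k"]) simp
  show "x - y \<in> ncl F" unfolding ncl_def mem_Collect_eq
    using nlim_diff[OF s(2,4)] s(1,3) subfield_ofD(4)[OF F] by (intro exI[of _ "\<lambda>k. s k - s' k"]) simp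
  show "x * y \<in> ncl F" unfolding ncl_def mem_Collect_eq
    using nlim_mult[OF s(2,4)] s(1,3) subfield_ofD(5)[OF F] by (intro exI[of _ "\<lambda>k. s k * s' k"]) simp
next
  fix x assume x: "x \<in> ncl F"
  then obtain s where s: "\<forall>k. s k \<in> F" "nlim s x" by (auto simp: ncl_def)
  show "inverse x \<in> ncl F"
  proof (cases "x = 0")
    case False
    then show ?thesis unfolding ncl_def mem_Collect_eq
      using nlim_inverse[OF s(2)] s(1) subfield_ofD(6)[OF F] by (intro exI[of _ "\<lambda>k. inverse (s k)"]) simp
  qed (use x in simp)
qed

text \<open>A nonzero element of the closure has the same norm as every sufficiently close element
  of \<open>F\<close>, so no new norms appear.\<close>

lemma discrete_ncl:
  assumes F: "subfield_of F" and \<theta>: "0 < \<theta>" "\<theta> < 1" "\<And>x. x \<in> F \<Longrightarrow> N x < 1 \<Longrightarrow> N x \<le> \<theta>"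
  shows "discrete_subfield (ncl F) \<theta>"
proof -
  have "N x \<le> \<theta>" if x: "x \<in> ncl F" "N x < 1" for x
  proof (cases "x = 0")
    case False
    then have "0 < N x" by (simp add: N_pos_iff)
    then obtain y where y: "y \<in> F" "N (x - y) < N x" using x(1) unfolding ncl_iff by blast
    then have "N y = N x" using N_add_eq[of "y - x" x] N_commute[of x y] by simp
    then show ?thesis using \<theta>(3)[OF y(1)] x by simp
  qed (use \<theta> in simp)
  then show ?thesis unfolding discrete_subfield_def
    using \<theta>(1,2) subfield_of_ncl[OF F] ncl_closed by blast
qed

section \<open>The completion is algebraically closed\<close>

text \<open>The norm of \<open>poly g x\<close> is that of the leading coefficient times the
  distances from \<open>x\<close> to the roots, so the nearest root satisfies the bound. The
  induction splits off a root in \<open>F\<close> and keeps the nearer of it and the root found for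
  the quotient. The point \<open>x\<close> may lie outside \<open>F\<close>.\<close>

lemma root_close:
  assumes F: "subfield_of F" and ac: "\<And>f. degree f > 0 \<Longrightarrow> \<forall>i. coeff f i \<in> F \<Longrightarrow> \<exists>x\<in>F. poly f x = 0"
  shows "degree g = Suc d \<Longrightarrow> \<forall>i. coeff g i \<in> F \<Longrightarrow>
    \<exists>\<rho>. poly g \<rho> = 0 \<and> N (lead_coeff g) * N (x - \<rho>) ^ Suc d \<le> N (poly g x)"
proof (induction d arbitrary: g)
  case 0
  then obtain \<rho> where \<rho>: "poly g \<rho> = 0" using ac[of g] by auto
  obtain a h where "g = pCons a h" by (cases g)
  moreover from this 0(1) have "degree h = 0" by (auto split: if_splits)
  ultimately obtain b where g: "g = [:a, b:]" by (auto elim: degree_eq_zeroE)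
  then have "a = - (\<rho> * b)" using \<rho> by (simp add: eq_neg_iff_add_eq_0)
  then have "poly g x = b * (x - \<rho>)" using g by (simp add: algebra_simps)
  then show ?case using \<rho> 0(1) g by (auto intro!: exI[of _ \<rho>] simp: N_mult)
next
  case (Suc d)
  then obtain \<rho> where \<rho>: "\<rho> \<in> F" "poly g \<rho> = 0" using ac[of g] by auto
  define h where "h = synthetic_div g \<rho>"
  have g: "g = [:-\<rho>, 1:] * h" using synthetic_div_correct'[of \<rho> g] \<rho> by (simp add: h_def)
  have pF: "poly f \<rho> \<in> F" if "\<forall>i. coeff f i \<in> F" for f
    unfolding poly_altdef by (intro subfield_of_sum[OF F] subfield_ofD[OF F] \<rho>) (use that in auto)
  have "coeff (synthetic_div f \<rho>) i \<in> F" if "\<forall>i. coeff f i \<in> F" for f i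
    using that
  proof (induction f arbitrary: i)
    case (pCons a f)
    have "\<forall>i. coeff f i \<in> F" using pCons.prems by (metis coeff_pCons_Suc)
    then show ?case using pCons.IH pF by (auto simp: coeff_pCons split: nat.splits)
  qed (use subfield_ofD[OF F] in auto)
  then have hF: "\<forall>i. coeff h i \<in> F" using Suc.prems by (simp add: h_def)
  have dh: "degree h = Suc d" using Suc.prems by (simp add: h_def degree_synthetic_div)
  have lh: "lead_coeff h = lead_coeff g" unfolding g lead_coeff_mult by simp
  obtain \<sigma> where \<sigma>: "poly h \<sigma> = 0" "N (lead_coeff h) * N (x - \<sigma>) ^ Suc d \<le> N (poly h x)"
    using Suc.IH[OF dh hF] by blast
  have gx: "N (poly g x) = N (x - \<rho>) * N (poly h x)" unfolding g poly_mult N_mult by simp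
  have 1: "N (lead_coeff g) * (N (x - \<rho>) * N (x - \<sigma>) ^ Suc d) \<le> N (poly g x)"
    using mult_left_mono[OF \<sigma>(2) N_nonneg[of "x - \<rho>"]] unfolding gx lh by (simp add: algebra_simps)
  have le: "N (x - \<tau>) ^ Suc (Suc d) \<le> N (x - \<rho>) * N (x - \<sigma>) ^ Suc d"
    if "N (x - \<tau>) \<le> N (x - \<rho>)" "N (x - \<tau>) \<le> N (x - \<sigma>)" for \<tau>
    unfolding power_Suc[of _ "Suc d"] using that by (intro mult_mono power_mono) (auto simp: N_nonneg)
  have gs: "poly g \<sigma> = 0" using \<sigma> g by simp
  show ?case
  proof (cases "N (x - \<rho>) \<le> N (x - \<sigma>)")
    case True
    then show ?thesis using \<rho>(2) 1 le[of \<rho>] mult_left_mono[OF le[of \<rho>] N_nonneg[of "lead_coeff g"]]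
      by (intro exI[of _ \<rho>]) auto
  next
    case False
    then show ?thesis using gs 1 mult_left_mono[OF le[of \<sigma>] N_nonneg[of "lead_coeff g"]]
      by (intro exI[of _ \<sigma>]) auto
  qed
qed

lemma N_poly_le:
  assumes "degree g \<le> d" "\<And>i. N (coeff g i) \<le> B" "N x \<le> R" "1 \<le> R" "0 \<le> B"
  shows "N (poly g x) \<le> B * R ^ d"
  unfolding poly_altdef
proof (rule N_sum)
  fix i assume "i \<in> {..degree g}"
  then have "N x ^ i \<le> R ^ i" "R ^ i \<le> R ^ d"
    using assms by (auto intro: power_mono power_increasing simp: N_nonneg)
  then show "N (coeff g i * x ^ i) \<le> B * R ^ d"
    unfolding N_mult N_power using assms by (intro mult_mono) (auto simp: N_nonneg)
qed (use assms in simp)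

text \<open>Continuity of roots: \<open>q\<close> is approximated coefficientwise by polynomials
  \<open>g k\<close> over \<open>F\<close>, each next root is taken close to the previous one, and
  the roots converge to a root of \<open>q\<close>.\<close>

theorem alg_closed_ncl:
  assumes F: "subfield_of F" and ac: "\<And>f. degree f > 0 \<Longrightarrow> \<forall>i. coeff f i \<in> F \<Longrightarrow> \<exists>x\<in>F. poly f x = 0"
    and dense: "ncl F = UNIV" and q: "degree (q :: 'a poly) \<ge> 1"
  shows "\<exists>x. poly q x = 0"
proof -
  define a where "a = N (lead_coeff q)"
  have a: "a > 0" using q by (auto simp: a_def N_pos_iff)
  obtain d where d: "degree q = Suc d" using q by (cases "degree q") auto
  define A where "A = Max (insert 1 ((\<lambda>i. N (coeff q i)) ` {..degree q}))"
  have A1: "1 \<le> A" unfolding A_def by (intro Max_ge) auto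
  have A: "N (coeff q i) \<le> A" for i
  proof (cases "i \<le> degree q")
    case True then show ?thesis unfolding A_def by (intro Max_ge) auto
  qed (use A1 in \<open>simp add: coeff_eq_0\<close>)
  \<comment> \<open>A bound for all roots of all \<open>g k\<close>, whose leading coefficients keep
    norm \<open>a\<close> and whose other coefficients have norm at most \<open>A\<close>.\<close>
  define R where "R = max 1 (A / a)"
  \<comment> \<open>Staying below \<open>a\<close> preserves the norm of the leading coefficient,
    staying at most 1 keeps the coefficients within \<open>A\<close>, and the powers of
    \<open>1/2\<close> make the error tend to 0.\<close>
  define \<delta> where "\<delta> k = min 1 (a/2) * (1/2) ^ k" for k :: nat
  have \<delta>: "0 < \<delta> k" "\<delta> k \<le> 1" "\<delta> k < a" "\<delta> (Suc k) \<le> \<delta> k" for k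
  proof -
    show "0 < \<delta> k" using a by (simp add: \<delta>_def)
    have "\<delta> k \<le> min 1 (a/2)" unfolding \<delta>_def using a by (intro mult_left_le) (auto simp: power_le_one)
    then show "\<delta> k \<le> 1" "\<delta> k < a" using a by auto
    show "\<delta> (Suc k) \<le> \<delta> k" using a by (simp add: \<delta>_def)
  qed
  have \<delta>0: "\<delta> \<longlonglongrightarrow> 0" unfolding \<delta>_def[abs_def] by (auto intro!: tendsto_mult_right_zero LIMSEQ_realpow_zero)
  have "\<exists>g. degree g = Suc d \<and> (\<forall>i. coeff g i \<in> F) \<and> N (lead_coeff g) = a \<and>
    (\<forall>i. N (coeff g i - coeff q i) < \<delta> k)" for k
  proof -
    have "\<exists>y\<in>F. N (coeff q i - y) < \<delta> k" for i using dense \<delta>(1) ncl_iff[of "coeff q i" F] by auto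
    then obtain y where y: "\<And>i. y i \<in> F" "\<And>i. N (coeff q i - y i) < \<delta> k" by metis
    define g where "g = (\<Sum>i\<le>Suc d. monom (y i) i)"
    have cg: "coeff g i = (if i \<le> Suc d then y i else 0)" for i by (simp add: g_def coeff_sum)
    have Nd: "N (y (Suc d)) = a"
      using N_add_eq[of "y (Suc d) - coeff q (Suc d)" "coeff q (Suc d)"] y(2)[of "Suc d"] \<delta>(3)[of k] d
      by (simp add: a_def N_commute)
    have dg: "degree g = Suc d"
    proof (rule antisym)
      show "degree g \<le> Suc d" by (rule degree_le) (simp add: cg)
      show "Suc d \<le> degree g" by (rule le_degree) (use Nd a in \<open>auto simp: cg\<close>)
    qed
    moreover have "N (coeff g i - coeff q i) < \<delta> k" for i
      using y(2)[of i] \<delta>(1)[of k] d by (auto simp: cg N_commute coeff_eq_0)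
    ultimately show ?thesis using y(1) Nd subfield_ofD(1)[OF F]
      by (intro exI[of _ g]) (auto simp: cg)
  qed
  then obtain g where g: "\<And>k. degree (g k) = Suc d" "\<And>k i. coeff (g k) i \<in> F" "\<And>k. N (lead_coeff (g k)) = a"
    "\<And>k i. N (coeff (g k) i - coeff q i) < \<delta> k" by metis
  have gA: "N (coeff (g k) i) \<le> A" for k i
    using N_add[of "coeff (g k) i - coeff q i" "coeff q i"] g(4)[of k i] A[of i] \<delta>(2)[of k] A1 by simp
  have root_R: "N r \<le> R" if r: "poly (g k) r = 0" for k r
  proof (cases "N r \<le> 1")
    case False
    then have r1: "1 < N r" by simp
    have "(\<Sum>i\<le>Suc d. coeff (g k) i * r ^ i) = 0" using r by (simp add: poly_altdef g(1))
    then have "lead_coeff (g k) * r ^ Suc d = - (\<Sum>i\<le>d. coeff (g k) i * r ^ i)"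
      by (simp add: g(1) eq_neg_iff_add_eq_0 add.commute)
    then have "a * N r ^ Suc d = N (\<Sum>i\<le>d. coeff (g k) i * r ^ i)"
      by (metis N_minus N_mult N_power g(3))
    also have "\<dots> \<le> A * N r ^ d"
    proof (rule N_sum)
      fix i assume "i \<in> {..d}"
      then have "N r ^ i \<le> N r ^ d" using r1 by (intro power_increasing) auto
      then show "N (coeff (g k) i * r ^ i) \<le> A * N r ^ d"
        unfolding N_mult N_power using gA A1 by (intro mult_mono) (auto simp: N_nonneg)
    qed (use A1 N_nonneg in simp)
    finally have "(a * N r) * N r ^ d \<le> A * N r ^ d" by (simp add: algebra_simps)
    then have "a * N r \<le> A" using r1 by (simp add: mult_le_cancel_right)
    then have "N r \<le> A / a" using a by (simp add: field_simps)
    then show ?thesis by (simp add: R_def)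
  qed (simp add: R_def)
  have R1: "1 \<le> R" by (simp add: R_def)
  have "\<exists>r. \<forall>k. poly (g k) (r k) = 0 \<and> a * N (r k - r (Suc k)) ^ Suc d \<le> N (poly (g (Suc k)) (r k))"
  proof (rule dependent_nat_choice)
    show "\<exists>x. poly (g 0) x = 0" using ac[of "g 0"] g(1,2) by auto
    fix x k assume "poly (g k) x = 0"
    show "\<exists>y. poly (g (Suc k)) y = 0 \<and> a * N (x - y) ^ Suc d \<le> N (poly (g (Suc k)) x)"
      using root_close[OF F ac g(1)[of "Suc k"], of x] g(2,3) by auto
  qed
  then obtain r where r: "\<And>k. poly (g k) (r k) = 0"
    "\<And>k. a * N (r k - r (Suc k)) ^ Suc d \<le> N (poly (g (Suc k)) (r k))"
    by blast
  have small: "N (poly (g (Suc k)) (r k)) \<le> \<delta> k * R ^ Suc d" "N (poly q (r k)) \<le> \<delta> k * R ^ Suc d" for k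
  proof -
    have "N (poly (g (Suc k) - g k) (r k)) \<le> \<delta> k * R ^ Suc d"
    proof (rule N_poly_le[OF _ _ root_R[OF r(1)] R1])
      show "degree (g (Suc k) - g k) \<le> Suc d" by (rule degree_diff_le) (simp_all add: g(1))
      show "N (coeff (g (Suc k) - g k) i) \<le> \<delta> k" for i
        using N_diff[of "coeff (g (Suc k)) i - coeff q i" "coeff (g k) i - coeff q i"] g(4)[of
          "Suc k" i] g(4)[of k i] \<delta>(4)[of k]
        by simp
    qed (use \<delta>(1)[of k] in simp)
    then show "N (poly (g (Suc k)) (r k)) \<le> \<delta> k * R ^ Suc d" by (simp add: r(1))
    have "N (poly (g k - q) (r k)) \<le> \<delta> k * R ^ Suc d"
    proof (rule N_poly_le[OF _ _ root_R[OF r(1)] R1])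
      show "degree (g k - q) \<le> Suc d" by (rule degree_diff_le) (simp_all add: g(1) d)
      show "N (coeff (g k - q) i) \<le> \<delta> k" for i using g(4)[of k i] by simp
    qed (use \<delta>(1)[of k] in simp)
    then show "N (poly q (r k)) \<le> \<delta> k * R ^ Suc d" by (simp add: r(1))
  qed
  have d0: "(\<lambda>k. \<delta> k * R ^ Suc d) \<longlonglongrightarrow> 0" using \<delta>0 by (rule tendsto_mult_left_zero)
  have "(\<lambda>k. N (r k - r (Suc k)) ^ Suc d) \<longlonglongrightarrow> 0"
  proof (rule Lim_null_comparison)
    show "(\<lambda>k. \<delta> k * R ^ Suc d / a) \<longlonglongrightarrow> 0" using d0 by (rule tendsto_divide_zero)
    have "N (r k - r (Suc k)) ^ Suc d \<le> \<delta> k * R ^ Suc d / a" for k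
      using r(2)[of k] small(1)[of k] a by (simp add: field_simps)
    then show "\<forall>\<^sub>F k in sequentially. norm (N (r k - r (Suc k)) ^ Suc d) \<le> \<delta> k * R ^ Suc d / a"
      by (simp add: N_nonneg)
  qed
  then have "(\<lambda>k. root (Suc d) (N (r k - r (Suc k)) ^ Suc d)) \<longlonglongrightarrow> root (Suc d) 0"
    by (rule tendsto_real_root)
  then have "(\<lambda>k. N (r (Suc k) - r k)) \<longlonglongrightarrow> 0"
    by (simp add: real_root_power_cancel N_nonneg N_commute del: power_Suc)
  then obtain l where l: "nsums (\<lambda>k. r (Suc k) - r k) l"
    using nsums_exists[of "\<lambda>k. r (Suc k) - r k"] by blast
  then have "nlim (\<lambda>k. r k - r 0) l" by (simp add: nsums_def sum_lessThan_telescope)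
  then have lim: "nlim r (l + r 0)" using nlim_add[OF _ nlim_const[of "r 0"]] by fastforce
  have "nlim (\<lambda>k. poly q (r k)) 0" by (rule nlimI[OF d0]) (use small in simp)
  then have "poly q (l + r 0) = 0" using nlim_unique nlim_poly[OF lim] by blast
  then show ?thesis by blast
qed

section \<open>Number fields are discretely valued\<close>

lemma N_of_nat_le: "N (of_nat k) \<le> 1"
proof (induction k)
  case (Suc k)
  then show ?case using N_add[of 1 "of_nat k"] by simp
qed simp

lemma N_of_int_le: "N (of_int k) \<le> 1"
  using N_of_nat_le[of "nat \<bar>k\<bar>"] by (cases "k \<ge> 0") (auto simp: abs_if)

text \<open>In a Bezout relation \<open>u * p + v * k = 1\<close> the first summand has norm below
  1, so the second has norm at least 1.\<close>

lemma N_coprime: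
  assumes "prime p" "\<not> p dvd k"
  shows "N (of_nat k) = 1"
proof (rule antisym[OF N_of_nat_le])
  have "coprime (int p) (int k)" using assms by (simp add: prime_imp_coprime)
  then obtain u v where "u * int p + v * int k = 1" using bezout_int[of "int p" "int k"] by auto
  then have "of_int u * of_nat p + of_int v * of_nat k = (1 :: 'a)"
    by (metis of_int_1 of_int_add of_int_mult of_int_of_nat_eq)
  then have "1 \<le> max (N (of_int u) * N (of_nat p)) (N (of_int v) * N (of_nat k))"
    using N_add[of "of_int u * of_nat p" "of_int v * of_nat k"] by (simp add: N_mult)
  moreover have "N (of_int u) * N (of_nat p) < 1"
    using N_of_int_le[of u] N_p N_nonneg by (meson mult_le_one le_less_trans mult_right_le_one_le not_less
      order_trans mult_left_le_one_le)
  moreover have "N (of_int v) * N (of_nat k) \<le> N (of_nat k)"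
    using N_of_int_le[of v] N_nonneg by (simp add: mult_left_le_one_le)
  ultimately show "1 \<le> N (of_nat k)" by auto
qed

lemma N_nat_power:
  assumes "prime p" "k > 0"
  shows "\<exists>m. N (of_nat k) = N (of_nat p) ^ m"
  using assms(2)
proof (induction k rule: less_induct)
  case (less k)
  show ?case
  proof (cases "p dvd k")
    case True
    then obtain j where j: "k = p * j" by (auto elim: dvdE)
    then have "j > 0" "j < k" using less.prems prime_gt_1_nat[OF assms(1)] by auto
    then obtain m where "N (of_nat j) = N (of_nat p) ^ m" using less.IH by blast
    then show ?thesis by (intro exI[of _ "Suc m"]) (simp add: j N_mult)
  next
    case False
    then show ?thesis using N_coprime[OF assms(1)] by (intro exI[of _ 0]) simp
  qed
qed

lemma N_rat_power:
  assumes "prime p" "x \<in> \<rat>" "x \<noteq> 0"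
  shows "\<exists>m m'. N x * N (of_nat p) ^ m = N (of_nat p) ^ m'"
proof -
  obtain a b where "b > 0" "x = of_int a / of_int b" using assms(2) by (auto elim!: Rats_cases')
  then have ab: "b \<noteq> 0" "x = of_int a / of_int b" by auto
  have a0: "a \<noteq> 0" using ab assms(3) by auto
  have abs: "N (of_int k) = N (of_nat (nat \<bar>k\<bar>))" for k by (cases "k \<ge> 0") (auto simp: abs_if)
  obtain m m' where "N (of_int b) = N (of_nat p) ^ m" "N (of_int a) = N (of_nat p) ^ m'"
    unfolding abs using N_nat_power[OF assms(1), of "nat \<bar>b\<bar>"] N_nat_power[OF assms(1), of
      "nat \<bar>a\<bar>"] ab(1) a0 by auto
  moreover have "N (of_int b) \<noteq> 0" using ab(1) by (simp add: N_eq_0_iff)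
  ultimately show ?thesis by (intro exI[of _ m] exI[of _ m']) (simp add: ab(2) N_divide)
qed

text \<open>A unique term of largest norm would determine the norm of the sum, which is 0; so the
  largest norm is attained twice.\<close>

lemma equal_norms:
  assumes I: "finite I" and s: "(\<Sum>i\<in>I. t i) = 0" and nz: "i0 \<in> I" "t i0 \<noteq> 0"
  shows "\<exists>i\<in>I. \<exists>j\<in>I. i \<noteq> j \<and> N (t i) = N (t j) \<and> t i \<noteq> 0"
proof -
  have "Max ((\<lambda>i. N (t i)) ` I) \<in> (\<lambda>i. N (t i)) ` I" using I nz(1) by (intro Max_in) auto
  then obtain i where i': "i \<in> I" "Max ((\<lambda>i. N (t i)) ` I) = N (t i)" by auto
  then have i: "i \<in> I" "\<And>j. j \<in> I \<Longrightarrow> N (t j) \<le> N (t i)"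
    using I by (auto simp: i'(2)[symmetric])
  have ti: "t i \<noteq> 0" using i(2)[OF nz(1)] nz(2) by (metis N_pos_iff N_0 not_less)
  have eq: "t i = - (\<Sum>j\<in>I-{i}. t j)" using s I i(1) by (simp add: sum.remove eq_neg_iff_add_eq_0)
  have "\<exists>j\<in>I-{i}. N (t j) \<ge> N (t i)"
  proof (rule ccontr)
    assume "\<not> ?thesis"
    then have lt: "\<forall>j\<in>I-{i}. N (t j) < N (t i)" by (simp add: not_le)
    have ne: "I - {i} \<noteq> {}" using eq ti by (metis sum.empty neg_equal_0_iff_equal)
    have "N (t i) \<le> Max ((\<lambda>j. N (t j)) ` (I - {i}))" unfolding arg_cong[OF eq, of N] N_minus
    proof (rule N_sum)
      show "0 \<le> Max ((\<lambda>j. N (t j)) ` (I - {i}))" using ne I by (auto simp: Max_ge_iff N_nonneg)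
    qed (use I in auto)
    also have "\<dots> < N (t i)" using lt ne I by (subst Max_less_iff) auto
    finally show False by simp
  qed
  then show ?thesis using i ti by (metis DiffE antisym insertCI)
qed

text \<open>Two terms of the polynomial relation for \<open>x\<close> have equal nonzero norm, so
  \<open>N x ^ (j - i)\<close> is a power of the norm of \<open>p\<close> with
  \<open>1 \<le> j - i \<le> n\<close>: the degree bounds the ramification.\<close>

lemma discrete_bounded_degree:
  assumes "prime p" and deg: "\<And>x. x \<in> F \<Longrightarrow> \<exists>f. f \<noteq> 0 \<and> (\<forall>i. coeff f i \<in> \<rat>) \<and> degree f \<le> n \<and> poly f x = 0"
  shows "\<exists>\<theta>>0. \<theta> < 1 \<and> (\<forall>x\<in>F. N x < 1 \<longrightarrow> N x \<le> \<theta>)"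
proof -
  define r where "r = N (of_nat p)"
  have r: "0 < r" "r < 1" using p_pos N_p by (auto simp: r_def N_pos_iff)
  \<comment> \<open>The root of index \<open>Suc n\<close> serves all exponents
    \<open>j - i \<le> n\<close> at once, and its index is positive even for
    \<open>n = 0\<close>.\<close>
  define \<theta> where "\<theta> = root (Suc n) r"
  have \<theta>: "0 < \<theta>" "\<theta> < 1" "\<theta> ^ Suc n = r"
    using r by (auto simp: \<theta>_def real_root_lt_1_iff simp del: power_Suc)
  have "N x \<le> \<theta>" if x: "x \<in> F" "N x < 1" for x
  proof (cases "x = 0")
    case False
    obtain f where f: "f \<noteq> 0" "\<forall>i. coeff f i \<in> \<rat>" "degree f \<le> n" "poly f x = 0" using deg[OF x(1)] by blast
    have "(\<Sum>i\<le>degree f. coeff f i * x ^ i) = 0" using f(4) by (simp add: poly_altdef)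
    from equal_norms[OF _ this, of "degree f"] f(1) False
    obtain i0 j0 where ij0: "i0 \<le> degree f" "j0 \<le> degree f" "i0 \<noteq> j0"
      "N (coeff f i0 * x ^ i0) = N (coeff f j0 * x ^ j0)"
      "coeff f i0 * x ^ i0 \<noteq> 0" by auto
    then have "coeff f i0 \<noteq> 0" "coeff f j0 \<noteq> 0" using N_eq_0_iff by (metis mult_eq_0_iff)+
    with ij0 obtain i j where ij: "i < j" "j \<le> n" "N (coeff f i * x ^ i) = N (coeff f j * x ^ j)"
      "coeff f i \<noteq> 0" "coeff f j \<noteq> 0" using f(3) by (metis le_trans nat_neq_iff)
    obtain m1 m1' m2 m2' where m: "N (coeff f i) * r ^ m1 = r ^ m1'" "N (coeff f j) * r ^ m2 = r ^ m2'"
      using N_rat_power[OF assms(1)] f(2) ij(4,5) unfolding r_def by metis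
    have Nx: "0 < N x" using False by (simp add: N_pos_iff)
    have "N (coeff f i) = N (coeff f j) * N x ^ (j - i)"
    proof -
      have "N (coeff f i) * N x ^ i = (N (coeff f j) * N x ^ (j - i)) * N x ^ i"
        using ij(1,3) by (simp add: N_mult N_power mult.assoc power_add[symmetric])
      then show ?thesis using Nx by simp
    qed
    then have "r ^ m1' * r ^ m2 = r ^ m2' * N x ^ (j - i) * r ^ m1"
      unfolding m[symmetric] by simp
    then have eq: "r ^ (m1' + m2) = r ^ (m2' + m1) * N x ^ (j - i)" by (simp add: power_add algebra_simps)
    have "N x ^ (j - i) < 1" using x(2) ij(1) Nx by (simp add: power_less_one_iff)
    then have "r ^ (m1' + m2) < r ^ (m2' + m1)" using eq r by simp
    then have "m2' + m1 < m1' + m2" using r by (simp add: power_strict_decreasing_iff)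
    then obtain e where e: "m1' + m2 = (m2' + m1) + Suc e" using less_imp_Suc_add by (metis add_Suc_right)
    have "N x ^ (j - i) = r ^ Suc e" using eq r unfolding e power_add[of r "m2' + m1"] by simp
    also have "\<dots> \<le> r" using r by (simp add: power_le_one mult_left_le)
    also have "\<dots> \<le> \<theta> ^ (j - i)" unfolding \<theta>(3)[symmetric] using \<theta>(1,2) ij(2) by (intro power_decreasing) auto
    finally have "N x ^ Suc (j - i - 1) \<le> \<theta> ^ Suc (j - i - 1)" using ij(1) by (metis Suc_diff_1 zero_less_diff)
    then show ?thesis using power_le_imp_le_base \<theta>(1) by (metis less_imp_le)
  qed (use \<theta> in simp)
  then show ?thesis using \<theta> by blast
qed

lemma discrete_number_field:
  assumes "prime p" "finite A" "A \<subseteq> {x. algebraic x}"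
  shows "\<exists>\<theta>. discrete_subfield (ncl (Q_adjoin A)) \<theta>"
proof -
  have "A \<subseteq> algebraic_over \<rat>" using assms(3) by (auto simp: algebraic_over_def algebraic_altdef)
  then obtain W where W: "finite W" "1 \<in> W" "A \<subseteq> stab \<rat> W"
    using finite_algebraic_stab[OF subfield_of_Rats_self assms(2)] by blast
  have "Q_adjoin A \<subseteq> stab \<rat> W"
    by (rule Q_adjoin_least[OF subfield_of_stab[OF subfield_of_Rats_self W(1,2)] W(3)]) simp
  then have "\<exists>f. f \<noteq> 0 \<and> (\<forall>i. coeff f i \<in> \<rat>) \<and> degree f \<le> card W \<and> poly f x = 0" if "x \<in> Q_adjoin A" for x
    using stab_algebraic[OF subfield_of_Rats_self W(1,2)] that by auto
  from discrete_bounded_degree[OF assms(1) this] obtain \<theta> where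
    \<theta>: "0 < \<theta>" "\<theta> < 1" "\<And>x. x \<in> Q_adjoin A \<Longrightarrow> N x < 1 \<Longrightarrow> N x \<le> \<theta>" by blast
  show ?thesis by (rule exI[of _ \<theta>], rule discrete_ncl[OF subfield_of_Q_adjoin \<theta>])
qed

end

section \<open>The \<open>p\<close>-adic exponential\<close>

context padic_complex
begin

text \<open>Zero is treated separately because \<open>real_of_ereal\<close> sends the infinite value
  to 0, which would give norm 1.\<close>

definition vnorm :: "'a \<Rightarrow> real" where
  "vnorm x = (if x = 0 then 0 else exp (- real_of_ereal (v x)))"

lemma v_finite: "x \<noteq> 0 \<Longrightarrow> v x = ereal (real_of_ereal (v x))"
  using v_eq_infinity_iff[of x] v_not_minus_infinity[of x] by (cases "v x") auto

lemma v_gt_iff: "v x > ereal M \<longleftrightarrow> vnorm x < exp (- M)"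
proof (cases "x = 0")
  case True
  then show ?thesis using v_eq_infinity_iff[of x] by (simp add: vnorm_def)
next
  case False
  then show ?thesis by (subst v_finite) (simp_all add: vnorm_def)
qed

lemma vnorm_antimono: "v x \<le> v y \<Longrightarrow> vnorm y \<le> vnorm x"
  using v_finite[of x] v_finite[of y] v_eq_infinity_iff[of x]
  by (cases "x = 0"; cases "y = 0") (auto simp: vnorm_def, metis ereal_less_eq(3))

lemma val_tendsto_iff: "val_tendsto v s l \<longleftrightarrow> (\<lambda>k. vnorm (s k - l)) \<longlonglongrightarrow> 0"
proof -
  have nn: "0 \<le> vnorm x" for x by (simp add: vnorm_def)
  show ?thesis unfolding val_tendsto_def tendsto_PInfty v_gt_iff
  proof (safe)
    assume *: "\<forall>r. \<forall>\<^sub>F k in sequentially. vnorm (s k - l) < exp (- r)"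
    show "(\<lambda>k. vnorm (s k - l)) \<longlonglongrightarrow> 0"
    proof (rule tendstoI)
      fix e :: real assume "e > 0"
      then show "\<forall>\<^sub>F k in sequentially. dist (vnorm (s k - l)) 0 < e"
        using *[rule_format, of "- ln e"] nn by simp
    qed
  next
    fix r assume "(\<lambda>k. vnorm (s k - l)) \<longlonglongrightarrow> 0"
    then show "\<forall>\<^sub>F k in sequentially. vnorm (s k - l) < exp (- r)"
      by (rule order_tendstoD(2)) simp
  qed
qed

lemma vnorm_p: "vnorm (of_nat p) = exp (- 1)"
  using prime_gt_0_nat[OF prime_p] by (simp add: vnorm_def v_p)

sublocale nonarch_field vnorm p
proof
  fix x y :: 'a and s :: "nat \<Rightarrow> 'a"
  show "0 \<le> vnorm x" "vnorm x = 0 \<longleftrightarrow> x = 0" by (auto simp: vnorm_def)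
  show "vnorm (x * y) = vnorm x * vnorm y"
  proof (cases "x = 0 \<or> y = 0")
    case False
    then have "v (x * y) = ereal (real_of_ereal (v x) + real_of_ereal (v y))"
      using v_finite[of x] v_finite[of y] v_mult[of x y] by (metis plus_ereal.simps(1))
    then show ?thesis using False by (simp add: vnorm_def exp_add[symmetric])
  qed (auto simp: vnorm_def)
  show "vnorm (x + y) \<le> max (vnorm x) (vnorm y)"
    using v_add[of x y] vnorm_antimono[of x "x + y"] vnorm_antimono[of y "x + y"]
    by (auto simp: min_def max_def split: if_splits)
  show "0 < p" using prime_gt_0_nat[OF prime_p] .
  show "vnorm (of_nat p) < 1" by (simp add: vnorm_p)
  assume s: "\<And>e. 0 < e \<Longrightarrow> \<exists>M. \<forall>i\<ge>M. \<forall>j\<ge>M. vnorm (s i - s j) < e"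
  have "val_Cauchy v s" unfolding val_Cauchy_def v_gt_iff using s by simp
  from complete[OF this] show "\<exists>l. (\<lambda>i. vnorm (s i - l)) \<longlonglongrightarrow> 0" by (simp add: val_tendsto_iff)
qed

lemma val_closure_eq: "val_closure v F = ncl F"
proof (rule set_eqI)
  fix x
  have "(\<forall>M. \<exists>y\<in>F. vnorm (x - y) < exp (- M)) \<longleftrightarrow> (\<forall>e>0. \<exists>y\<in>F. vnorm (x - y) < e)"
  proof safe
    fix e :: real assume "\<forall>M. \<exists>y\<in>F. vnorm (x - y) < exp (- M)" "e > 0"
    then show "\<exists>y\<in>F. vnorm (x - y) < e" by (metis exp_ln minus_minus)
  qed simp
  then show "x \<in> val_closure v F \<longleftrightarrow> x \<in> ncl F"
    unfolding val_closure_def mem_Collect_eq v_gt_iff ncl_iff .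
qed

lemma alg_closed_ambient: "degree (q :: 'a poly) \<ge> 1 \<Longrightarrow> \<exists>x. poly q x = 0"
proof (rule alg_closed_ncl[of "Qp_bar v"])
  show "subfield_of (Qp_bar v)" unfolding Qp_bar_def Qp_def val_closure_eq
    by (intro subfield_of_algebraic_over subfield_of_ncl subfield_of_Rats_self)
  show "ncl (Qp_bar v) = UNIV" using Qp_bar_dense by (simp add: val_closure_eq)
qed (use Qp_bar_closed in auto)

text \<open>The completions of number fields inside the ambient field; joining finite sets of
  generators makes the family directed.\<close>

definition coefficient_fields :: "'a set set" where
  "coefficient_fields = {ncl (Q_adjoin A) | A. finite A \<and> A \<subseteq> {x. algebraic x}}"

sublocale power_series_family vnorm p coefficient_fields "ncl (Q_adjoin {})"
proof
  show "\<exists>\<theta>. discrete_subfield K \<theta>" if "K \<in> coefficient_fields" for K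
    using that discrete_number_field[OF prime_p] by (auto simp: coefficient_fields_def)
  show "\<exists>K''\<in>coefficient_fields. K \<union> K' \<subseteq> K''" if KK: "K \<in> coefficient_fields" "K' \<in> coefficient_fields" for K K'
  proof -
    obtain A A' where A: "K = ncl (Q_adjoin A)" "finite A" "A \<subseteq> {x. algebraic x}"
      "K' = ncl (Q_adjoin A')" "finite A'" "A' \<subseteq> {x. algebraic x}"
      using KK unfolding coefficient_fields_def by blast
    have "ncl (Q_adjoin (A \<union> A')) \<in> coefficient_fields"
      unfolding coefficient_fields_def mem_Collect_eq using A by (intro exI[of _ "A \<union> A'"]) auto
    moreover have "K \<union> K' \<subseteq> ncl (Q_adjoin (A \<union> A'))"
      unfolding A(1,4) by (intro Un_least ncl_mono Q_adjoin_mono) auto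
    ultimately show ?thesis by blast
  qed
  show "ncl (Q_adjoin {}) \<in> coefficient_fields" unfolding coefficient_fields_def by blast
  show "ncl (Q_adjoin {}) \<subseteq> K" if "K \<in> coefficient_fields" for K
    using that ncl_mono[OF Q_adjoin_mono[of "{}"]] unfolding coefficient_fields_def by blast
  show "\<exists>x. poly q x = 0" if "degree q \<ge> 1" for q :: "'a poly" using alg_closed_ambient[OF that] .
qed

lemma algebraic_coefficient_field: "algebraic x \<Longrightarrow> \<exists>K\<in>coefficient_fields. x \<in> K"
  unfolding coefficient_fields_def using ncl_superset[of "Q_adjoin {x}"] Q_adjoin_superset[of "{x}"] by blast

text \<open>Legendre's recursion: among \<open>1, ..., j\<close> only the multiples
  \<open>p * m\<close> with \<open>m \<le> j div p\<close> have norm below 1, and each contributes a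
  factor \<open>exp (-1)\<close> besides the norm of \<open>m\<close>.\<close>

lemma fact_div_norm: "vnorm (fact j) = exp (-1) ^ (j div p) * vnorm (fact (j div p))"
proof (induction j)
  case (Suc j)
  have "vnorm (fact (Suc j)) = vnorm (of_nat (Suc j)) * vnorm (fact j)" by (simp add: N_mult)
  also have "\<dots> = exp (-1) ^ (Suc j div p) * vnorm (fact (Suc j div p))"
  proof (cases "p dvd Suc j")
    case True
    then obtain m where m: "Suc j = p * m" by (auto elim: dvdE)
    then have m0: "m > 0" by (cases m) auto
    have sd: "Suc j div p = m" using m p_pos by simp
    moreover have "Suc j div p = Suc (j div p)" using True by (simp add: div_Suc mod_eq_0_iff_dvd)
    ultimately have jd: "j div p = m - 1" by simp
    obtain k where k: "m = Suc k" using m0 by (cases m) auto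
    have "vnorm (of_nat (Suc j)) = exp (-1) * vnorm (of_nat m)" unfolding m by (simp add: N_mult vnorm_p)
    moreover have "vnorm (fact (Suc k)) = vnorm (of_nat (Suc k)) * vnorm (fact k)" by (simp only: fact_Suc N_mult)
    ultimately show ?thesis unfolding Suc.IH sd jd k
      by (simp del: fact_Suc of_nat_Suc add: algebra_simps)
  next
    case False
    then have "Suc j div p = j div p" by (simp add: div_Suc mod_eq_0_iff_dvd)
    then show ?thesis using N_coprime[OF prime_p False] Suc.IH by simp
  qed
  finally show ?case .
qed simp

text \<open>The multiplicative form of Legendre's estimate for \<open>v (fact j)\<close>; the power
  \<open>p - 1\<close> avoids fractional exponents. With \<open>d = j div p\<close>, the recursion
  combines with \<open>d * p = d * (p - 1) + d\<close>.\<close>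

lemma fact_norm: "exp (-1) ^ j \<le> vnorm (fact j) ^ (p - 1)"
proof (induction j rule: less_induct)
  case (less j)
  show ?case
  proof (cases "j = 0")
    case False
    let ?d = "j div p" and ?e = "exp (-1) :: real"
    have p1: "p > 1" using prime_gt_1_nat[OF prime_p] .
    have IH: "?e ^ ?d \<le> vnorm (fact ?d) ^ (p - 1)" using False p1 by (intro less.IH) simp
    have "?d * p \<le> j" by (metis div_times_less_eq_dividend)
    then have "?e ^ j \<le> ?e ^ (?d * p)" by (intro power_decreasing) auto
    also have "?d * p = ?d * (p - 1) + ?d" using p1 by (cases p) auto
    also have "?e ^ (?d * (p - 1) + ?d) = (?e ^ ?d) ^ (p - 1) * ?e ^ ?d" by (simp add: power_add power_mult)
    also have "\<dots> \<le> (?e ^ ?d) ^ (p - 1) * vnorm (fact ?d) ^ (p - 1)" using IH by simp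
    also have "\<dots> = vnorm (fact j) ^ (p - 1)" unfolding fact_div_norm[of j] by (simp add: power_mult_distrib)
    finally show ?thesis .
  qed simp
qed

text \<open>Every such root has valuation \<open>1 / (p - 1)\<close>, the bound in
  \<open>Dp\<close>, so dividing by it turns \<open>Dp p v\<close> into the open unit disc. Being
  algebraic, it belongs to a coefficient field.\<close>

definition uniformiser :: 'a where
  "uniformiser = (SOME x. x ^ (p - 1) = of_nat p)"

lemma uniformiser_power: "uniformiser ^ (p - 1) = of_nat p"
proof -
  have p1: "p - 1 \<ge> 1" using prime_gt_1_nat[OF prime_p] by simp
  define q :: "'a poly" where "q = monom 1 (p - 1) + [:- of_nat p:]"
  have "degree q = p - 1" unfolding q_def using p1 by (subst degree_add_eq_left) (auto simp: degree_monom_eq)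
  then obtain x where "poly q x = 0" using alg_closed_ambient[of q] p1 by auto
  then have "x ^ (p - 1) = of_nat p" by (simp add: q_def poly_monom)
  then show ?thesis unfolding uniformiser_def by (rule someI)
qed

lemma uniformiser_norm: "vnorm uniformiser ^ (p - 1) = exp (-1)" "vnorm uniformiser \<le> 1" "uniformiser \<noteq> 0"
proof -
  have p1: "p - 1 \<noteq> 0" using prime_gt_1_nat[OF prime_p] by simp
  show 1: "vnorm uniformiser ^ (p - 1) = exp (-1)" using uniformiser_power
    by (simp add: N_power[symmetric] vnorm_p)
  show "uniformiser \<noteq> 0" using 1 p1 by (auto simp: power_0_left)
  show "vnorm uniformiser \<le> 1"
  proof (rule ccontr)
    assume "\<not> ?thesis"
    then have "1 \<le> vnorm uniformiser ^ (p - 1)" by (intro one_le_power) simp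
    then show False using 1 by simp
  qed
qed

lemma algebraic_uniformiser: "algebraic uniformiser"
proof (rule algebraicI')
  define q :: "'a poly" where "q = monom 1 (p - 1) + [:- of_nat p:]"
  have p1: "p - 1 \<ge> 1" using prime_gt_1_nat[OF prime_p] by simp
  have "degree q = p - 1" unfolding q_def using p1 by (subst degree_add_eq_left) (auto simp: degree_monom_eq)
  then show "q \<noteq> 0" using p1 by auto
  show "coeff q i \<in> \<rat>" for i by (auto simp: q_def coeff_pCons split: nat.splits)
  show "poly q uniformiser = 0" using uniformiser_power by (simp add: q_def poly_monom)
qed

lemma Dp_iff: "z \<in> Dp p v \<longleftrightarrow> vnorm (z / uniformiser) < 1"
proof -
  have p1: "p > 1" using prime_gt_1_nat[OF prime_p] .
  have "exp (- (1 / (real p - 1))) ^ (p - 1) = exp (-1)"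
    using p1 by (simp add: exp_of_nat_mult[symmetric] of_nat_diff)
  then have "exp (- (1 / (real p - 1))) = vnorm uniformiser"
    using uniformiser_norm(1) p1 power_eq_iff_eq_base[of "p - 1" "exp (- (1 / (real p - 1)))" "vnorm uniformiser"]
    by (simp add: N_nonneg)
  then show ?thesis unfolding Dp_def mem_Collect_eq v_gt_iff
    using uniformiser_norm(3) by (simp add: N_divide N_pos_iff)
qed

section \<open>The exponential as an integral power series\<close>

lemma padic_exp_eq: "nsums (\<lambda>j. x ^ j / fact j) l \<Longrightarrow> padic_exp v x = l"
  unfolding padic_exp_def val_tendsto_iff nlim_def[symmetric] nsums_def[symmetric]
  using nsums_unique by blast

lemma exp_coefficient_le: "vnorm (uniformiser ^ j / fact j) \<le> 1"
proof -
  obtain k where k: "p - 1 = Suc k" using prime_gt_1_nat[OF prime_p] by (cases "p - 1") auto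
  have "(vnorm uniformiser ^ j) ^ (p - 1) = exp (-1) ^ j"
    by (simp add: uniformiser_norm(1)[symmetric] power_mult[symmetric] mult.commute)
  then have "(vnorm uniformiser ^ j) ^ (p - 1) \<le> vnorm (fact j) ^ (p - 1)" using fact_norm by simp
  then have "vnorm uniformiser ^ j \<le> vnorm (fact j)" unfolding k by (rule power_le_imp_le_base) (rule N_nonneg)
  then show ?thesis by (simp add: N_divide N_power N_pos_iff)
qed

text \<open>The coefficients \<open>uniformiser ^ j / fact j\<close> are integral, so the sum
  belongs to the ring. Its constant term is 1, so it differs from 1 by an element of the maximal
  ideal and never vanishes on \<open>Delta\<close>.\<close>

lemma padic_exp_power_series:
  assumes i: "i < n"
  shows "(\<lambda>t. padic_exp v (uniformiser * t i)) \<in> B n" "t \<in> Delta \<Longrightarrow> padic_exp v (uniformiser * t i) \<noteq> 0"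
proof -
  obtain K where KK: "K \<in> coefficient_fields" "uniformiser \<in> K"
    using algebraic_coefficient_field[OF algebraic_uniformiser] by blast
  obtain \<theta> where "power_series_ring vnorm p K \<theta>" using ring_instance[OF KK(1)] by blast
  then interpret R: power_series_ring vnorm p K \<theta> .
  define c where "c j = uniformiser ^ j / fact j" for j
  have "fact j \<in> K" for j
    using subfield_of_Rats[OF R.K] by (metis Rats_of_nat of_nat_fact subsetD)
  then have c: "c j \<in> K" "vnorm (c j) \<le> \<theta> ^ 0" for j
    using KK(2) exp_coefficient_le by (auto simp: c_def intro!: R.K')
  have h: "(\<lambda>t. c j * t i ^ j) \<in> R.I n j" for j
    using R.I_scale[OF c R.I_power[OF R.I_var[OF i]], of j j] by simp
  obtain F where F: "\<And>t. t \<in> Delta \<Longrightarrow> nsums (\<lambda>j. c j * t i ^ j) (F t)"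
    using R.I_sums_exists[of "\<lambda>j t. c j * t i ^ j" n 0] h by auto
  have F_I: "F \<in> R.I n 0"
    by (rule R.I_complete[where h = "\<lambda>j t. c j * t i ^ j" and s = 0]) (use h F in simp_all)
  have eq: "padic_exp v (uniformiser * t i) = F t" if "t \<in> Delta" for t
  proof (rule padic_exp_eq)
    show "nsums (\<lambda>j. (uniformiser * t i) ^ j / fact j) (F t)"
      using F[OF that] by (simp add: c_def power_mult_distrib)
  qed
  show "(\<lambda>t. padic_exp v (uniformiser * t i)) \<in> B n"
    by (rule B_I[OF R.I_cong[OF F_I eq] KK(1)])
  have "nsums (\<lambda>j. c j * 0 ^ j) 1" using nsums_finite[of 1 "\<lambda>j. c j * 0 ^ j"] by (simp add: c_def)
  then have F0: "F (\<lambda>i. 0) = 1" using F[OF zero_in_Delta] nsums_unique by blast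
  have "(\<lambda>t. F t - 1) \<in> R.I n 1" by (rule R.I_maximal[OF R.I_diff[OF F_I R.I_1]]) (simp add: F0)
  then have "vnorm (F t - 1) < 1" if "t \<in> Delta" for t by (rule R.I_bound_less[OF that])
  then show "padic_exp v (uniformiser * t i) \<noteq> 0" if "t \<in> Delta"
    using eq[OF that] that by (metis N_1 N_minus diff_0 less_irrefl)
qed

section \<open>Proof of the theorem\<close>

text \<open>The supremum may be infinite, so only a family of at least \<open>k\<close> elements is
  claimed. For positive \<open>k\<close> some size exceeds the predecessor of \<open>k\<close>; for
  \<open>k = 0\<close> the empty family is independent, because a polynomial without variables is
  its constant term.\<close>

lemma trdeg_Q_ge:
  assumes "enat k \<le> trdeg_Q L"
  shows "\<exists>m\<ge>k. \<exists>b. (\<forall>i<m. b i \<in> L) \<and> algebraically_independent \<rat> m b"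
proof (cases k)
  case 0
  have "algebraically_independent \<rat> 0 b" for b :: "nat \<Rightarrow> 'b::field_char_0"
  proof -
    have "P = 0" if P: "mpol_vars P \<subseteq> {..<0}" "mpol_eval b P = 0" for P :: "(nat, 'b) mpol"
    proof -
      have "Poly_Mapping.keys P \<subseteq> {0}" using P(1) by (auto simp: mpol_vars_def)
      then have "mpol_eval b P = Poly_Mapping.lookup P 0"
        by (subst mpol_eval_superset[of "{0}"]) auto
      then have "Poly_Mapping.lookup P m = 0" for m
        using P(2) \<open>Poly_Mapping.keys P \<subseteq> {0}\<close> by (metis in_keys_iff singletonD subsetD)
      then show ?thesis by (intro poly_mapping_eqI) simp
    qed
    then show ?thesis unfolding algebraically_independent_def by blast
  qed
  then show ?thesis using 0 by blast
next
  case (Suc l)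
  then have "enat l < trdeg_Q L" using assms by (metis Suc_ile_eq)
  then obtain m where m: "enat l < enat m" "\<exists>b. (\<forall>i<m. b i \<in> L) \<and> algebraically_independent \<rat> m b"
    unfolding trdeg_Q_def less_Sup_iff by blast
  then show ?thesis using Suc by (intro exI[of _ m]) auto
qed

lemma integer_relation:
  fixes z :: "nat \<Rightarrow> 'b::field_char_0"
  assumes "\<not> Q_linearly_independent n z"
  shows "\<exists>m :: nat \<Rightarrow> int. (\<exists>i<n. m i \<noteq> 0) \<and> (\<Sum>i<n. of_int (m i) * z i) = 0"
proof -
  obtain c :: "nat \<Rightarrow> rat" and i0 where c: "(\<Sum>i<n. of_rat (c i) * z i) = 0" "i0 < n" "c i0 \<noteq> 0"
    using assms by (auto simp: Q_linearly_independent_def)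
  define den where "den i = snd (quotient_of (c i))" for i
  define D where "D = (\<Prod>i<n. den i)"
  have den: "den i > 0" for i by (simp add: den_def quotient_of_denom_pos')
  have num: "c i = of_int (fst (quotient_of (c i))) / of_int (den i)" for i
    unfolding den_def by (rule quotient_of_div) simp
  define m where "m i = fst (quotient_of (c i)) * (\<Prod>j\<in>{..<n}-{i}. den j)" for i
  have m: "of_int (m i) = of_int D * c i" if "i < n" for i
  proof -
    have "D = den i * (\<Prod>j\<in>{..<n}-{i}. den j)" using that by (simp add: D_def prod.remove)
    then show ?thesis using den[of i] by (subst num) (simp add: m_def)
  qed
  have "of_int (m i) = of_int D * (of_rat (c i) :: 'b)" if "i < n" for i
    using arg_cong[OF m[OF that], of "of_rat :: rat \<Rightarrow> 'b"] by (simp add: of_rat_mult)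
  then have "(\<Sum>i<n. of_int (m i) * z i) = of_int D * (\<Sum>i<n. of_rat (c i) * z i)"
    by (simp add: sum_distrib_left mult.assoc)
  moreover have "D > 0" unfolding D_def by (intro prod_pos) (simp add: den)
  then have "m i0 \<noteq> 0" using m[OF c(2)] c(3) by auto
  ultimately show ?thesis using c by auto
qed

theorem finitely_many_subspaces:
  fixes V :: "(('a ^ 'n) \<times> ('a ^ 'n)) set"
  assumes V: "closed_defined_over {x. algebraic x} V"
    and dim: "variety_dim V < enat CARD('n)"
    and schanuel: "padic_schanuel p v"
  shows "\<exists>\<L> :: ('a ^ 'n) set set. finite \<L> \<and> (\<forall>L\<in>\<L>. proper_Q_subspace L) \<and>
           (\<forall>z. (\<forall>i. z $ i \<in> Dp p v) \<longrightarrow> (z, \<chi> i. padic_exp v (z $ i)) \<in> V \<longrightarrow> (\<exists>L\<in>\<L>. z \<in> L))"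
proof -
  define n where "n = CARD('n)"
  \<comment> \<open>The series use variables numbered by naturals, so the coordinates indexed by the
    finite type are renumbered.\<close>
  obtain ix :: "'n \<Rightarrow> nat" where ix: "bij_betw ix UNIV {..<n}"
    using ex_bij_betw_finite_nat[of "UNIV :: 'n set"] by (auto simp: n_def atLeast0LessThan)
  have ix_lt: "ix i < n" for i using ix by (auto simp: bij_betw_def)
  define xi where "xi = the_inv_into UNIV ix"
  have xi: "xi (ix i) = i" for i using ix by (simp add: xi_def bij_betw_def the_inv_into_f_f)
  have ix': "ix (xi j) = j" if "j < n" for j
    using ix that unfolding xi_def by (metis bij_betw_def f_the_inv_into_f lessThan_iff)
  have reindex: "(\<Sum>i\<in>UNIV. g (ix i)) = (\<Sum>j<n. g j)" for g :: "nat \<Rightarrow> 'a"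
    using sum.reindex_bij_betw[OF ix, of g] .
  define pt where "pt z = (z, \<chi> i. padic_exp v (z $ i))" for z :: "'a ^ 'n"
  have relation: "\<exists>m. m \<noteq> 0 \<and> (\<Sum>i\<in>UNIV. of_int (m $ i) * z $ i) = 0"
    if z: "\<forall>i. z $ i \<in> Dp p v" "pt z \<in> V" for z
  proof (rule ccontr)
    assume none: "\<not> ?thesis"
    define y where "y j = z $ xi j" for j
    have "Q_linearly_independent n y"
    proof (rule ccontr)
      assume "\<not> Q_linearly_independent n y"
      then obtain m :: "nat \<Rightarrow> int" and i0 where m: "i0 < n" "m i0 \<noteq> 0" "(\<Sum>i<n. of_int (m i) * y i) = 0"
        using integer_relation by blast
      define m' where "m' = ((\<chi> i. m (ix i)) :: int ^ 'n)"
      have "m' $ xi i0 \<noteq> 0" using m by (simp add: m'_def ix')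
      then have "m' \<noteq> 0" by auto
      moreover have "(\<Sum>i\<in>UNIV. of_int (m' $ i) * z $ i) = 0"
        using m(3) reindex[of "\<lambda>j. of_int (m j) * y j"] by (simp add: m'_def y_def xi)
      ultimately show False using none by blast
    qed
    moreover have "\<forall>j<n. y j \<in> Dp p v" using z(1) by (simp add: y_def)
    moreover have "n \<ge> 1" by (simp add: n_def Suc_leI)
    ultimately have "enat n \<le> trdeg_Q (Q_adjoin (y ` {..<n} \<union> (\<lambda>i. padic_exp v (y i)) ` {..<n}))"
      using schanuel unfolding padic_schanuel_def by blast
    then obtain m b where b: "m \<ge> n" "\<forall>i<m. b i \<in> Q_adjoin (y ` {..<n} \<union> (\<lambda>i. padic_exp v (y i)) ` {..<n})"
      "algebraically_independent \<rat> m b" using trdeg_Q_ge by blast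
    have "y ` {..<n} \<union> (\<lambda>i. padic_exp v (y i)) ` {..<n} \<subseteq> range (coords (pt z))"
    proof -
      have "y j = coords (pt z) (Inl (xi j))" "padic_exp v (y j) = coords (pt z) (Inr (xi j))" for j
        by (simp_all add: coords_def pt_def y_def)
      then show ?thesis by auto
    qed
    then have "\<forall>i<m. b i \<in> Q_adjoin (range (coords (pt z)))" using b(2) Q_adjoin_mono by blast
    moreover have "alg_closed_set (UNIV :: 'a set)"
      unfolding alg_closed_set_def using alg_closed_ambient by (auto simp: subfield_of_def)
    ultimately have "enat m \<le> variety_dim V" using variety_dim_ge V z(2) b(3) by blast
    then have "enat m < enat n" using dim unfolding n_def by (rule le_less_trans)
    then show False using b(1) by simp
  qed
  define w where "w t = (\<chi> i. uniformiser * t (ix i))" for t :: "nat \<Rightarrow> 'a"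
  define Z where "Z = {t \<in> Delta. pt (w t) \<in> V}"
  \<comment> \<open>The hyperplanes are written in the scaled coordinates \<open>t\<close>: the
    nonzero factor \<open>uniformiser\<close> does not change them, and integer coefficients are
    integral.\<close>
  define lin where "lin m t = (\<Sum>i\<in>UNIV. of_int (m $ i) * t (ix i))" for m :: "int ^ 'n" and t :: "nat \<Rightarrow> 'a"
  define X where "X = lin ` {m. m \<noteq> 0}"
  have w_Dp: "w t $ i \<in> Dp p v" if "t \<in> Delta" for t i
    using that uniformiser_norm(3) by (simp add: w_def Dp_iff Delta_def)
  have lin_w: "(\<Sum>i\<in>UNIV. of_int (m $ i) * w t $ i) = uniformiser * lin m t" for m t
    by (simp add: w_def lin_def sum_distrib_left algebra_simps)
  obtain S where S: "\<forall>P\<in>S. mpol_coeffs_in {x. algebraic x} P" "V = {q \<in> GaGm. \<forall>P\<in>S. mpol_eval (coords q) P = 0}"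
    using V unfolding closed_defined_over_def by blast
  have "\<exists>Y\<subseteq>X. finite Y \<and> (\<forall>t\<in>Z. \<exists>g\<in>Y. g t = 0)"
  proof (rule countable_cover_finite[where n = n])
    show "Z \<subseteq> Delta" by (auto simp: Z_def)
    show "countable X" unfolding X_def by simp
    show "X \<subseteq> B n"
    proof
      fix g assume "g \<in> X"
      then obtain m where g: "g = lin m" by (auto simp: X_def)
      have "of_int k \<in> ncl (Q_adjoin {})" for k
        using ncl_superset subfield_of_Rats[OF subfield_of_Q_adjoin[of "{}"]] by (metis Rats_of_int subsetD)
      then have "(\<lambda>t. of_int k) \<in> B n" for k using K0(1) N_of_int_le by (intro B_const)
      then have "(\<Sum>i\<in>UNIV. (\<lambda>t. of_int (m $ i)) * (\<lambda>t. t (ix i))) \<in> B n"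
        by (intro subring_of_sum[OF subring_of_B] B_ring(5) B_var ix_lt)
      moreover have "(\<Sum>i\<in>UNIV. (\<lambda>t. of_int (m $ i)) * (\<lambda>t. t (ix i))) = g"
        by (rule ext) (simp add: g lin_def sum_fun_apply)
      ultimately show "g \<in> B n" by simp
    qed
    show "\<exists>g\<in>X. g t = 0" if t: "t \<in> Z" for t
    proof -
      have t': "t \<in> Delta" "pt (w t) \<in> V" using t by (auto simp: Z_def)
      from relation[OF _ t'(2)] w_Dp[OF t'(1)] obtain m where "m \<noteq> 0" "uniformiser * lin m t = 0"
        unfolding lin_w by blast
      then show ?thesis using uniformiser_norm(3) by (auto simp: X_def)
    qed
    \<comment> \<open>It remains to see that \<open>Z\<close> is a common zero set of series. The
      exponentials never vanish, so only the equations of \<open>V\<close> have to be expressed by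
      members of \<open>B n\<close>.\<close>
    fix t assume t: "t \<in> Delta" and van: "\<And>f. f \<in> B n \<Longrightarrow> (\<And>z. z \<in> Z \<Longrightarrow> f z = 0) \<Longrightarrow> f t = 0"
    have "pt (w t) \<in> GaGm"
      using padic_exp_power_series(2)[OF ix_lt t] by (auto simp: GaGm_def pt_def w_def)
    moreover have "mpol_eval (coords (pt (w t))) P = 0" if P: "P \<in> S" for P
    proof -
      define co where "co j = (\<lambda>t. coords (pt (w t)) j)" for j
      obtain KU where KU: "KU \<in> coefficient_fields" "uniformiser \<in> KU"
        using algebraic_coefficient_field[OF algebraic_uniformiser] by blast
      have co_Inl: "co (Inl i) = (\<lambda>t. uniformiser) * (\<lambda>t. t (ix i))" for i
        by (rule ext) (simp add: co_def coords_def pt_def w_def)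
      have co_Inr: "co (Inr i) = (\<lambda>t. padic_exp v (uniformiser * t (ix i)))" for i
        by (rule ext) (simp add: co_def coords_def pt_def w_def)
      have co: "co j \<in> B n" for j
      proof (cases j)
        case (Inl i)
        have "(\<lambda>t. uniformiser) \<in> B n" by (rule B_const[OF KU uniformiser_norm(2)])
        then show ?thesis unfolding Inl co_Inl by (intro B_ring(5) B_var ix_lt)
      next
        case (Inr i)
        show ?thesis unfolding Inr co_Inr by (rule padic_exp_power_series(1)[OF ix_lt])
      qed
      \<comment> \<open>The coefficients of \<open>P\<close> need not be integral; multiplying the
        equation by a power of \<open>p\<close> makes them so without changing its zeros.\<close>
      obtain k where k: "\<And>m. m \<in> Poly_Mapping.keys P \<Longrightarrow> vnorm (of_nat p ^ k * Poly_Mapping.lookup P m) \<le> 1"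
      proof -
        define C where "C = Max (insert 1 ((\<lambda>m. vnorm (Poly_Mapping.lookup P m)) ` Poly_Mapping.keys P))"
        have C: "1 \<le> C" "\<And>m. m \<in> Poly_Mapping.keys P \<Longrightarrow> vnorm (Poly_Mapping.lookup P m) \<le> C"
          unfolding C_def by (auto intro!: Max_ge)
        obtain k where k: "vnorm (of_nat p ^ k) < 1 / C" using small_element[of "1 / C"] C(1) by auto
        show ?thesis
        proof (rule that[of k])
          fix m assume "m \<in> Poly_Mapping.keys P"
          then have "vnorm (of_nat p ^ k) * vnorm (Poly_Mapping.lookup P m) \<le> 1 / C * C"
            using C k by (intro mult_mono) (auto simp: N_nonneg)
          then show "vnorm (of_nat p ^ k * Poly_Mapping.lookup P m) \<le> 1" using C(1) by (simp add: N_mult)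
        qed
      qed
      have cB: "(\<lambda>t. of_nat p ^ k * Poly_Mapping.lookup P m) \<in> B n" if m: "m \<in> Poly_Mapping.keys P" for m
      proof -
        have "algebraic (Poly_Mapping.lookup P m)" using S(1) P by (auto simp: mpol_coeffs_in_def)
        then obtain K where KK: "K \<in> coefficient_fields" "Poly_Mapping.lookup P m \<in> K"
          using algebraic_coefficient_field by blast
        obtain \<theta> where "power_series_ring vnorm p K \<theta>" using ring_instance[OF KK(1)] by blast
        then interpret R: power_series_ring vnorm p K \<theta> .
        have "of_nat p ^ k * Poly_Mapping.lookup P m \<in> K"
          using subfield_of_Rats[OF R.K] by (intro R.K'(5) KK(2)) auto
        then show ?thesis by (rule B_const[OF KK(1) _ k[OF m]])
      qed
      define f where "f = (\<Sum>m\<in>Poly_Mapping.keys P. (\<lambda>t. of_nat p ^ k * Poly_Mapping.lookup P m) *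
        (\<Prod>x\<in>Poly_Mapping.keys m. co x ^ Poly_Mapping.lookup m x))"
      have prod_fun: "(\<Prod>x\<in>A. g x) t = (\<Prod>x\<in>A. g x t)" for A :: "('n + 'n) set" and g ::
        "'n + 'n \<Rightarrow> (nat \<Rightarrow> 'a) \<Rightarrow> 'a" and t
        by (induction A rule: infinite_finite_induct) auto
      have f: "f t = of_nat p ^ k * mpol_eval (coords (pt (w t))) P" for t
        by (simp add: f_def sum_fun_apply prod_fun power_fun_apply co_def mpol_eval_def sum_distrib_left
          mult.assoc)
      have "f t = 0"
      proof (rule van)
        show "f \<in> B n" unfolding f_def
          by (intro subring_of_sum[OF subring_of_B] B_ring(5) cB subring_of_prod[OF subring_of_B] B_ring(7) co)
        show "f z = 0" if "z \<in> Z" for z using that P by (simp add: f Z_def S(2))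
      qed
      then show ?thesis using p_pos by (simp add: f)
    qed
    ultimately show "t \<in> Z" using t by (simp add: Z_def S(2))
  qed
  then obtain Y where Y: "Y \<subseteq> X" "finite Y" "\<forall>t\<in>Z. \<exists>g\<in>Y. g t = 0" by blast
  obtain Ms where Ms: "Ms \<subseteq> {m. m \<noteq> 0}" "finite Ms" "Y = lin ` Ms"
    using finite_subset_image[OF Y(2) Y(1)[unfolded X_def]] by blast
  define H where "H m = {x :: 'a ^ 'n. (\<Sum>i\<in>UNIV. of_int (m $ i) * x $ i) = 0}" for m :: "int ^ 'n"
  have "proper_Q_subspace (H m)" if "m \<in> Ms" for m
    unfolding proper_Q_subspace_def H_def using that Ms(1) by (intro exI[of _ "{m}"]) auto
  moreover have "\<exists>L\<in>H ` Ms. z \<in> L" if z: "\<forall>i. z $ i \<in> Dp p v" "(z, \<chi> i. padic_exp v (z $ i)) \<in> V" for z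
  proof -
    define t where "t j = z $ xi j / uniformiser" for j
    have t: "t \<in> Delta" using z(1) by (simp add: Delta_def t_def Dp_iff)
    have wt: "w t = z" using uniformiser_norm(3) by (simp add: w_def t_def xi vec_eq_iff)
    have "t \<in> Z" using t z(2) by (simp add: Z_def wt pt_def)
    then obtain m where m: "m \<in> Ms" "lin m t = 0" using Y(3) Ms(3) by blast
    then have "z \<in> H m" using lin_w[of m t] by (simp add: H_def wt)
    then show ?thesis using m(1) by blast
  qed
  ultimately show ?thesis using Ms(2) by (intro exI[of _ "H ` Ms"]) auto
qed

end

theorem theorem1p2:
  fixes p :: nat
    and v :: "'a::field_char_0 \<Rightarrow> ereal"
    and V :: "(('a ^ 'n) \<times> ('a ^ 'n)) set"
  assumes "padic_complex p v"
    and "irreducible_closed V"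
    and "closed_defined_over {x. algebraic x} V"
    and "variety_dim V < enat CARD('n)"
    and "padic_schanuel p v"
  shows "\<exists>\<L> :: ('a ^ 'n) set set. finite \<L> \<and> (\<forall>L\<in>\<L>. proper_Q_subspace L) \<and>
           (\<forall>z. (\<forall>i. z $ i \<in> Dp p v) \<longrightarrow> (z, \<chi> i. padic_exp v (z $ i)) \<in> V \<longrightarrow>
                (\<exists>L\<in>\<L>. z \<in> L))"
  by (rule padic_complex.finitely_many_subspaces[OF assms(1,3-5)])

end
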